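(* Let $t_T:=\sup\{s\ge0:\operatorname{ess\,sup}_{v\in\mathbb{X}}\mathbb{E}_s|V^v|<\infty\}$ and let $0\le t<t_T$. For $v\in\mathbb{X}$ and $r\ge0$ put $$\phi^v_t(r):=1-\exp\Big(-t\int_{\{x:\,d(v,x)>r\}}\varphi(v,x)\,\lambda(dx)\Big),\qquad \phi^*_t(r):=\operatorname*{ess\,sup}_{v\in\mathbb{X}}\phi^v_t(r).$$ If $\phi^*_t(r)$ decays exponentially as $r\to\infty$ (i.e. $\phi_t^*(r)\le ae^{-br}$ for some $a,b>0$ and all large $r$), then there exists $\delta>0$ such that $$\operatorname*{ess\,sup}_{v\in\mathbb{X}}\ \mathbb{E}_t\,e^{\delta D(V^v)}<\infty .$$
   Context: $(\mathbb{X},d)$ is a complete separable metric space with its Borel $\sigma$-field, and $\lambda$ is a locally finite (finite on bounded sets), diffuse measure on $\mathbb{X}$. The connection function $\varphi:\mathbb{X}^2\to[0,1]$ is measurable and symmetric with $\int\varphi(x,y)\,\lambda(dy)<\infty$ for $\lambda$-a.e. $x$. For a simple point process $\chi$, the random connection model (RCM) based on $\chi$ is the random graph whose vertices are the points of $\chi$ and in which each pair of distinct points $x,y$ is joined by an edge with probability $\varphi(x,y)$, independently for different pairs. $\mathbb{E}_t$ is expectation when $\eta$ is a Poisson process with intensity measure $t\lambda$. For $v\in\mathbb{X}$, $V^v$ is the vertex set of the connected component of $v$ in the RCM based on $\eta+\delta_v$, $|V^v|$ is its cardinality and $D(V^v)=\sup_{x,y\in V^v}d(x,y)$ its diameter.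 Essential suprema are with respect to $\lambda$. *)

theory Defs
  imports "HOL-Probability.Probability"
begin

section \<open>Point processes\<close>

text \<open>
  A point configuration \<open>(k, x)\<close> is the counting measure
  \<open>\<delta>\<^bsub>x 0\<^esub> + \<delta>\<^bsub>x 1\<^esub> + \<dots>\<close> with \<open>k\<close> summands, where \<open>k\<close> may be \<open>\<infinity>\<close>; the values
  \<open>x n\<close> with \<open>n \<ge> k\<close> are irrelevant. A point process is a measurable random
  configuration.
\<close>

type_synonym 'a config = "enat \<times> (nat \<Rightarrow> 'a)"

definition config_algebra :: "'a::topological_space config measure" where
  "config_algebra = count_space UNIV \<Otimes>\<^sub>M PiM UNIV (\<lambda>_. borel)"

definition num_points :: "'a config \<Rightarrow> 'a set \<Rightarrow> ennreal" where
  "num_points c B = emeasure (count_space UNIV) {n. enat n < fst c \<and> snd c n \<in> B}"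

definition add_point :: "'a \<Rightarrow> 'a config \<Rightarrow> 'a config" where
  "add_point v c = (eSuc (fst c), case_nat v (snd c))"

lemma num_points_add_point:
  "num_points (add_point v c) B = indicator B v + num_points c B"
proof -
  let ?S = "{n. enat n < fst c \<and> snd c n \<in> B}"
  have "{n. enat n < fst (add_point v c) \<and> snd (add_point v c) n \<in> B} =
      (if v \<in> B then {0} else {}) \<union> Suc ` ?S" (is "?L = ?R")
  proof (rule set_eqI)
    fix n show "n \<in> ?L \<longleftrightarrow> n \<in> ?R"
      by (cases n) (auto simp: add_point_def zero_enat_def[symmetric] eSuc_enat Suc_ile_eq)
  qed
  moreover have "emeasure (count_space UNIV) (Suc ` ?S) = emeasure (count_space UNIV) ?S"
    by (auto simp: emeasure_count_space finite_image_iff card_image)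
  moreover have "emeasure (count_space UNIV) ((if v \<in> B then {0} else {}) \<union> Suc ` ?S) =
      emeasure (count_space UNIV) (if v \<in> B then {0} else {}) +
      emeasure (count_space UNIV) (Suc ` ?S)"
    using emeasure_insert[of 0 "count_space (UNIV::nat set)" "Suc ` ?S"]
    by auto
  ultimately show ?thesis
    by (auto simp: num_points_def indicator_def emeasure_count_space)
qed

text \<open>
  A Poisson process with intensity measure \<open>\<Lambda>\<close>; the Poisson distribution with
  parameter \<open>\<infinity>\<close> is the point mass at \<open>\<infinity>\<close>.
\<close>

definition poisson_process ::
    "'w measure \<Rightarrow> 'a::topological_space measure \<Rightarrow> ('w \<Rightarrow> 'a config) \<Rightarrow> bool" where
  "poisson_process M \<Lambda> \<eta> \<longleftrightarrow>
     prob_space M \<and> \<eta> \<in> M \<rightarrow>\<^sub>M config_algebra \<and>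
     (\<forall>B\<in>sets \<Lambda>. \<forall>k::nat.
        measure M {\<omega> \<in> space M. num_points (\<eta> \<omega>) B = of_nat k} =
          (if emeasure \<Lambda> B = \<infinity> then 0
           else measure \<Lambda> B ^ k / fact k * exp (- measure \<Lambda> B))) \<and>
     (\<forall>n::nat. \<forall>B. (\<forall>i<n. B i \<in> sets \<Lambda>) \<longrightarrow> disjoint_family_on B {..<n} \<longrightarrow>
        prob_space.indep_vars M (\<lambda>_. borel) (\<lambda>i \<omega>. num_points (\<eta> \<omega>) (B i)) {..<n})"


section \<open>The random connection model\<close>

text \<open>
  The edges are realised by independent uniform marks \<open>u (m, n)\<close>, \<open>m < n\<close>, attached to
  the pairs of indices of the points: the points with indices \<open>m < n\<close> are joined iff
  \<open>u (m, n) \<le> \<phi> (x m) (x n)\<close>. For simple configurations every pair of distinct points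
  has exactly one mark. Marks at \<open>(m, n)\<close> with \<open>m \<ge> n\<close> are present but never used.
\<close>

definition rcm_adj ::
    "('a \<Rightarrow> 'a \<Rightarrow> real) \<Rightarrow> 'a config \<Rightarrow> (nat \<times> nat \<Rightarrow> real) \<Rightarrow> 'a \<Rightarrow> 'a \<Rightarrow> bool" where
  "rcm_adj \<phi> c u x y \<longleftrightarrow> x \<noteq> y \<and>
     (\<exists>m n. m < n \<and> enat n < fst c \<and> {snd c m, snd c n} = {x, y} \<and> u (m, n) \<le> \<phi> x y)"

definition rcm_component ::
    "('a \<Rightarrow> 'a \<Rightarrow> real) \<Rightarrow> 'a config \<Rightarrow> (nat \<times> nat \<Rightarrow> real) \<Rightarrow> 'a \<Rightarrow> 'a set" where
  "rcm_component \<phi> c u v = {x. (rcm_adj \<phi> c u)\<^sup>*\<^sup>* v x}"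

text \<open>
  The marks \<open>U\<close> are independent, uniformly distributed on \<open>[0,1]\<close>, and independent of
  the point process \<open>\<xi>\<close>.
\<close>

definition rcm_marks ::
    "'w measure \<Rightarrow> ('w \<Rightarrow> 'a::topological_space config) \<Rightarrow> ('w \<Rightarrow> nat \<times> nat \<Rightarrow> real) \<Rightarrow> bool" where
  "rcm_marks M \<xi> U \<longleftrightarrow>
     \<xi> \<in> M \<rightarrow>\<^sub>M config_algebra \<and> U \<in> M \<rightarrow>\<^sub>M PiM UNIV (\<lambda>_. borel) \<and>
     distr M (config_algebra \<Otimes>\<^sub>M PiM UNIV (\<lambda>_. borel)) (\<lambda>\<omega>. (\<xi> \<omega>, U \<omega>)) =
       distr M config_algebra \<xi> \<Otimes>\<^sub>M PiM UNIV (\<lambda>_. uniform_measure lborel {0..1})"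

text \<open>The set \<open>V\<^sup>v\<close>: the component of \<open>v\<close> in the RCM based on \<open>\<eta> + \<delta>\<^sub>v\<close>.\<close>

definition cluster ::
    "('a \<Rightarrow> 'a \<Rightarrow> real) \<Rightarrow> ('w \<Rightarrow> 'a config) \<Rightarrow> ('w \<Rightarrow> nat \<times> nat \<Rightarrow> real) \<Rightarrow> 'a \<Rightarrow> 'w \<Rightarrow> 'a set" where
  "cluster \<phi> \<eta> U v \<omega> = rcm_component \<phi> (add_point v (\<eta> \<omega>)) (U \<omega>) v"

text \<open>
  Unlike \<^const>\<open>card\<close> and \<^const>\<open>diameter\<close>, the following take the value \<open>\<infinity>\<close> on infinite,
  respectively unbounded, sets.
\<close>

definition cardinality :: "'a set \<Rightarrow> ennreal" where
  "cardinality A = emeasure (count_space UNIV) A"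

definition ediameter :: "'a::metric_space set \<Rightarrow> ennreal" where
  "ediameter A = (SUP x\<in>A. SUP y\<in>A. ennreal (dist x y))"

definition ennexp :: "ennreal \<Rightarrow> ennreal" where
  "ennexp x = (if x = \<infinity> then \<infinity> else ennreal (exp (enn2real x)))"

text \<open>
  Here \<open>P t\<close> is a probability measure under which \<open>\<eta>\<close> is a Poisson process with intensity
  measure \<open>t\<nu>\<close>.
\<close>

definition critical_intensity ::
    "'a measure \<Rightarrow> ('a \<Rightarrow> 'a \<Rightarrow> real) \<Rightarrow> (real \<Rightarrow> 'w measure) \<Rightarrow>
      ('w \<Rightarrow> 'a config) \<Rightarrow> ('w \<Rightarrow> nat \<times> nat \<Rightarrow> real) \<Rightarrow> ennreal" where
  "critical_intensity \<nu> \<phi> P \<eta> U =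
     (SUP s \<in> {s. 0 \<le> s \<and>
        esssup \<nu> (\<lambda>v. \<integral>\<^sup>+ \<omega>. cardinality (cluster \<phi> \<eta> U v \<omega>) \<partial>P s) < \<infinity>}. ennreal s)"

text \<open>
  Since \<open>\<integral> \<phi>(v,x) \<nu>(dx)\<close> may be infinite for exceptional \<open>v\<close>, the exponential is taken
  in \<open>[0,\<infinity>]\<close>, with \<open>exp (- x)\<close> written as \<open>inverse (ennexp x)\<close>.
\<close>

definition long_edge_prob ::
    "'a::metric_space measure \<Rightarrow> ('a \<Rightarrow> 'a \<Rightarrow> real) \<Rightarrow> real \<Rightarrow> 'a \<Rightarrow> real \<Rightarrow> ennreal" where
  "long_edge_prob \<nu> \<phi> t v r =
     1 - inverse (ennexp (ennreal t * (\<integral>\<^sup>+ x\<in>{x. dist v x > r}. ennreal (\<phi> v x) \<partial>\<nu>)))"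

definition long_edge_esssup ::
    "'a::metric_space measure \<Rightarrow> ('a \<Rightarrow> 'a \<Rightarrow> real) \<Rightarrow> real \<Rightarrow> real \<Rightarrow> ennreal" where
  "long_edge_esssup \<nu> \<phi> t r = esssup \<nu> (\<lambda>v. long_edge_prob \<nu> \<phi> t v r)"

end

theory Submission
  imports Defs
begin

text \<open>
  Fix \<open>t < s\<close> with \<open>E\<^sub>s|V\<^sup>v| \<le> T\<close> for almost every \<open>v\<close>. Explore the cluster of \<open>v\<close> depth first, in a Poisson
  process of intensity \<open>h \<le> t\<close>: the neighbours of an explored point \<open>w\<close> have intensity \<open>\<phi>(w,\<cdot>)h\<close>, and the
  rest of the exploration takes place in an independent Poisson process of intensity \<open>(1 - \<phi>(w,\<cdot>))h\<close>.
  Weigh every explored point by \<open>e\<close> to the power \<open>\<delta>\<close> times the length of the tree path leading to it, and let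
  \<open>b\<close> be the supremum over \<open>v\<close> and \<open>h\<close> of the expected total weight. Replacing the factor \<open>e\<^sup>\<delta>\<^sup>d\<close> of
  each tree edge in turn by \<open>1 + (e\<^sup>\<delta>\<^sup>d - 1)\<close> gives \<open>b \<le> T + \<epsilon>Tb\<close> with
  \<open>\<epsilon> = ess sup\<^sub>w t\<integral>\<phi>(w,x)(e\<^sup>\<delta>\<^sup>d\<^sup>(\<^sup>w\<^sup>,\<^sup>x\<^sup>) - 1)\<lambda>(dx)\<close>, which tends to \<open>0\<close> with \<open>\<delta>\<close>, since the tails of \<open>\<phi>\<close>
  decay exponentially and \<open>s\<integral>\<phi>(w,x)\<lambda>(dx) \<le> T\<close>. Hence \<open>b \<le> 2T\<close> for small \<open>\<delta>\<close>. By the triangle inequality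
  \<open>exp(\<delta>D(V\<^sup>v)/2)\<close> is at most the total weight. Allowing all \<open>h \<le> t\<close> makes the recursion close; that the
  count in intensity \<open>h\<close> is still at most \<open>T\<close> is seen by thinning. In bounded regions the Poisson
  process is described by its Janossy densities, which turns all expectations into iterated integrals.
\<close>

section \<open>Functions of lists of points\<close>

text \<open>The inequality for \<open>b\<close> gives a bound only if \<open>b\<close> is finite.
  The exploration is therefore cut off after \<open>n\<close> steps: \<open>bsup n\<close> is finite
  by induction on \<open>n\<close>, the resulting bound does not depend on \<open>n\<close>, and the
  cut-off is removed at the end (\<open>pois_avg_length_le\<close>). A truncated exploration depends
  on the order in which the points are listed, so it is not a function of a point configuration;
  this is why Poisson averages are iterated integrals over lists. Only the complete exploration,
  which is symmetric, is identified with an expectation. The bounds on cluster sizes and tails hold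
  for almost every point, but the recursion uses them at every explored point. Hence a null set is
  cut out first, and all regions are subsets of its complement \<open>S\<close>. A Poisson process
  is given by its counts alone. Independence of counts on disjoint sets yields generating functions;
  their coefficients, combined by Ryser's formula for permanents, yield the Janossy densities. The
  rate shrinks three times: from \<open>b\<close> to \<open>b / 2\<close> to make moments finite, by
  a factor \<open>\<theta>\<close> to make them small, and by \<open>1 / 2\<close> to pass from
  distances to the root to the diameter.\<close>

text \<open>
  Measurability of a function of finite lists, respectively of two finite lists, without a
  \<open>\<sigma>\<close>-algebra on lists: for every fixed length, in the entries.
\<close>

definition lmeas :: "('a::topological_space list \<Rightarrow> ennreal) \<Rightarrow> bool" where
  "lmeas F \<longleftrightarrow> (\<forall>k. (\<lambda>x. F (map x [0..<k])) \<in> borel_measurable (PiM UNIV (\<lambda>_. borel)))"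

definition lmeas2 :: "('a::topological_space list \<Rightarrow> 'a list \<Rightarrow> ennreal) \<Rightarrow> bool" where
  "lmeas2 H \<longleftrightarrow> (\<forall>j k. (\<lambda>x. H (map x [0..<j]) (map x [j..<j + k]))
     \<in> borel_measurable (PiM UNIV (\<lambda>_. borel)))"

text \<open>\<open>lmeas\<close> and \<open>lmeas2\<close> are stated on the space of infinite
  sequences, so a list of measurable functions is padded; beyond its length the entries are the
  constant \<open>undefined\<close>.\<close>

lemma measurable_list_PiM:
  assumes "\<And>f. f \<in> set fs \<Longrightarrow> f \<in> M \<rightarrow>\<^sub>M (borel :: 'a::topological_space measure)"
  shows "(\<lambda>\<omega> i. if i < length fs then (fs ! i) \<omega> else undefined) \<in> M \<rightarrow>\<^sub>M PiM UNIV (\<lambda>_. borel)"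
proof (rule measurable_PiM_single')
  fix i
  show "(\<lambda>\<omega>. if i < length fs then (fs ! i) \<omega> else undefined) \<in> M \<rightarrow>\<^sub>M borel"
    using assms[of "fs ! i"] by (cases "i < length fs") auto
qed auto

lemma lmeasD:
  assumes "lmeas F" "\<And>f. f \<in> set fs \<Longrightarrow> f \<in> M \<rightarrow>\<^sub>M borel"
  shows "(\<lambda>\<omega>. F (map (\<lambda>f. f \<omega>) fs)) \<in> borel_measurable M"
proof -
  have "(\<lambda>x. F (map x [0..<length fs])) \<in> borel_measurable (PiM UNIV (\<lambda>_. borel))"
    using assms(1) by (simp add: lmeas_def)
  from measurable_compose[OF measurable_list_PiM[OF assms(2)] this]
  have "(\<lambda>\<omega>. F (map (\<lambda>i. if i < length fs then (fs ! i) \<omega> else undefined) [0..<length fs]))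
      \<in> borel_measurable M" .
  moreover have "map (\<lambda>i. if i < length fs then (fs ! i) \<omega> else undefined) [0..<length fs]
      = map (\<lambda>f. f \<omega>) fs" for \<omega>
    by (rule nth_equalityI) auto
  ultimately show ?thesis by simp
qed

lemma lmeasD':
  assumes "lmeas F" "\<And>f. f \<in> set fs \<Longrightarrow> f \<in> M \<rightarrow>\<^sub>M borel" "\<And>\<omega>. X \<omega> = map (\<lambda>f. f \<omega>) fs"
  shows "(\<lambda>\<omega>. F (X \<omega>)) \<in> borel_measurable M"
  unfolding assms(3) by (rule lmeasD[OF assms(1,2)])

lemma lmeas2D:
  assumes "lmeas2 H" "\<And>f. f \<in> set fs \<Longrightarrow> f \<in> M \<rightarrow>\<^sub>M borel" "\<And>g. g \<in> set gs \<Longrightarrow> g \<in> M \<rightarrow>\<^sub>M borel"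
    and X: "\<And>\<omega>. X \<omega> = map (\<lambda>f. f \<omega>) fs" and Y: "\<And>\<omega>. Y \<omega> = map (\<lambda>f. f \<omega>) gs"
  shows "(\<lambda>\<omega>. H (X \<omega>) (Y \<omega>)) \<in> borel_measurable M"
proof -
  let ?x = "\<lambda>\<omega> i. if i < length (fs @ gs) then ((fs @ gs) ! i) \<omega> else undefined"
  have *: "(\<lambda>x. H (map x [0..<length fs]) (map x [length fs..<length fs + length gs]))
      \<in> borel_measurable (PiM UNIV (\<lambda>_. borel))"
    using assms(1) by (simp add: lmeas2_def)
  have "?x \<in> M \<rightarrow>\<^sub>M PiM UNIV (\<lambda>_. borel)"
    by (rule measurable_list_PiM) (use assms(2,3) in auto)
  from measurable_compose[OF this *]
  have "(\<lambda>\<omega>. H (map (?x \<omega>) [0..<length fs]) (map (?x \<omega>) [length fs..<length fs + length gs]))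
      \<in> borel_measurable M" .
  moreover have "map (?x \<omega>) [0..<length fs] = map (\<lambda>f. f \<omega>) fs" for \<omega>
    by (rule nth_equalityI) (auto simp: nth_append)
  moreover have "map (?x \<omega>) [length fs..<length fs + length gs] = map (\<lambda>f. f \<omega>) gs" for \<omega>
    by (rule nth_equalityI) (auto simp: nth_append)
  ultimately show ?thesis by (simp add: X Y)
qed

lemma measurable_PiM_UNIV_component:
  "(\<lambda>x. x i) \<in> PiM UNIV (\<lambda>_. M) \<rightarrow>\<^sub>M M"
  by (rule measurable_component_singleton) simp

lemma lmeas2_comp:
  assumes "lmeas2 H"
  shows "lmeas (H xs)" "lmeas2 (\<lambda>Y Z. H (x # Y) Z)" "lmeas2 (\<lambda>Y Z. H Y (x # Z))"
proof -
  note [intro] = measurable_PiM_UNIV_component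
  show "lmeas (H xs)"
    unfolding lmeas_def
    by (intro allI, rule lmeas2D[OF assms, where fs = "map (\<lambda>a _. a) xs" and gs = "map (\<lambda>i x. x i) [0..<k]" for k])
      (auto simp: comp_def)
  show "lmeas2 (\<lambda>Y Z. H (x # Y) Z)"
    unfolding lmeas2_def
    by (intro allI, rule lmeas2D[OF assms, where fs = "(\<lambda>_. x) # map (\<lambda>i x. x i) [0..<j]" and
      gs = "map (\<lambda>i x. x i) [j..<j+k]" for j k]) (auto simp: comp_def)
  show "lmeas2 (\<lambda>Y Z. H Y (x # Z))"
    unfolding lmeas2_def
    by (intro allI, rule lmeas2D[OF assms, where fs = "map (\<lambda>i x. x i) [0..<j]" and
      gs = "(\<lambda>_. x) # map (\<lambda>i x. x i) [j..<j+k]" for j k]) (auto simp: comp_def)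
qed

lemma lmeas_append:
  assumes "lmeas F"
  shows "lmeas (\<lambda>Y. F (xs @ Y))"
  unfolding lmeas_def
  by (intro allI, rule lmeasD'[OF assms, where fs = "map (\<lambda>a _. a) xs @ map (\<lambda>i x. x i) [0..<k]" for k])
    (auto simp: comp_def intro: measurable_PiM_UNIV_component)

lemma lmeas_Cons: "lmeas F \<Longrightarrow> lmeas (\<lambda>Y. F (x # Y))"
  using lmeas_append[of F "[x]"] by simp

lemma lmeas_const [simp]: "lmeas (\<lambda>_. c)"
  by (simp add: lmeas_def)

lemma lmeas_mult: "lmeas F \<Longrightarrow> lmeas G \<Longrightarrow> lmeas (\<lambda>x. F x * G x)"
  unfolding lmeas_def by (intro allI borel_measurable_times_ennreal) blast+

text \<open>
  The expectation of \<open>H Y Z\<close> when every entry \<open>x\<close> of the list is independently put into \<open>Y\<close> with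
  probability \<open>g x\<close>, and into \<open>Z\<close> otherwise.
\<close>

fun thin :: "('a \<Rightarrow> ennreal) \<Rightarrow> 'a list \<Rightarrow> ('a list \<Rightarrow> 'a list \<Rightarrow> ennreal) \<Rightarrow> ennreal" where
  "thin g [] H = H [] []"
| "thin g (x # xs) H = g x * thin g xs (\<lambda>Y Z. H (x # Y) Z) + (1 - g x) * thin g xs (\<lambda>Y Z. H Y (x # Z))"

lemma thin_mono: "(\<And>Y Z. H Y Z \<le> K Y Z) \<Longrightarrow> thin g X H \<le> thin g X K"
  by (induction X arbitrary: H K) (auto intro!: add_mono mult_left_mono)

lemma thin_add: "thin g X (\<lambda>Y Z. H Y Z + K Y Z) = thin g X H + thin g X K"
  by (induction X arbitrary: H K) (auto simp: algebra_simps)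

lemma thin_cmult: "thin g X (\<lambda>Y Z. c * H Y Z) = c * thin g X H"
  by (induction X arbitrary: H) (auto simp: algebra_simps)

lemma thin_map: "thin g (map x X) H = thin (\<lambda>i. g (x i)) X (\<lambda>Y Z. H (map x Y) (map x Z))"
  by (induction X arbitrary: H) auto

lemma ennreal_add_1_minus: "(g::ennreal) \<le> 1 \<Longrightarrow> g + (1 - g) = 1"
  by (simp add: add_diff_inverse_ennreal)

text \<open>In both branches of \<open>thin\<close> the value is at most the one with the entry
  kept, because inserting an entry cannot lower \<open>F\<close>. The prefix \<open>P\<close>
  carries the entries already kept, in front of the undecided ones.\<close>

lemma thin_le:
  assumes "\<And>x. g x \<le> 1" "\<And>P x Q. F (P @ Q) \<le> F (P @ x # Q)"
  shows "thin g X (\<lambda>Y Z. F (P @ Y)) \<le> F (P @ X)"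
proof (induction X arbitrary: P)
  case (Cons x X)
  have "thin g (x # X) (\<lambda>Y Z. F (P @ Y)) \<le> g x * F (P @ x # X) + (1 - g x) * F (P @ X)"
    using Cons[of "P @ [x]"] Cons[of P] by (auto intro!: add_mono mult_left_mono)
  also have "\<dots> \<le> g x * F (P @ x # X) + (1 - g x) * F (P @ x # X)"
    by (intro add_mono mult_left_mono assms order_refl) auto
  also have "\<dots> = F (P @ x # X)"
    by (metis (no_types) assms(1) ennreal_add_1_minus distrib_right mult_1)
  finally show ?case .
qed simp

text \<open>The recursion only redistributes the functions in \<open>fs\<close>, so it is enough
  that \<open>H\<close> is measurable on lists made of these.\<close>

lemma measurable_thin:
  assumes "\<And>f. f \<in> set fs \<Longrightarrow> (\<lambda>\<omega>. g \<omega> (f \<omega>)) \<in> borel_measurable M"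
    and "\<And>f. f \<in> set fs \<Longrightarrow> f \<in> M \<rightarrow>\<^sub>M borel"
    and "\<And>Y Z. set Y \<subseteq> set fs \<Longrightarrow> set Z \<subseteq> set fs \<Longrightarrow>
       (\<lambda>\<omega>. H \<omega> (map (\<lambda>f. f \<omega>) Y) (map (\<lambda>f. f \<omega>) Z)) \<in> borel_measurable M"
  shows "(\<lambda>\<omega>. thin (g \<omega>) (map (\<lambda>f. f \<omega>) fs) (H \<omega>)) \<in> borel_measurable M"
  using assms
proof (induction fs arbitrary: H)
  case Nil
  then show ?case using Nil(3)[of "[]" "[]"] by simp
next
  case (Cons f fs)
  have [measurable]: "(\<lambda>\<omega>. g \<omega> (f \<omega>)) \<in> borel_measurable M" using Cons by auto
  have [measurable]: "f \<in> M \<rightarrow>\<^sub>M borel" using Cons by auto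
  have [measurable]: "(\<lambda>\<omega>. thin (g \<omega>) (map (\<lambda>f. f \<omega>) fs) (\<lambda>Y Z. H \<omega> (f \<omega> # Y) Z)) \<in> borel_measurable M"
  proof (rule Cons.IH)
    fix Y Z assume "set Y \<subseteq> set fs" "set Z \<subseteq> set fs"
    then show "(\<lambda>\<omega>. H \<omega> (f \<omega> # map (\<lambda>f. f \<omega>) Y) (map (\<lambda>f. f \<omega>) Z)) \<in> borel_measurable M"
      using Cons.prems(3)[of "f # Y" Z] by (simp add: subset_insertI2)
  qed (simp_all add: Cons.prems)
  have [measurable]: "(\<lambda>\<omega>. thin (g \<omega>) (map (\<lambda>f. f \<omega>) fs) (\<lambda>Y Z. H \<omega> Y (f \<omega> # Z))) \<in> borel_measurable M"
  proof (rule Cons.IH)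
    fix Y Z assume "set Y \<subseteq> set fs" "set Z \<subseteq> set fs"
    then show "(\<lambda>\<omega>. H \<omega> (map (\<lambda>f. f \<omega>) Y) (f \<omega> # map (\<lambda>f. f \<omega>) Z)) \<in> borel_measurable M"
      using Cons.prems(3)[of Y "f # Z"] by (simp add: subset_insertI2)
  qed (simp_all add: Cons.prems)
  show ?case by simp
qed

lemma lmeas_thin:
  assumes "g \<in> borel_measurable borel" "lmeas2 H"
  shows "lmeas (\<lambda>X. thin g X H)"
  unfolding lmeas_def
proof
  fix k
  have "(\<lambda>\<omega>. thin ((\<lambda>\<omega>. g) \<omega>) (map (\<lambda>f. f \<omega>) (map (\<lambda>i x. x i) [0..<k])) ((\<lambda>\<omega> Y Z. H Y Z) \<omega>)) \<in> borel_measurable (PiM UNIV (\<lambda>_. borel))"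
    by (rule measurable_thin, rule measurable_compose[OF _ assms(1)], force intro: measurable_PiM_UNIV_component,
        force intro: measurable_PiM_UNIV_component, rule lmeas2D[OF assms(2) _ _ refl refl])
      (auto intro: measurable_PiM_UNIV_component)
  then show "(\<lambda>x. thin g (map x [0..<k]) H) \<in> borel_measurable (PiM UNIV (\<lambda>_. borel))"
    by (simp add: comp_def)
qed

section \<open>Iterated integrals of functions of lists\<close>

primrec lint :: "'a measure \<Rightarrow> ('a \<Rightarrow> ennreal) \<Rightarrow> nat \<Rightarrow> ('a list \<Rightarrow> ennreal) \<Rightarrow> ennreal" where
  "lint \<nu> h 0 F = F []"
| "lint \<nu> h (Suc k) F = (\<integral>\<^sup>+x. h x * lint \<nu> h k (\<lambda>xs. F (x # xs)) \<partial>\<nu>)"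

text \<open>The comparison is needed only on lists inside a set \<open>S\<close> that carries
  \<open>h\<close>. This is how bounds that may fail at exceptional points can be used under
  iterated integrals.\<close>

lemma lint_mono:
  assumes "\<And>x. x \<notin> S \<Longrightarrow> h x = 0" "\<And>xs. length xs = k \<Longrightarrow> set xs \<subseteq> S \<Longrightarrow> F xs \<le> G xs"
  shows "lint \<nu> h k F \<le> lint \<nu> h k G"
  using assms(2)
proof (induction k arbitrary: F G)
  case (Suc k)
  have "h x * lint \<nu> h k (\<lambda>xs. F (x # xs)) \<le> h x * lint \<nu> h k (\<lambda>xs. G (x # xs))" for x
  proof (cases "x \<in> S")
    case True
    then show ?thesis by (intro mult_left_mono Suc.IH Suc.prems) auto
  qed (simp add: assms(1))
  then show ?case by (auto intro!: nn_integral_mono)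
qed auto

context
  fixes \<nu> :: "'a::second_countable_topology measure"
  assumes sets_nu [measurable_cong]: "sets \<nu> = sets borel" and sf: "sigma_finite_measure \<nu>"
begin

text \<open>The prefix \<open>ys\<close> makes the induction go through: when \<open>lint\<close> is
  unfolded once, the outermost integration variable becomes the last entry of the prefix.\<close>

lemma lmeas_lint:
  assumes [measurable]: "h \<in> borel_measurable borel" and "lmeas F"
  shows "lmeas (\<lambda>ys. lint \<nu> h k (\<lambda>xs. F (ys @ xs)))"
proof (induction k)
  case 0
  then show ?case using assms by simp
next
  case (Suc k)
  interpret sigma_finite_measure \<nu> by (rule sf)
  show ?case unfolding lmeas_def
  proof
    fix j
    have "(\<lambda>\<omega>. lint \<nu> h k (\<lambda>xs. F ((map (fst \<omega>) [0..<j] @ [snd \<omega>]) @ xs)))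
        \<in> borel_measurable (PiM UNIV (\<lambda>_. borel) \<Otimes>\<^sub>M (borel :: 'a measure))"
      by (rule lmeasD'[OF Suc, where fs = "map (\<lambda>i \<omega>. fst \<omega> i) [0..<j] @ [snd]"])
        (auto intro: measurable_compose[OF measurable_fst measurable_PiM_UNIV_component])
    then have [measurable]: "(\<lambda>\<omega>. lint \<nu> h k (\<lambda>xs. F (map (fst \<omega>) [0..<j] @ snd \<omega> # xs)))
        \<in> borel_measurable (PiM UNIV (\<lambda>_. borel) \<Otimes>\<^sub>M (borel :: 'a measure))"
      by (simp add: comp_def)
    have "(\<lambda>x. \<integral>\<^sup>+y. h y * lint \<nu> h k (\<lambda>xs. F (map x [0..<j] @ y # xs)) \<partial>\<nu>)
       \<in> borel_measurable (PiM UNIV (\<lambda>_. borel))"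
      using borel_measurable_nn_integral[of "\<lambda>x y. h y * lint \<nu> h k (\<lambda>xs. F (map x [0..<j] @ y # xs))"
          "PiM UNIV (\<lambda>_. borel)"] by (simp add: split_beta' cong: measurable_cong_sets)
    then show "(\<lambda>x. lint \<nu> h (Suc k) (\<lambda>xs. F (map x [0..<j] @ xs))) \<in> borel_measurable (PiM UNIV (\<lambda>_. borel))"
      by simp
  qed
qed

lemma measurable_lint_Cons:
  assumes "h \<in> borel_measurable borel" "lmeas F"
  shows "(\<lambda>x. lint \<nu> h k (\<lambda>xs. F (x # xs))) \<in> borel_measurable borel"
  using lmeasD[OF lmeas_lint[OF assms], of "[\<lambda>x. x]"] by auto

lemma lmeas2_lint:
  assumes [measurable]: "h \<in> borel_measurable borel" and "lmeas2 H"
  shows "lmeas2 (\<lambda>Y W. lint \<nu> h k (\<lambda>Z. H Y (W @ Z)))"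
proof (induction k)
  case 0
  then show ?case using assms by simp
next
  case (Suc k)
  interpret sigma_finite_measure \<nu> by (rule sf)
  show ?case unfolding lmeas2_def
  proof (intro allI)
    fix i j
    have "(\<lambda>\<omega>. lint \<nu> h k (\<lambda>xs. H (map (fst \<omega>) [0..<i]) ((map (fst \<omega>) [i..<i+j] @ [snd \<omega>]) @ xs)))
        \<in> borel_measurable (PiM UNIV (\<lambda>_. borel) \<Otimes>\<^sub>M (borel :: 'a measure))"
      by (rule lmeas2D[OF Suc, where fs = "map (\<lambda>i \<omega>. fst \<omega> i) [0..<i]" and
            gs = "map (\<lambda>i \<omega>. fst \<omega> i) [i..<i+j] @ [snd]"])
        (auto intro: measurable_compose[OF measurable_fst measurable_PiM_UNIV_component])
    then have [measurable]: "(\<lambda>\<omega>. lint \<nu> h k (\<lambda>xs. H (map (fst \<omega>) [0..<i]) (map (fst \<omega>) [i..<i+j] @ snd \<omega> # xs)))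
        \<in> borel_measurable (PiM UNIV (\<lambda>_. borel) \<Otimes>\<^sub>M (borel :: 'a measure))"
      by (simp add: comp_def)
    have "(\<lambda>x. \<integral>\<^sup>+y. h y * lint \<nu> h k (\<lambda>xs. H (map x [0..<i]) (map x [i..<i+j] @ y # xs)) \<partial>\<nu>)
       \<in> borel_measurable (PiM UNIV (\<lambda>_. borel))"
      using borel_measurable_nn_integral[of "\<lambda>x y. h y * lint \<nu> h k (\<lambda>xs. H (map x [0..<i]) (map x [i..<i+j] @ y # xs))"
          "PiM UNIV (\<lambda>_. borel)"] by (simp add: split_beta' cong: measurable_cong_sets)
    then show "(\<lambda>x. lint \<nu> h (Suc k) (\<lambda>xs. H (map x [0..<i]) (map x [i..<i+j] @ xs))) \<in> borel_measurable (PiM UNIV (\<lambda>_. borel))"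
      by simp
  qed
qed

lemma lint_add:
  assumes [measurable]: "h \<in> borel_measurable borel" and "lmeas F" "lmeas G"
  shows "lint \<nu> h k (\<lambda>xs. F xs + G xs) = lint \<nu> h k F + lint \<nu> h k G"
  using assms(2,3)
proof (induction k arbitrary: F G)
  case (Suc k)
  note [measurable] = measurable_lint_Cons[OF assms(1) Suc.prems(1)] measurable_lint_Cons[OF assms(1) Suc.prems(2)]
  show ?case
    using Suc by (simp add: lmeas_Cons nn_integral_add[symmetric] distrib_left)
qed simp

lemma lint_cmult:
  assumes [measurable]: "h \<in> borel_measurable borel" and "lmeas F"
  shows "lint \<nu> h k (\<lambda>xs. c * F xs) = c * lint \<nu> h k F"
  using assms(2)
proof (induction k arbitrary: F)
  case (Suc k)
  note [measurable] = measurable_lint_Cons[OF assms(1) Suc.prems(1)]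
  show ?case
    using Suc by (simp add: lmeas_Cons nn_integral_cmult[symmetric] algebra_simps)
qed simp

lemma lint_const:
  assumes [measurable]: "h \<in> borel_measurable borel"
  shows "lint \<nu> h k (\<lambda>_. c) = c * (\<integral>\<^sup>+x. h x \<partial>\<nu>) ^ k"
  by (induction k) (auto simp: nn_integral_cmult nn_integral_multc ac_simps)

text \<open>Tonelli's theorem for one variable against an iterated integral. In
  \<open>lint_thin\<close>, an entry put into the second list is integrated first, but has to move
  inside the integrals over the first list.\<close>

lemma lint_swap:
  assumes [measurable]: "h \<in> borel_measurable borel" "p \<in> borel_measurable borel" and "lmeas K"
  shows "(\<integral>\<^sup>+x. p x * lint \<nu> h j (\<lambda>Y. K (x # Y)) \<partial>\<nu>) = lint \<nu> h j (\<lambda>Y. \<integral>\<^sup>+x. p x * K (x # Y) \<partial>\<nu>)"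
proof -
  have *: "(\<integral>\<^sup>+x. p x * lint \<nu> h j (\<lambda>Y. K (x # ys @ Y)) \<partial>\<nu>) = lint \<nu> h j (\<lambda>Y. \<integral>\<^sup>+x. p x * K (x # ys @ Y) \<partial>\<nu>)" for ys
  proof (induction j arbitrary: ys)
    case (Suc j)
    interpret sigma_finite_measure \<nu> by (rule sf)
    interpret pair_sigma_finite \<nu> \<nu> ..
    have "(\<lambda>\<omega>. lint \<nu> h j (\<lambda>Y. K (([fst \<omega>] @ ys @ [snd \<omega>]) @ Y))) \<in> borel_measurable (\<nu> \<Otimes>\<^sub>M \<nu>)"
      by (rule lmeasD'[OF lmeas_lint[OF assms(1,3)], where fs = "[fst] @ map (\<lambda>a _. a) ys @ [snd]"])
        (auto simp: comp_def)
    then have mm [measurable]: "(\<lambda>\<omega>. lint \<nu> h j (\<lambda>Y. K (fst \<omega> # ys @ snd \<omega> # Y))) \<in> borel_measurable (\<nu> \<Otimes>\<^sub>M \<nu>)"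
      by (simp add: comp_def)
    have [measurable]: "(\<lambda>y. lint \<nu> h j (\<lambda>Y. K (x # ys @ y # Y))) \<in> borel_measurable \<nu>" for x
      using measurable_compose[OF measurable_Pair1' mm, of x] sets_eq_imp_space_eq[OF sets_nu] by simp
    have [measurable]: "(\<lambda>x. lint \<nu> h j (\<lambda>Y. K (x # ys @ y # Y))) \<in> borel_measurable \<nu>" for y
      using measurable_compose[OF measurable_Pair2' mm, of y] sets_eq_imp_space_eq[OF sets_nu] by simp
    have "(\<integral>\<^sup>+x. p x * lint \<nu> h (Suc j) (\<lambda>Y. K (x # ys @ Y)) \<partial>\<nu>) =
       (\<integral>\<^sup>+x. \<integral>\<^sup>+y. h y * (p x * lint \<nu> h j (\<lambda>Y. K (x # ys @ y # Y))) \<partial>\<nu> \<partial>\<nu>)"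
      by (auto simp: nn_integral_cmult[symmetric] ac_simps intro!: nn_integral_cong)
    also have "\<dots> = (\<integral>\<^sup>+y. \<integral>\<^sup>+x. h y * (p x * lint \<nu> h j (\<lambda>Y. K (x # ys @ y # Y))) \<partial>\<nu> \<partial>\<nu>)"
      by (intro Fubini'[symmetric]) (simp add: split_beta')
    also have "\<dots> = (\<integral>\<^sup>+y. h y * (\<integral>\<^sup>+x. p x * lint \<nu> h j (\<lambda>Y. K (x # (ys @ [y]) @ Y)) \<partial>\<nu>) \<partial>\<nu>)"
      by (auto intro!: nn_integral_cong nn_integral_cmult)
    also have "\<dots> = lint \<nu> h (Suc j) (\<lambda>Y. \<integral>\<^sup>+x. p x * K (x # ys @ Y) \<partial>\<nu>)"
      by (subst Suc) simp
    finally show ?case .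
  qed simp
  show ?thesis using *[of "[]"] by simp
qed

text \<open>Each way of keeping \<open>j\<close> of the \<open>k\<close> entries contributes the
  same integral, in which kept entries have density \<open>g * h\<close> and discarded ones
  \<open>(1 - g) * h\<close>; the binomial coefficient counts these ways.\<close>

lemma lint_thin:
  assumes [measurable]: "h \<in> borel_measurable borel" "g \<in> borel_measurable borel" and "lmeas2 H"
  shows "lint \<nu> h k (\<lambda>X. thin g X H) = (\<Sum>j\<le>k. of_nat (k choose j) *
     lint \<nu> (\<lambda>x. g x * h x) j (\<lambda>Y. lint \<nu> (\<lambda>x. (1 - g x) * h x) (k - j) (H Y)))"
  using assms(3)
proof (induction k arbitrary: H)
  case (Suc k)
  let ?p = "\<lambda>x. g x * h x" and ?q = "\<lambda>x. (1 - g x) * h x"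
  note m2 = lmeas2_comp[OF Suc.prems]
  have p: "?p \<in> borel_measurable borel" and q: "?q \<in> borel_measurable borel" by measurable
  define A where "A j l = lint \<nu> ?p j (\<lambda>Y. lint \<nu> ?q l (H Y))" for j l
  have lm: "lmeas (\<lambda>Y. lint \<nu> ?q l (H Y))" for l
  proof -
    have "lmeas2 (\<lambda>Y W. lint \<nu> ?q l (\<lambda>Z. H Y (W @ Z)))"
      by (rule lmeas2_lint[OF q Suc.prems])
    then have "(\<lambda>x. lint \<nu> ?q l (\<lambda>Z. H (map x [0..<k]) ([] @ Z))) \<in> borel_measurable (PiM UNIV (\<lambda>_. borel))" for k
      by (rule lmeas2D[where fs = "map (\<lambda>i x. x i) [0..<k]" and gs = "[]"]) (auto intro: measurable_PiM_UNIV_component)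
    then show ?thesis by (simp add: lmeas_def)
  qed
  have m1: "(\<lambda>x. lint \<nu> ?p j (\<lambda>Y. lint \<nu> ?q l (H (x # Y)))) \<in> borel_measurable borel" for j l
    using measurable_lint_Cons[OF p lm] by auto
  \<comment> \<open>\<open>K\<close> reads the discarded entry as the head of its list, the form in
    which \<open>lint_swap\<close> accepts an integrand; at \<open>[]\<close> its value is an
    arbitrary constant.\<close>
  define K where "K l = (\<lambda>X. lint \<nu> ?q l (\<lambda>Z. H (tl X) ([hd X] @ Z)))" for l
  have lK: "lmeas (K l)" for l
  proof -
    have *: "lmeas2 (\<lambda>Y W. lint \<nu> ?q l (\<lambda>Z. H Y (W @ Z)))"
      by (rule lmeas2_lint[OF q Suc.prems])
    show ?thesis unfolding lmeas_def
    proof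
      fix k
      show "(\<lambda>x. K l (map x [0..<k])) \<in> borel_measurable (PiM UNIV (\<lambda>_. borel))"
      proof (cases k)
        case (Suc k')
        have "map x [0..<k] = x 0 # map x [Suc 0..<k]" for x :: "nat \<Rightarrow> 'a"
          unfolding Suc by (subst upt_conv_Cons) auto
        moreover have "(\<lambda>x. lint \<nu> ?q l (\<lambda>Z. H (map x [Suc 0..<k]) ([x 0] @ Z))) \<in> borel_measurable (PiM UNIV (\<lambda>_. borel))"
          by (rule lmeas2D[OF *, where fs = "map (\<lambda>i x. x i) [Suc 0..<k]" and gs = "[\<lambda>x. x 0]"])
            (auto intro: measurable_PiM_UNIV_component)
        ultimately show ?thesis
          by (simp add: K_def)
      qed simp
    qed
  qed
  have m3: "(\<lambda>x. lint \<nu> ?p j (\<lambda>Y. lint \<nu> ?q l (\<lambda>Z. H Y (x # Z)))) \<in> borel_measurable borel" for j l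
    using measurable_lint_Cons[OF p lK, of j l] by (simp add: K_def)
  have eq1: "(\<integral>\<^sup>+x. ?p x * lint \<nu> ?p j (\<lambda>Y. lint \<nu> ?q l (H (x # Y))) \<partial>\<nu>) = A (Suc j) l" for j l
    by (simp add: A_def)
  have eq2: "(\<integral>\<^sup>+x. ?q x * lint \<nu> ?p j (\<lambda>Y. lint \<nu> ?q l (\<lambda>Z. H Y (x # Z))) \<partial>\<nu>) = A j (Suc l)" for j l
    using lint_swap[OF p q lK, of j l] by (simp add: K_def A_def)
  have "lint \<nu> h (Suc k) (\<lambda>X. thin g X H) =
    (\<integral>\<^sup>+x. ?p x * lint \<nu> h k (\<lambda>X. thin g X (\<lambda>Y Z. H (x # Y) Z)) + ?q x * lint \<nu> h k (\<lambda>X. thin g X (\<lambda>Y Z. H Y (x # Z))) \<partial>\<nu>)"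
    by (auto simp: lint_add lint_cmult lmeas_mult lmeas_thin m2 algebra_simps intro!: nn_integral_cong)
  also have "\<dots> = (\<integral>\<^sup>+x. (\<Sum>j\<le>k. of_nat (k choose j) * (?p x * lint \<nu> ?p j (\<lambda>Y. lint \<nu> ?q (k - j) (H (x # Y))))) +
      (\<Sum>j\<le>k. of_nat (k choose j) * (?q x * lint \<nu> ?p j (\<lambda>Y. lint \<nu> ?q (k - j) (\<lambda>Z. H Y (x # Z))))) \<partial>\<nu>)"
    by (auto simp: Suc.IH m2 sum_distrib_left ac_simps intro!: nn_integral_cong arg_cong2[where f="(+)"] sum.cong)
  also have "\<dots> = (\<Sum>j\<le>k. of_nat (k choose j) * A (Suc j) (k - j)) + (\<Sum>j\<le>k. of_nat (k choose j) * A j (Suc (k - j)))"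
    using m1 m3 by (subst nn_integral_add) (auto simp: nn_integral_sum nn_integral_cmult eq1 eq2)
  \<comment> \<open>Pascal's rule, after the term \<open>j = 0\<close> has been split off.\<close>
  also have "\<dots> = (\<Sum>j\<le>Suc k. of_nat (Suc k choose j) * A j (Suc k - j))"
  proof -
    have 1: "(\<Sum>j\<le>Suc k. of_nat (Suc k choose j) * A j (Suc k - j)) =
      A 0 (Suc k) + (\<Sum>j\<le>k. of_nat (k choose j) * A (Suc j) (k - j)) + (\<Sum>j\<le>k. of_nat (k choose Suc j) * A (Suc j) (k - j))"
      by (subst sum.atMost_Suc_shift) (simp add: algebra_simps sum.distrib)
    have "(\<Sum>j\<le>k. of_nat (k choose j) * A j (Suc (k - j))) = (\<Sum>j\<le>Suc k. of_nat (k choose j) * A j (Suc k - j))"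
      by (simp add: Suc_diff_le cong: sum.cong_simp)
    also have "\<dots> = A 0 (Suc k) + (\<Sum>j\<le>k. of_nat (k choose Suc j) * A (Suc j) (k - j))"
      by (subst sum.atMost_Suc_shift) simp
    finally show ?thesis using 1 by (simp add: algebra_simps)
  qed
  finally show ?case by (simp add: A_def)
qed simp

end

section \<open>Poisson averages\<close>

lemma ennreal_suminf_swap: "(\<Sum>i. \<Sum>j. f i j) = (\<Sum>j. \<Sum>i. (f i j :: ennreal))"
  using nn_integral_suminf[of "\<lambda>j i. f i j" "count_space UNIV"]
  by (simp add: nn_integral_count_space_nat)

text \<open>Summation along the diagonals \<open>j + l = k\<close> turns a sum over the total number
  of points into a double sum over the numbers of kept and of discarded points.\<close>

lemma ennreal_suminf_Cauchy:
  "(\<Sum>k. \<Sum>j\<le>k. B j (k - j)) = (\<Sum>j. \<Sum>l. (B j l :: ennreal))"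
proof -
  have "(\<Sum>k. \<Sum>j\<le>k. B j (k - j)) = (\<Sum>k. \<Sum>j. if j \<le> k then B j (k - j) else 0)"
  proof (rule suminf_cong)
    fix k
    have "(\<Sum>j. if j \<le> k then B j (k - j) else 0) = (\<Sum>j\<le>k. if j \<le> k then B j (k - j) else 0)"
      by (rule suminf_finite) auto
    then show "(\<Sum>j\<le>k. B j (k - j)) = (\<Sum>j. if j \<le> k then B j (k - j) else 0)" by simp
  qed
  also have "\<dots> = (\<Sum>j. \<Sum>k. if j \<le> k then B j (k - j) else 0)"
    by (rule ennreal_suminf_swap)
  also have "\<dots> = (\<Sum>j. \<Sum>l. B j l)"
  proof (rule suminf_cong)
    fix j
    have "(\<Sum>l. if j \<le> l + j then B j (l + j - j) else 0) = (\<Sum>k. if j \<le> k then B j (k - j) else 0)"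
      by (rule suminf_mono_reindex[of "\<lambda>l. l + j"])
        (auto simp: strict_mono_def image_iff intro: le_add_diff_inverse2[symmetric])
    then show "(\<Sum>k. if j \<le> k then B j (k - j) else 0) = (\<Sum>l. B j l)" by simp
  qed
  finally show ?thesis .
qed

lemma suminf_ennreal_exp:
  assumes "0 \<le> m"
  shows "(\<Sum>k. ennreal m ^ k * ennreal (1 / fact k)) = ennreal (exp m)"
proof -
  have "(\<Sum>k. ennreal (m ^ k / fact k)) = ennreal (\<Sum>k. m ^ k / fact k)"
    using assms summable_exp[of m] by (intro suminf_ennreal2) (auto simp: field_simps)
  then show ?thesis
    using assms by (simp add: exp_def ennreal_power ennreal_mult[symmetric] field_simps scaleR_conv_of_real)
qed

text \<open>
  The expectation of \<open>F\<close> at the points of a Poisson process with intensity measure \<open>h\<nu>\<close>; meaningful only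
  if \<open>\<integral>h d\<nu> < \<infinity>\<close>.
\<close>

definition pois_avg :: "'a measure \<Rightarrow> ('a \<Rightarrow> ennreal) \<Rightarrow> ('a list \<Rightarrow> ennreal) \<Rightarrow> ennreal" where
  "pois_avg \<nu> h F = ennreal (exp (- enn2real (\<integral>\<^sup>+x. h x \<partial>\<nu>))) * (\<Sum>k. lint \<nu> h k F * ennreal (1 / fact k))"

lemma pois_avg_mono:
  assumes "\<And>x. x \<notin> S \<Longrightarrow> h x = 0" "\<And>xs. set xs \<subseteq> S \<Longrightarrow> F xs \<le> G xs"
  shows "pois_avg \<nu> h F \<le> pois_avg \<nu> h G"
  unfolding pois_avg_def
  by (intro mult_left_mono suminf_le mult_right_mono lint_mono[OF assms(1)] assms(2)) auto

text \<open>
  The expected total weight of at most \<open>n\<close> points visited by the depth first exploration from the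
  weighted points \<open>L\<close> among the points \<open>X\<close>, where \<open>\<kappa> w c y\<close> is the weight of \<open>y\<close> if it is found as a neighbour of
  \<open>w\<close>, which has weight \<open>c\<close>.
\<close>

fun explore :: "('a \<Rightarrow> 'a \<Rightarrow> ennreal) \<Rightarrow> ('a \<Rightarrow> ennreal \<Rightarrow> 'a \<Rightarrow> ennreal) \<Rightarrow> nat \<Rightarrow>
    ('a \<times> ennreal) list \<Rightarrow> 'a list \<Rightarrow> ennreal" where
  "explore \<phi> \<kappa> 0 L X = 0"
| "explore \<phi> \<kappa> (Suc n) [] X = 0"
| "explore \<phi> \<kappa> (Suc n) (p # L) X = snd p + thin (\<phi> (fst p)) X
     (\<lambda>Y Z. explore \<phi> \<kappa> n (map (\<lambda>y. (y, \<kappa> (fst p) (snd p) y)) Y @ L) Z)"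

lemma explore_Suc_mono: "explore \<phi> \<kappa> n L X \<le> explore \<phi> \<kappa> (Suc n) L X"
proof (induction n arbitrary: L X)
  case (Suc n)
  show ?case
    by (cases L) (auto simp del: explore.simps simp: explore.simps(2,3) intro!: add_mono thin_mono Suc)
qed simp

lemma measurable_explore:
  assumes \<phi>: "case_prod \<phi> \<in> borel_measurable (borel \<Otimes>\<^sub>M borel)"
    and \<kappa>: "(\<lambda>(w, c, y). \<kappa> w c y) \<in> borel_measurable (borel \<Otimes>\<^sub>M borel \<Otimes>\<^sub>M borel)"
    and "\<And>f. f \<in> set Ls \<Longrightarrow> f \<in> M \<rightarrow>\<^sub>M borel \<Otimes>\<^sub>M borel" "\<And>f. f \<in> set Xs \<Longrightarrow> f \<in> M \<rightarrow>\<^sub>M borel"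
  shows "(\<lambda>\<omega>. explore \<phi> \<kappa> n (map (\<lambda>f. f \<omega>) Ls) (map (\<lambda>f. f \<omega>) Xs)) \<in> borel_measurable M"
  using assms(3,4)
proof (induction n arbitrary: Ls Xs)
  case (Suc n)
  show ?case
  proof (cases Ls)
    case (Cons f Fs)
    have [measurable]: "f \<in> M \<rightarrow>\<^sub>M borel \<Otimes>\<^sub>M borel" using Suc.prems Cons by auto
    have "(\<lambda>\<omega>. thin ((\<lambda>\<omega>. \<phi> (fst (f \<omega>))) \<omega>) (map (\<lambda>f. f \<omega>) Xs) ((\<lambda>\<omega> Y Z. explore \<phi> \<kappa> n
         (map (\<lambda>y. (y, \<kappa> (fst (f \<omega>)) (snd (f \<omega>)) y)) Y @ map (\<lambda>f. f \<omega>) Fs) Z) \<omega>)) \<in> borel_measurable M"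
    proof (rule measurable_thin)
      fix x assume "x \<in> set Xs"
      then have [measurable]: "x \<in> M \<rightarrow>\<^sub>M borel" using Suc.prems by auto
      show "x \<in> M \<rightarrow>\<^sub>M borel" by fact
      have "(\<lambda>\<omega>. (fst (f \<omega>), x \<omega>)) \<in> M \<rightarrow>\<^sub>M borel \<Otimes>\<^sub>M borel" by measurable
      from measurable_compose[OF this \<phi>] show "(\<lambda>\<omega>. \<phi> (fst (f \<omega>)) (x \<omega>)) \<in> borel_measurable M" by simp
    next
      fix Y Z assume YZ: "set Y \<subseteq> set Xs" "set Z \<subseteq> set Xs"
      have "(\<lambda>\<omega>. explore \<phi> \<kappa> n (map (\<lambda>f. f \<omega>) (map (\<lambda>y \<omega>. (y \<omega>, \<kappa> (fst (f \<omega>)) (snd (f \<omega>)) (y \<omega>))) Y @ Fs))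
          (map (\<lambda>f. f \<omega>) Z)) \<in> borel_measurable M"
      proof (rule Suc.IH)
        fix z assume "z \<in> set Z" then show "z \<in> M \<rightarrow>\<^sub>M borel" using YZ Suc.prems by auto
      next
        fix l assume "l \<in> set (map (\<lambda>y \<omega>. (y \<omega>, \<kappa> (fst (f \<omega>)) (snd (f \<omega>)) (y \<omega>))) Y @ Fs)"
        then consider "l \<in> set Fs" | y where "y \<in> set Y" "l = (\<lambda>\<omega>. (y \<omega>, \<kappa> (fst (f \<omega>)) (snd (f \<omega>)) (y \<omega>)))"
          by auto
        then show "l \<in> M \<rightarrow>\<^sub>M borel \<Otimes>\<^sub>M borel"
        proof cases
          case 2
          then have [measurable]: "y \<in> M \<rightarrow>\<^sub>M borel" using YZ Suc.prems by auto
          have "(\<lambda>\<omega>. (fst (f \<omega>), snd (f \<omega>), y \<omega>)) \<in> M \<rightarrow>\<^sub>M borel \<Otimes>\<^sub>M borel \<Otimes>\<^sub>M borel" by measurable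
          from measurable_compose[OF this \<kappa>]
          have [measurable]: "(\<lambda>\<omega>. \<kappa> (fst (f \<omega>)) (snd (f \<omega>)) (y \<omega>)) \<in> borel_measurable M" by simp
          show ?thesis unfolding 2 by measurable
        qed (use Suc.prems Cons in auto)
      qed
      then show "(\<lambda>\<omega>. explore \<phi> \<kappa> n (map (\<lambda>y. (y, \<kappa> (fst (f \<omega>)) (snd (f \<omega>)) y)) (map (\<lambda>f. f \<omega>) Y)
          @ map (\<lambda>f. f \<omega>) Fs) (map (\<lambda>f. f \<omega>) Z)) \<in> borel_measurable M"
        by (simp add: comp_def)
    qed
    then have [measurable]: "(\<lambda>\<omega>. thin (\<phi> (fst (f \<omega>))) (map (\<lambda>f. f \<omega>) Xs) (\<lambda>Y Z. explore \<phi> \<kappa> n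
         (map (\<lambda>y. (y, \<kappa> (fst (f \<omega>)) (snd (f \<omega>)) y)) Y @ map (\<lambda>f. f \<omega>) Fs) Z)) \<in> borel_measurable M"
      by simp
    show ?thesis unfolding Cons by simp
  qed simp
qed simp

lemma lmeas_explore:
  assumes \<phi>: "case_prod \<phi> \<in> borel_measurable (borel \<Otimes>\<^sub>M borel)"
    and \<kappa>: "(\<lambda>(w, c, y). \<kappa> w c y) \<in> borel_measurable (borel \<Otimes>\<^sub>M borel \<Otimes>\<^sub>M borel)"
  shows "lmeas (explore \<phi> \<kappa> n L)"
  unfolding lmeas_def
proof
  fix k
  have "(\<lambda>\<omega>. explore \<phi> \<kappa> n (map (\<lambda>f. f \<omega>) (map (\<lambda>p _. p) L)) (map (\<lambda>f. f \<omega>) (map (\<lambda>i x. x i) [0..<k])))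
     \<in> borel_measurable (PiM UNIV (\<lambda>_. borel))"
    by (rule measurable_explore[OF \<phi> \<kappa>]) (auto intro: measurable_PiM_UNIV_component)
  then show "(\<lambda>x. explore \<phi> \<kappa> n L (map x [0..<k])) \<in> borel_measurable (PiM UNIV (\<lambda>_. borel))"
    by (simp add: comp_def)
qed

lemma lmeas2_explore:
  assumes \<phi>: "case_prod \<phi> \<in> borel_measurable (borel \<Otimes>\<^sub>M borel)"
    and \<kappa>: "(\<lambda>(w, c, y). \<kappa> w c y) \<in> borel_measurable (borel \<Otimes>\<^sub>M borel \<Otimes>\<^sub>M borel)"
    and a [measurable]: "a \<in> borel_measurable borel"
  shows "lmeas2 (\<lambda>Y. explore \<phi> \<kappa> n (map (\<lambda>y. (y, a y)) Y @ L))"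
  unfolding lmeas2_def
proof (intro allI)
  fix j k
  have "(\<lambda>\<omega>. explore \<phi> \<kappa> n (map (\<lambda>f. f \<omega>) (map (\<lambda>i x. (x i, a (x i))) [0..<j] @ map (\<lambda>p _. p) L))
      (map (\<lambda>f. f \<omega>) (map (\<lambda>i x. x i) [j..<j+k])))
     \<in> borel_measurable (PiM UNIV (\<lambda>_. borel))"
  proof (rule measurable_explore[OF \<phi> \<kappa>])
    fix f :: "(nat \<Rightarrow> 'a) \<Rightarrow> 'a \<times> ennreal"
    assume "f \<in> set (map (\<lambda>i x. (x i, a (x i))) [0..<j] @ map (\<lambda>p _. p) L)"
    moreover have "(\<lambda>x. (x i, a (x i))) \<in> PiM UNIV (\<lambda>_. borel) \<rightarrow>\<^sub>M borel \<Otimes>\<^sub>M borel" for i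
      using measurable_compose[OF measurable_PiM_UNIV_component[of i] a] measurable_PiM_UNIV_component[of i]
      by (rule measurable_Pair[rotated])
    ultimately show "f \<in> PiM UNIV (\<lambda>_. borel) \<rightarrow>\<^sub>M borel \<Otimes>\<^sub>M borel" by auto
  qed (auto intro: measurable_PiM_UNIV_component)
  then show "(\<lambda>x. explore \<phi> \<kappa> n (map (\<lambda>y. (y, a y)) (map x [0..<j]) @ L) (map x [j..<j + k]))
      \<in> borel_measurable (PiM UNIV (\<lambda>_. borel))"
    by (simp add: comp_def)
qed

context
  fixes \<nu> :: "'a::second_countable_topology measure"
  assumes sets_nu [measurable_cong]: "sets \<nu> = sets borel" and sf: "sigma_finite_measure \<nu>"
begin

lemma lmeas_lint2:
  assumes "h \<in> borel_measurable borel" "lmeas2 H"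
  shows "lmeas (\<lambda>Y. lint \<nu> h k (H Y))"
  unfolding lmeas_def
proof
  fix j
  from lmeas2_lint[OF sets_nu sf assms]
  have "(\<lambda>x. lint \<nu> h k (\<lambda>Z. H (map x [0..<j]) ([] @ Z))) \<in> borel_measurable (PiM UNIV (\<lambda>_. borel))"
    by (rule lmeas2D[where fs = "map (\<lambda>i x. x i) [0..<j]" and gs = "[]"])
      (auto intro: measurable_PiM_UNIV_component)
  then show "(\<lambda>x. lint \<nu> h k (H (map x [0..<j]))) \<in> borel_measurable (PiM UNIV (\<lambda>_. borel))" by simp
qed

lemma lmeas_suminf: "(\<And>i. lmeas (F i)) \<Longrightarrow> lmeas (\<lambda>x. \<Sum>i. F i x)"
  unfolding lmeas_def by (intro allI borel_measurable_suminf_order) blast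

lemma lmeas_pois_avg:
  assumes "h \<in> borel_measurable borel" "lmeas2 H"
  shows "lmeas (\<lambda>Y. pois_avg \<nu> h (H Y))"
  unfolding pois_avg_def by (intro lmeas_mult lmeas_suminf lmeas_lint2 assms lmeas_const)

lemma lint_suminf:
  assumes [measurable]: "h \<in> borel_measurable borel" and "\<And>i. lmeas (F i)"
  shows "lint \<nu> h k (\<lambda>xs. \<Sum>i. F i xs) = (\<Sum>i. lint \<nu> h k (F i))"
  using assms(2)
proof (induction k arbitrary: F)
  case (Suc k)
  note [measurable] = measurable_lint_Cons[OF sets_nu sf assms(1) Suc.prems(1)]
  show ?case
    using Suc by (simp add: lmeas_Cons nn_integral_suminf[symmetric])
qed simp

context
  fixes h assumes h [measurable]: "h \<in> borel_measurable borel" and fin: "(\<integral>\<^sup>+x. h x \<partial>\<nu>) < \<infinity>"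
begin

lemma pois_avg_add: "lmeas F \<Longrightarrow> lmeas G \<Longrightarrow> pois_avg \<nu> h (\<lambda>xs. F xs + G xs) = pois_avg \<nu> h F + pois_avg \<nu> h G"
  by (simp add: pois_avg_def lint_add[OF sets_nu sf h] distrib_left distrib_right suminf_add[symmetric])

lemma pois_avg_cmult: "lmeas F \<Longrightarrow> pois_avg \<nu> h (\<lambda>xs. c * F xs) = c * pois_avg \<nu> h F"
  by (simp add: pois_avg_def lint_cmult[OF sets_nu sf h] mult.assoc) (simp add: ac_simps)

lemma pois_avg_const: "pois_avg \<nu> h (\<lambda>_. c) = c"
proof -
  obtain m where m: "0 \<le> m" "(\<integral>\<^sup>+x. h x \<partial>\<nu>) = ennreal m"
    using fin by (cases "\<integral>\<^sup>+x. h x \<partial>\<nu>") auto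
  have "pois_avg \<nu> h (\<lambda>_. c) = c * (ennreal (exp (- m)) * (\<Sum>k. ennreal m ^ k * ennreal (1 / fact k)))"
    using m by (simp add: pois_avg_def lint_const[OF sets_nu sf h] mult.assoc) (simp add: ac_simps)
  also have "\<dots> = c" using m by (simp add: suminf_ennreal_exp ennreal_mult[symmetric] exp_minus)
  finally show ?thesis .
qed

lemma lmeas_sum_list:
  assumes e [measurable]: "e \<in> borel_measurable borel"
  shows "lmeas (\<lambda>Y. \<Sum>y\<leftarrow>Y. e y :: ennreal)"
proof -
  have "(\<lambda>x. \<Sum>i\<leftarrow>I. e (x i) :: ennreal) \<in> borel_measurable (PiM UNIV (\<lambda>_. borel))" for I :: "nat list"
  proof (induction I)
    case (Cons i I)
    have "(\<lambda>x. e (x i)) \<in> borel_measurable (PiM UNIV (\<lambda>_. borel))"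
      by (rule measurable_compose[OF measurable_PiM_UNIV_component e])
    then show ?case using Cons by simp
  qed simp
  then show ?thesis by (simp add: lmeas_def comp_def)
qed

text \<open>Campbell's formula. Each of the \<open>Suc k\<close> positions of a list contributes the
  same integral, and this factor reduces \<open>1 / fact (Suc k)\<close> to
  \<open>1 / fact k\<close>, leaving the exponential series.\<close>

lemma pois_avg_sum_list:
  assumes e [measurable]: "e \<in> borel_measurable borel"
  shows "pois_avg \<nu> h (\<lambda>Y. \<Sum>y\<leftarrow>Y. e y) = (\<integral>\<^sup>+x. h x * e x \<partial>\<nu>)"
proof -
  obtain m where m: "0 \<le> m" "(\<integral>\<^sup>+x. h x \<partial>\<nu>) = ennreal m"
    using fin by (cases "\<integral>\<^sup>+x. h x \<partial>\<nu>") auto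
  let ?I = "\<integral>\<^sup>+x. h x * e x \<partial>\<nu>"
  have *: "lint \<nu> h (Suc k) (\<lambda>Y. \<Sum>y\<leftarrow>Y. e y) = of_nat (Suc k) * ennreal m ^ k * ?I" for k
  proof (induction k)
    case (Suc k)
    have "lint \<nu> h (Suc (Suc k)) (\<lambda>Y. \<Sum>y\<leftarrow>Y. e y) =
       (\<integral>\<^sup>+x. ennreal m ^ Suc k * (h x * e x) + (of_nat (Suc k) * ennreal m ^ k * ?I) * h x \<partial>\<nu>)"
      by (subst lint.simps(2))
        (simp del: lint.simps power_Suc add: lint_add[OF sets_nu sf h] lmeas_sum_list lint_const[OF sets_nu sf h] Suc m algebra_simps)
    also have "\<dots> = ennreal m ^ Suc k * ?I + of_nat (Suc k) * ennreal m ^ k * ?I * ennreal m"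
      by (simp del: power_Suc add: nn_integral_add nn_integral_cmult m)
    finally show ?case by (simp add: algebra_simps)
  qed (simp add: nn_integral_cmult)
  have "(\<Sum>k. lint \<nu> h k (\<lambda>Y. \<Sum>y\<leftarrow>Y. e y) * ennreal (1 / fact k)) =
    (\<Sum>k. lint \<nu> h (Suc k) (\<lambda>Y. \<Sum>y\<leftarrow>Y. e y) * ennreal (1 / fact (Suc k)))"
    by (rule suminf_mono_reindex[symmetric, of Suc])
      (auto simp: strict_mono_def image_iff, metis lint.simps(1) list.map(1) mult_zero_left not0_implies_Suc sum_list.Nil)
  also have "\<dots> = (\<Sum>k. ?I * (ennreal m ^ k * ennreal (1 / fact k)))"
  proof (rule suminf_cong)
    fix k
    have c: "of_nat (Suc k) * ennreal (1 / fact (Suc k)) = ennreal (1 / fact k)"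
      unfolding ennreal_of_nat_eq_real_of_nat by (subst ennreal_mult[symmetric]) (auto simp: divide_simps)
    show "lint \<nu> h (Suc k) (\<lambda>Y. \<Sum>y\<leftarrow>Y. e y) * ennreal (1 / fact (Suc k)) = ?I * (ennreal m ^ k * ennreal (1 / fact k))"
      unfolding * c[symmetric] by (simp only: ac_simps)
  qed
  also have "\<dots> = ?I * ennreal (exp m)" using m by (simp add: suminf_ennreal_exp)
  finally have **: "(\<Sum>k. lint \<nu> h k (\<lambda>Y. \<Sum>y\<leftarrow>Y. e y) * ennreal (1 / fact k)) = ?I * ennreal (exp m)" .
  have "ennreal (exp (- m)) * ennreal (exp m) = 1"
    by (simp add: ennreal_mult[symmetric] exp_minus)
  moreover have "ennreal (exp (- m)) * (?I * ennreal (exp m)) = ?I * (ennreal (exp (- m)) * ennreal (exp m))"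
    by (simp only: ac_simps)
  ultimately show ?thesis
    unfolding pois_avg_def ** using m by simp
qed

text \<open>The thinning theorem: kept and discarded points form independent Poisson processes. In
  \<open>lint_thin\<close> the binomial coefficient times \<open>1 / fact k\<close> splits into
  \<open>1 / fact j\<close> and \<open>1 / fact (k - j)\<close>, and the sum over \<open>k\<close>
  becomes a Cauchy product.\<close>

lemma pois_avg_thin:
  assumes g [measurable]: "g \<in> borel_measurable borel" and g1: "\<And>x. g x \<le> 1" and H: "lmeas2 H"
  shows "pois_avg \<nu> h (\<lambda>X. thin g X H) = pois_avg \<nu> (\<lambda>x. g x * h x) (\<lambda>Y. pois_avg \<nu> (\<lambda>x. (1 - g x) * h x) (H Y))"
proof -
  let ?p = "\<lambda>x. g x * h x" and ?q = "\<lambda>x. (1 - g x) * h x"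
  have p: "?p \<in> borel_measurable borel" and q: "?q \<in> borel_measurable borel" by measurable
  define A where "A j l = lint \<nu> ?p j (\<lambda>Y. lint \<nu> ?q l (H Y))" for j l
  have hpq: "h x = ?p x + ?q x" for x
    by (metis g1 ennreal_add_1_minus distrib_right mult_1)
  have "(\<integral>\<^sup>+x. h x \<partial>\<nu>) = (\<integral>\<^sup>+x. ?p x \<partial>\<nu>) + (\<integral>\<^sup>+x. ?q x \<partial>\<nu>)"
    by (subst nn_integral_add[symmetric]) (auto simp: hpq[symmetric])
  then have N: "ennreal (exp (- enn2real (\<integral>\<^sup>+x. h x \<partial>\<nu>))) =
      ennreal (exp (- enn2real (\<integral>\<^sup>+x. ?p x \<partial>\<nu>))) * ennreal (exp (- enn2real (\<integral>\<^sup>+x. ?q x \<partial>\<nu>)))"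
    using fin by (simp add: enn2real_plus less_top exp_add[symmetric] ennreal_mult[symmetric])
  have c: "of_nat (k choose j) * ennreal (1 / fact k) = ennreal (1 / fact j) * ennreal (1 / fact (k - j))" if "j \<le> k" for j k
  proof -
    have "real (k choose j) * (1 / fact k) = (1 / fact j) * (1 / fact (k - j))"
      using that by (simp add: binomial_fact field_simps)
    then show ?thesis
      unfolding ennreal_of_nat_eq_real_of_nat by (simp only: ennreal_mult[symmetric] of_nat_0_le_iff divide_nonneg_nonneg fact_ge_zero zero_le_one)
  qed
  have "(\<Sum>k. lint \<nu> h k (\<lambda>X. thin g X H) * ennreal (1 / fact k)) =
     (\<Sum>k. \<Sum>j\<le>k. A j (k - j) * ennreal (1 / fact j) * ennreal (1 / fact (k - j)))"
    unfolding lint_thin[OF sets_nu sf h g H] sum_distrib_right A_def[symmetric]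
  proof (intro suminf_cong sum.cong refl)
    fix k j :: nat assume "j \<in> {..k}"
    then have "A j (k - j) * (of_nat (k choose j) * ennreal (1 / fact k)) =
        A j (k - j) * (ennreal (1 / fact j) * ennreal (1 / fact (k - j)))"
      by (subst c) auto
    then show "of_nat (k choose j) * A j (k - j) * ennreal (1 / fact k) =
        A j (k - j) * ennreal (1 / fact j) * ennreal (1 / fact (k - j))"
      by (simp only: ac_simps)
  qed
  also have "\<dots> = (\<Sum>j. \<Sum>l. A j l * ennreal (1 / fact j) * ennreal (1 / fact l))"
    by (rule ennreal_suminf_Cauchy)
  also have "\<dots> = (\<Sum>j. (\<Sum>l. A j l * ennreal (1 / fact l)) * ennreal (1 / fact j))"
    by (simp add: ac_simps flip: ennreal_suminf_cmult)
  also have "\<dots> = (\<Sum>j. lint \<nu> ?p j (\<lambda>Y. \<Sum>l. lint \<nu> ?q l (H Y) * ennreal (1 / fact l)) * ennreal (1 / fact j))"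
    using lmeas_lint2[OF q H] lint_cmult[OF sets_nu sf p lmeas_lint2[OF q H]]
    by (simp add: lint_suminf[OF p] lmeas_mult A_def mult.commute)
  finally have *: "(\<Sum>k. lint \<nu> h k (\<lambda>X. thin g X H) * ennreal (1 / fact k)) = \<dots>" .
  show ?thesis
    unfolding pois_avg_def N *
    by (subst lint_cmult[OF sets_nu sf p])
      (intro lmeas_suminf lmeas_mult lmeas_lint2[OF q H] lmeas_const, simp only: mult.assoc ennreal_suminf_cmult)
qed

end

end

section \<open>Exploration of the cluster\<close>

text \<open>With \<open>kscale E\<close> the weight of a point is the weight of its root times the
  product of the factors \<open>E\<close> along its tree path; \<open>kone\<close> merely counts the
  points found.\<close>

abbreviation (input) "kscale E \<equiv> (\<lambda>w c y. c * (E w y :: ennreal))"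
abbreviation (input) "kone \<equiv> (\<lambda>_ _ _. 1 :: ennreal)"

text \<open>The weights do not influence which points are visited, and \<open>kscale\<close> passes
  them on linearly.\<close>

lemma explore_add:
  "explore \<phi> (kscale E) n (map (\<lambda>(w, c, d). (w, c + d)) L) X =
     explore \<phi> (kscale E) n (map (\<lambda>(w, c, d). (w, c)) L) X + explore \<phi> (kscale E) n (map (\<lambda>(w, c, d). (w, d)) L) X"
proof (induction n arbitrary: L X)
  case (Suc n)
  show ?case
  proof (cases L)
    case (Cons p L')
    obtain w c d where p: "p = (w, c, d)" by (cases p)
    let ?y = "\<lambda>y. (y, c * E w y, d * E w y)"
    have "thin (\<phi> w) X (\<lambda>Y Z. explore \<phi> (kscale E) n (map (\<lambda>y. (y, (c + d) * E w y)) Y @ map (\<lambda>(w, c, d). (w, c + d)) L') Z) =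
      thin (\<phi> w) X (\<lambda>Y Z. explore \<phi> (kscale E) n (map (\<lambda>y. (y, c * E w y)) Y @ map (\<lambda>(w, c, d). (w, c)) L') Z +
        explore \<phi> (kscale E) n (map (\<lambda>y. (y, d * E w y)) Y @ map (\<lambda>(w, c, d). (w, d)) L') Z)"
      using Suc[of "map ?y Y @ L'" Z for Y Z] by (simp add: comp_def distrib_right)
    then show ?thesis
      unfolding Cons p by (simp add: thin_add algebra_simps)
  qed simp
qed simp

lemma explore_scale:
  "explore \<phi> (kscale E) n (map (\<lambda>(w, c). (w, a * c)) L) X = a * explore \<phi> (kscale E) n L X"
proof (induction n arbitrary: L X)
  case (Suc n)
  show ?case
  proof (cases L)
    case (Cons p L')
    obtain w c where p: "p = (w, c)" by (cases p)
    have "(\<lambda>Y. explore \<phi> (kscale E) n (map (\<lambda>y. (y, a * c * E w y)) Y @ map (\<lambda>(w, c). (w, a * c)) L')) =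
        (\<lambda>Y Z. a * explore \<phi> (kscale E) n (map (\<lambda>y. (y, c * E w y)) Y @ L') Z)"
    proof (intro ext)
      fix Y Z
      show "explore \<phi> (kscale E) n (map (\<lambda>y. (y, a * c * E w y)) Y @ map (\<lambda>(w, c). (w, a * c)) L') Z =
        a * explore \<phi> (kscale E) n (map (\<lambda>y. (y, c * E w y)) Y @ L') Z"
        using Suc[of "map (\<lambda>y. (y, c * E w y)) Y @ L'" Z] by (simp add: comp_def mult.assoc)
    qed
    then show ?thesis
      unfolding Cons p by (simp add: thin_cmult distrib_left)
  qed simp
qed simp

lemma pois_avg_zero [simp]: "pois_avg \<nu> h (\<lambda>_. 0) = 0"
proof -
  have "lint \<nu> h k (\<lambda>_. 0) = 0" for k by (induction k) auto
  then show ?thesis by (simp add: pois_avg_def)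
qed

lemma explore_0 [simp]: "explore \<phi> \<kappa> 0 L = (\<lambda>_. 0)" "explore \<phi> \<kappa> n [] = (\<lambda>_. 0)"
  by (auto intro!: ext) (cases n; simp)

text \<open>Closed under multiplication by measurable factors at most \<open>1\<close>, hence under
  both thinnings in a step of the exploration (\<open>env_phi\<close>).\<close>

definition envs :: "('a::topological_space \<Rightarrow> ennreal) \<Rightarrow> ('a \<Rightarrow> ennreal) set" where
  "envs hmax = {h \<in> borel_measurable borel. \<forall>x. h x \<le> hmax x}"

context
  fixes \<nu> :: "'a::second_countable_topology measure" and \<phi> E :: "'a \<Rightarrow> 'a \<Rightarrow> ennreal"
    and S :: "'a set" and hmax :: "'a \<Rightarrow> ennreal"
  assumes sets_nu [measurable_cong]: "sets \<nu> = sets borel" and sf: "sigma_finite_measure \<nu>"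
    and \<phi>: "case_prod \<phi> \<in> borel_measurable (borel \<Otimes>\<^sub>M borel)"
    and E: "case_prod E \<in> borel_measurable (borel \<Otimes>\<^sub>M borel)"
    and \<phi>1: "\<And>x y. \<phi> x y \<le> 1" and E1: "\<And>x y. 1 \<le> E x y"
    and hmax [measurable]: "hmax \<in> borel_measurable borel" and hfin: "(\<integral>\<^sup>+x. hmax x \<partial>\<nu>) < \<infinity>"
    and hS: "\<And>x. x \<notin> S \<Longrightarrow> hmax x = 0"
begin

abbreviation "env \<equiv> envs hmax"

lemma phi_w: "\<phi> w \<in> borel_measurable borel"
  using measurable_compose[OF measurable_Pair1' \<phi>, of w] by simp

lemma E_w: "E w \<in> borel_measurable borel"
  using measurable_compose[OF measurable_Pair1' E, of w] by simp

lemma kscale_meas: "(\<lambda>(w, c, y). kscale E w c y) \<in> borel_measurable (borel \<Otimes>\<^sub>M borel \<Otimes>\<^sub>M borel)"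
proof -
  have "(\<lambda>x. (fst x, snd (snd x))) \<in> borel \<Otimes>\<^sub>M borel \<Otimes>\<^sub>M borel \<rightarrow>\<^sub>M borel \<Otimes>\<^sub>M borel" by measurable
  from measurable_compose[OF this E]
  have [measurable]: "(\<lambda>x. E (fst x) (snd (snd x))) \<in> borel_measurable (borel \<Otimes>\<^sub>M (borel :: ennreal measure) \<Otimes>\<^sub>M borel)"
    by (simp add: split_beta')
  show ?thesis unfolding split_beta' by measurable
qed

lemma envD:
  assumes "h \<in> env"
  shows "h \<in> borel_measurable borel" "(\<integral>\<^sup>+x. h x \<partial>\<nu>) < \<infinity>" "x \<notin> S \<Longrightarrow> h x = 0"
proof -
  have "(\<integral>\<^sup>+x. h x \<partial>\<nu>) \<le> (\<integral>\<^sup>+x. hmax x \<partial>\<nu>)"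
    using assms by (intro nn_integral_mono) (auto simp: envs_def)
  then show "(\<integral>\<^sup>+x. h x \<partial>\<nu>) < \<infinity>" using hfin by order
  show "h \<in> borel_measurable borel" using assms by (simp add: envs_def)
  show "x \<notin> S \<Longrightarrow> h x = 0" using assms hS[of x] by (auto simp: envs_def) (metis le_zero_eq)
qed

lemma env_mult:
  assumes "h \<in> env" "g \<in> borel_measurable borel" "\<And>x. g x \<le> 1"
  shows "(\<lambda>x. g x * h x) \<in> env"
proof -
  have "g x * h x \<le> hmax x" for x
    using mult_mono[of "g x" 1 "h x" "hmax x"] assms by (auto simp: envs_def)
  then show ?thesis using assms by (auto simp: envs_def)
qed

lemma env_phi:
  assumes "h \<in> env" shows "(\<lambda>x. \<phi> w x * h x) \<in> env" "(\<lambda>x. (1 - \<phi> w x) * h x) \<in> env"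
  using phi_w[of w] by (auto intro!: env_mult assms \<phi>1 simp: diff_le_self_ennreal)

text \<open>The thinning theorem applied to one step. The second part is the measurability that
  linearity of the outer average will require.\<close>

lemma pois_avg_explore_Suc:
  assumes h: "h \<in> env"
    and \<kappa>: "(\<lambda>(w, c, y). \<kappa> w c y) \<in> borel_measurable (borel \<Otimes>\<^sub>M borel \<Otimes>\<^sub>M borel)"
  shows "pois_avg \<nu> h (explore \<phi> \<kappa> (Suc n) ((w, c) # L)) = c + pois_avg \<nu> (\<lambda>x. \<phi> w x * h x)
    (\<lambda>Y. pois_avg \<nu> (\<lambda>x. (1 - \<phi> w x) * h x) (explore \<phi> \<kappa> n (map (\<lambda>y. (y, \<kappa> w c y)) Y @ L)))"
    and "lmeas (\<lambda>Y. pois_avg \<nu> (\<lambda>x. (1 - \<phi> w x) * h x) (explore \<phi> \<kappa> n (map (\<lambda>y. (y, \<kappa> w c y)) Y @ L)))"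
proof -
  note hm = envD(1,2)[OF h]
  have "(\<lambda>y. (w, c, y)) \<in> borel \<rightarrow>\<^sub>M borel \<Otimes>\<^sub>M borel \<Otimes>\<^sub>M borel" by measurable
  from measurable_compose[OF this \<kappa>] have "\<kappa> w c \<in> borel_measurable borel" by simp
  from lmeas2_explore[OF \<phi> \<kappa> this]
  have l2: "lmeas2 (\<lambda>Y. explore \<phi> \<kappa> n (map (\<lambda>y. (y, \<kappa> w c y)) Y @ L))" .
  show "lmeas (\<lambda>Y. pois_avg \<nu> (\<lambda>x. (1 - \<phi> w x) * h x) (explore \<phi> \<kappa> n (map (\<lambda>y. (y, \<kappa> w c y)) Y @ L)))"
    by (rule lmeas_pois_avg[OF sets_nu sf envD(1)[OF env_phi(2)[OF h]] l2])
  have "explore \<phi> \<kappa> (Suc n) ((w, c) # L) =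
     (\<lambda>X. c + thin (\<phi> w) X (\<lambda>Y. explore \<phi> \<kappa> n (map (\<lambda>y. (y, \<kappa> w c y)) Y @ L)))"
    by (rule ext) simp
  then show "pois_avg \<nu> h (explore \<phi> \<kappa> (Suc n) ((w, c) # L)) = c + pois_avg \<nu> (\<lambda>x. \<phi> w x * h x)
    (\<lambda>Y. pois_avg \<nu> (\<lambda>x. (1 - \<phi> w x) * h x) (explore \<phi> \<kappa> n (map (\<lambda>y. (y, \<kappa> w c y)) Y @ L)))"
    using pois_avg_add[OF sets_nu sf hm] pois_avg_const[OF sets_nu sf hm] pois_avg_thin[OF sets_nu sf hm phi_w \<phi>1 l2]
    by (simp add: lmeas_thin[OF phi_w l2])
qed

text \<open>The \<open>b\<close> of the overview, cut off at \<open>n\<close> steps and as a true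
  supremum over \<open>S\<close>, so that it can be applied at every point met on the way.\<close>

definition bsup :: "nat \<Rightarrow> ennreal" where
  "bsup n = (SUP h\<in>env. SUP v\<in>S. pois_avg \<nu> h (explore \<phi> (kscale E) n [(v, 1)]))"

lemma bsup_upper: "h \<in> env \<Longrightarrow> v \<in> S \<Longrightarrow> pois_avg \<nu> h (explore \<phi> (kscale E) n [(v, 1)]) \<le> bsup n"
  unfolding bsup_def by (meson SUP_upper SUP_upper2)

lemma bsup_mono: "bsup n \<le> bsup (Suc n)"
  unfolding bsup_def by (intro SUP_mono' pois_avg_mono[of UNIV]) (auto simp del: explore.simps intro: explore_Suc_mono)

lemma pois_avg_explore_single:
  assumes h: "h \<in> env" "v \<in> S"
  shows "pois_avg \<nu> h (explore \<phi> (kscale E) n [(v, c)]) \<le> c * bsup n"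
proof -
  have "explore \<phi> (kscale E) n [(v, c)] = (\<lambda>X. c * explore \<phi> (kscale E) n [(v, 1)] X)"
    using explore_scale[of \<phi> E n c "[(v, 1)]"] by auto
  then have "pois_avg \<nu> h (explore \<phi> (kscale E) n [(v, c)]) = c * pois_avg \<nu> h (explore \<phi> (kscale E) n [(v, 1)])"
    using pois_avg_cmult[OF sets_nu sf envD(1,2)[OF h(1)] lmeas_explore[OF \<phi> kscale_meas]] by simp
  then show ?thesis using bsup_upper[OF h] by (simp add: mult_left_mono)
qed

text \<open>The search is depth first, so everything found from \<open>L1\<close> is finished before
  \<open>L2\<close> is touched, and what is then left of the environment still lies in
  \<open>env\<close>. Each entry of \<open>L2\<close> thus costs at most its weight times
  \<open>bsup n\<close>.\<close>

lemma pois_avg_explore_append: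
  assumes "h \<in> env" "fst ` set L1 \<subseteq> S" "fst ` set L2 \<subseteq> S"
  shows "pois_avg \<nu> h (explore \<phi> (kscale E) n (L1 @ L2)) \<le>
     pois_avg \<nu> h (explore \<phi> (kscale E) n L1) + (\<Sum>p\<leftarrow>L2. snd p) * bsup n"
  using assms
proof (induction n arbitrary: h L1 L2)
  case 0
  then show ?case by simp
next
  case (Suc n)
  have cons: "pois_avg \<nu> h (explore \<phi> (kscale E) (Suc n) ((w, c) # L1 @ L2)) \<le>
      pois_avg \<nu> h (explore \<phi> (kscale E) (Suc n) ((w, c) # L1)) + (\<Sum>p\<leftarrow>L2. snd p) * bsup (Suc n)"
    if "w \<in> S" "fst ` set L1 \<subseteq> S" "fst ` set L2 \<subseteq> S" for w c L1 L2
  proof -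
    let ?p = "\<lambda>x. \<phi> w x * h x" and ?q = "\<lambda>x. (1 - \<phi> w x) * h x"
    note hp = env_phi(1)[OF Suc.prems(1), of w] and hq = env_phi(2)[OF Suc.prems(1), of w]
    let ?F = "\<lambda>L Y. pois_avg \<nu> ?q (explore \<phi> (kscale E) n (map (\<lambda>y. (y, c * E w y)) Y @ L))"
    let ?\<sigma> = "\<Sum>p\<leftarrow>L2. snd p"
    note rec = pois_avg_explore_Suc[OF Suc.prems(1) kscale_meas, where n = n and w = w and c = c]
    have "pois_avg \<nu> ?p (?F (L1 @ L2)) \<le> pois_avg \<nu> ?p (\<lambda>Y. ?F L1 Y + ?\<sigma> * bsup n)"
    proof (rule pois_avg_mono[of S])
      fix Y assume "set Y \<subseteq> S"
      then show "?F (L1 @ L2) Y \<le> ?F L1 Y + ?\<sigma> * bsup n"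
        using Suc.IH[OF hq, of "map (\<lambda>y. (y, c * E w y)) Y @ L1" L2] that
        by (simp add: image_Un image_comp subset_iff)
    qed (use envD(3)[OF hp] in auto)
    also have "\<dots> = pois_avg \<nu> ?p (?F L1) + ?\<sigma> * bsup n"
      by (simp add: pois_avg_add[OF sets_nu sf envD(1,2)[OF hp]] pois_avg_const[OF sets_nu sf envD(1,2)[OF hp]] rec)
    also have "\<dots> \<le> pois_avg \<nu> ?p (?F L1) + ?\<sigma> * bsup (Suc n)"
      by (intro add_left_mono mult_left_mono bsup_mono) auto
    finally show ?thesis
      unfolding rec(1) by (simp add: add.assoc add_left_mono)
  qed
  \<comment> \<open>For empty \<open>L1\<close> there is no head to expand. The first entry of
    \<open>L2\<close> takes the part of \<open>L1\<close>, and \<open>cons\<close> charges the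
    others.\<close>
  have single: "pois_avg \<nu> h (explore \<phi> (kscale E) (Suc n) L2) \<le> (\<Sum>p\<leftarrow>L2. snd p) * bsup (Suc n)"
    if "fst ` set L2 \<subseteq> S" for L2
    using that
  proof (cases L2)
    case Nil
    then show ?thesis by simp
  next
    case (Cons p L)
    obtain w c where p: "p = (w, c)" by (cases p)
    have "pois_avg \<nu> h (explore \<phi> (kscale E) (Suc n) ((w, c) # [] @ L)) \<le>
      pois_avg \<nu> h (explore \<phi> (kscale E) (Suc n) [(w, c)]) + (\<Sum>p\<leftarrow>L. snd p) * bsup (Suc n)"
      by (rule cons) (use that Cons p in auto)
    also have "\<dots> \<le> c * bsup (Suc n) + (\<Sum>p\<leftarrow>L. snd p) * bsup (Suc n)"
      using that Cons p by (intro add_right_mono pois_avg_explore_single Suc.prems(1)) auto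
    finally show ?thesis
      unfolding Cons p by (simp only: append_Nil list.map sum_list.Cons snd_conv distrib_right)
  qed
  show ?case
  proof (cases L1)
    case Nil
    have "pois_avg \<nu> h (explore \<phi> (kscale E) (Suc n) ([] @ L2)) \<le> (\<Sum>p\<leftarrow>L2. snd p) * bsup (Suc n)"
      using single Suc.prems by simp
    then show ?thesis unfolding Nil by simp
  next
    case (Cons p L)
    then show ?thesis using cons[of "fst p" L L2 "snd p"] Suc.prems by (auto simp del: explore.simps)
  qed
qed

lemma pois_avg_explore_sum:
  assumes "h \<in> env" "fst ` set L \<subseteq> S"
  shows "pois_avg \<nu> h (explore \<phi> (kscale E) n L) \<le> (\<Sum>p\<leftarrow>L. snd p) * bsup n"
proof -
  show ?thesis using pois_avg_explore_append[OF assms(1), of "[]" L n] assms(2) by simp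
qed

text \<open>A crude comparison with a branching process of mean offspring weight at most
  \<open>M\<close>. The bound may grow with \<open>n\<close>; what matters is finiteness, which
  permits the absorption in \<open>exploration_bound\<close>.\<close>

lemma bsup_finite:
  assumes M: "\<And>v. v \<in> S \<Longrightarrow> (\<integral>\<^sup>+y. \<phi> v y * hmax y * E v y \<partial>\<nu>) \<le> M" and "M < \<infinity>"
  shows "bsup n < \<infinity>"
proof (induction n)
  case 0
  have "bsup 0 \<le> 0" unfolding bsup_def by (intro SUP_least) simp
  then show ?case by simp
next
  case (Suc n)
  have "pois_avg \<nu> h (explore \<phi> (kscale E) (Suc n) [(v, 1)]) \<le> 1 + M * bsup n" if h: "h \<in> env" and v: "v \<in> S" for h v
  proof -
    let ?p = "\<lambda>x. \<phi> v x * h x" and ?q = "\<lambda>x. (1 - \<phi> v x) * h x"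
    note hp = env_phi(1)[OF h, of v] and hq = env_phi(2)[OF h, of v]
    have "pois_avg \<nu> ?p (\<lambda>Y. pois_avg \<nu> ?q (explore \<phi> (kscale E) n (map (\<lambda>y. (y, 1 * E v y)) Y @ []))) \<le>
       pois_avg \<nu> ?p (\<lambda>Y. bsup n * (\<Sum>y\<leftarrow>Y. E v y))"
    proof (rule pois_avg_mono[of S])
      fix Y assume "set Y \<subseteq> S"
      then show "pois_avg \<nu> ?q (explore \<phi> (kscale E) n (map (\<lambda>y. (y, 1 * E v y)) Y @ [])) \<le> bsup n * (\<Sum>y\<leftarrow>Y. E v y)"
        using pois_avg_explore_sum[OF hq, of "map (\<lambda>y. (y, 1 * E v y)) Y" n] by (auto simp: comp_def mult.commute[of "sum_list _"] image_image)
    qed (use envD(3)[OF hp] in auto)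
    also have "\<dots> = bsup n * (\<integral>\<^sup>+y. \<phi> v y * h y * E v y \<partial>\<nu>)"
      using E_w by (simp add: pois_avg_cmult[OF sets_nu sf envD(1,2)[OF hp]] pois_avg_sum_list[OF sets_nu sf envD(1,2)[OF hp]]
          lmeas_sum_list[OF sets_nu sf envD(1,2)[OF hp]])
    also have "\<dots> \<le> bsup n * (\<integral>\<^sup>+y. \<phi> v y * hmax y * E v y \<partial>\<nu>)"
      using h by (intro mult_left_mono nn_integral_mono mult_right_mono) (auto simp: envs_def)
    also have "\<dots> \<le> bsup n * M" by (intro mult_left_mono M v) auto
    finally show ?thesis
      unfolding pois_avg_explore_Suc(1)[OF h kscale_meas] by (simp add: mult.commute add_left_mono)
  qed
  then have "bsup (Suc n) \<le> 1 + M * bsup n"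
    unfolding bsup_def[of "Suc n"] by (intro SUP_least)
  also have "\<dots> < \<infinity>" using Suc \<open>M < \<infinity>\<close> by (simp add: ennreal_mult_less_top less_top[symmetric] ennreal_mult_eq_top_iff)
  finally show ?case .
qed

text \<open>The weight \<open>E w y\<close> of a new neighbour is split into \<open>1\<close> and
  \<open>E w y - 1\<close>. The unit part continues like the unweighted exploration; the excess is
  charged at once by \<open>pois_avg_explore_sum\<close>. By Campbell's formula an explored point is
  charged at most \<open>\<epsilon> * bsup n\<close> on average, so the total charge is this times
  the expected number of explored points.\<close>

lemma pois_avg_explore_compare:
  assumes eps: "\<And>v. v \<in> S \<Longrightarrow> (\<integral>\<^sup>+y. \<phi> v y * hmax y * (E v y - 1) \<partial>\<nu>) \<le> \<epsilon>"
    and "h \<in> env" "set L \<subseteq> S"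
  shows "pois_avg \<nu> h (explore \<phi> (kscale E) n (map (\<lambda>w. (w, 1)) L)) \<le>
     (1 + \<epsilon> * bsup n) * pois_avg \<nu> h (explore \<phi> kone n (map (\<lambda>w. (w, 1)) L))"
  using assms(2,3)
proof (induction n arbitrary: h L)
  case 0
  then show ?case by simp
next
  case (Suc n)
  show ?case
  proof (cases L)
    case Nil
    then show ?thesis by simp
  next
    case (Cons w L')
    then have w: "w \<in> S" and L': "set L' \<subseteq> S" using Suc.prems by auto
    let ?p = "\<lambda>x. \<phi> w x * h x" and ?q = "\<lambda>x. (1 - \<phi> w x) * h x"
    let ?L = "map (\<lambda>w. (w, 1)) L'"
    note hp = env_phi(1)[OF Suc.prems(1), of w] and hq = env_phi(2)[OF Suc.prems(1), of w]
    let ?G = "\<lambda>Y. pois_avg \<nu> ?q (explore \<phi> kone n (map (\<lambda>y. (y, 1)) Y @ ?L))"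
    have k1: "(\<lambda>(w::'a, c::ennreal, y::'a). kone w c y) \<in> borel_measurable (borel \<Otimes>\<^sub>M borel \<Otimes>\<^sub>M borel)"
      by simp
    note rec1 = pois_avg_explore_Suc(1)[OF Suc.prems(1) k1, where n = n and w = w and c = 1 and L = ?L]
      and rec2 = pois_avg_explore_Suc(2)[OF Suc.prems(1) k1, where n = n and w = w and L = ?L]
    let ?b = "1 + \<epsilon> * bsup n"
    have "pois_avg \<nu> ?p (\<lambda>Y. pois_avg \<nu> ?q (explore \<phi> (kscale E) n (map (\<lambda>y. (y, 1 * E w y)) Y @ ?L))) \<le>
       pois_avg \<nu> ?p (\<lambda>Y. ?b * ?G Y + bsup n * (\<Sum>y\<leftarrow>Y. E w y - 1))"
    proof (rule pois_avg_mono[of S])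
      fix Y assume Y: "set Y \<subseteq> S"
      have 1: "1 + (E w y - 1) = E w y" for y
        using E1[of w y] by (simp add: add_diff_inverse_ennreal)
      \<comment> \<open>Both summands must explore the same list, so the pending points
        \<open>L'\<close> appear in the second one with weight \<open>0\<close>.\<close>
      have eq: "explore \<phi> (kscale E) n (map (\<lambda>y. (y, 1 * E w y)) Y @ ?L) X =
         explore \<phi> (kscale E) n (map (\<lambda>w. (w, 1)) (Y @ L')) X +
         explore \<phi> (kscale E) n (map (\<lambda>y. (y, E w y - 1)) Y @ map (\<lambda>w. (w, 0)) L') X" for X
        using explore_add[of \<phi> E n "map (\<lambda>y. (y, 1, E w y - 1)) Y @ map (\<lambda>w. (w, 1, 0)) L'" X]
        by (simp add: comp_def 1)
      have "pois_avg \<nu> ?q (explore \<phi> (kscale E) n (map (\<lambda>y. (y, 1 * E w y)) Y @ ?L)) =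
        pois_avg \<nu> ?q (explore \<phi> (kscale E) n (map (\<lambda>w. (w, 1)) (Y @ L'))) +
        pois_avg \<nu> ?q (explore \<phi> (kscale E) n (map (\<lambda>y. (y, E w y - 1)) Y @ map (\<lambda>w. (w, 0)) L'))"
        unfolding ext[of _ _, OF eq]
        by (intro pois_avg_add[OF sets_nu sf envD(1,2)[OF hq]] lmeas_explore \<phi> kscale_meas)
      also have "\<dots> \<le> ?b * ?G Y + (\<Sum>p\<leftarrow>map (\<lambda>y. (y, E w y - 1)) Y @ map (\<lambda>w. (w, 0)) L'. snd p) * bsup n"
      proof (intro add_mono)
        show "pois_avg \<nu> ?q (explore \<phi> (kscale E) n (map (\<lambda>w. (w, 1)) (Y @ L'))) \<le> ?b * ?G Y"
          using Suc.IH[OF hq, of "Y @ L'"] Y L' by simp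
        show "pois_avg \<nu> ?q (explore \<phi> (kscale E) n (map (\<lambda>y. (y, E w y - 1)) Y @ map (\<lambda>w. (w, 0)) L')) \<le>
          (\<Sum>p\<leftarrow>map (\<lambda>y. (y, E w y - 1)) Y @ map (\<lambda>w. (w, 0)) L'. snd p) * bsup n"
          by (rule pois_avg_explore_sum[OF hq]) (use Y L' in auto)
      qed
      also have "(\<Sum>p\<leftarrow>map (\<lambda>y. (y, E w y - 1)) Y @ map (\<lambda>w. (w, 0)) L'. snd p) = (\<Sum>y\<leftarrow>Y. E w y - 1)"
        by (simp add: comp_def)
      finally show "pois_avg \<nu> ?q (explore \<phi> (kscale E) n (map (\<lambda>y. (y, 1 * E w y)) Y @ ?L)) \<le> ?b * ?G Y + bsup n * (\<Sum>y\<leftarrow>Y. E w y - 1)"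
        by (simp add: mult.commute)
    qed (use envD(3)[OF hp] in auto)
    also have "\<dots> = ?b * pois_avg \<nu> ?p ?G + bsup n * (\<integral>\<^sup>+y. \<phi> w y * h y * (E w y - 1) \<partial>\<nu>)"
      using E_w[of w]
      by (simp add: pois_avg_add[OF sets_nu sf envD(1,2)[OF hp]] pois_avg_cmult[OF sets_nu sf envD(1,2)[OF hp]]
          pois_avg_sum_list[OF sets_nu sf envD(1,2)[OF hp]] lmeas_mult rec2
          lmeas_sum_list[OF sets_nu sf envD(1,2)[OF hp]])
    also have "\<dots> \<le> ?b * pois_avg \<nu> ?p ?G + bsup n * \<epsilon>"
    proof -
      have "(\<integral>\<^sup>+y. \<phi> w y * h y * (E w y - 1) \<partial>\<nu>) \<le> (\<integral>\<^sup>+y. \<phi> w y * hmax y * (E w y - 1) \<partial>\<nu>)"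
        using Suc.prems(1) by (intro nn_integral_mono mult_right_mono mult_left_mono) (auto simp: envs_def)
      also have "\<dots> \<le> \<epsilon>" by (rule eps[OF w])
      finally show ?thesis by (intro add_left_mono mult_left_mono) auto
    qed
    finally have "pois_avg \<nu> h (explore \<phi> (kscale E) (Suc n) (map (\<lambda>w. (w, 1)) L)) \<le> 1 + (?b * pois_avg \<nu> ?p ?G + bsup n * \<epsilon>)"
      unfolding Cons list.map pois_avg_explore_Suc(1)[OF Suc.prems(1) kscale_meas] by (intro add_left_mono)
    \<comment> \<open>The weight \<open>1\<close> of \<open>w\<close> and the charge for the edges
      at \<open>w\<close> add up to \<open>?b\<close>.\<close>
    also have "\<dots> = ?b * (1 + pois_avg \<nu> ?p ?G)"
      by (simp add: distrib_left distrib_right mult.commute add_ac)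
    also have "\<dots> = ?b * pois_avg \<nu> h (explore \<phi> kone (Suc n) (map (\<lambda>w. (w, 1)) L))"
      unfolding Cons list.map rec1 by simp
    also have "\<dots> \<le> (1 + \<epsilon> * bsup (Suc n)) * pois_avg \<nu> h (explore \<phi> kone (Suc n) (map (\<lambda>w. (w, 1)) L))"
      by (intro mult_right_mono add_left_mono mult_left_mono bsup_mono) auto
    finally show ?thesis .
  qed
qed

text \<open>Absorption: by \<open>small\<close> the finite number \<open>bsup n\<close> returns on
  the right-hand side with a factor of at most \<open>1 / 2\<close>.\<close>

lemma exploration_bound:
  assumes eps: "\<And>v. v \<in> S \<Longrightarrow> (\<integral>\<^sup>+y. \<phi> v y * hmax y * (E v y - 1) \<partial>\<nu>) \<le> \<epsilon>"
    and M: "\<And>v. v \<in> S \<Longrightarrow> (\<integral>\<^sup>+y. \<phi> v y * hmax y * E v y \<partial>\<nu>) \<le> M" and "M < \<infinity>"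
    and T: "\<And>h v n. h \<in> env \<Longrightarrow> v \<in> S \<Longrightarrow> pois_avg \<nu> h (explore \<phi> kone n [(v, 1)]) \<le> ennreal T"
    and small: "\<epsilon> * ennreal T \<le> ennreal (1 / 2)" and "0 \<le> T"
    and h: "h \<in> env" "v \<in> S"
  shows "pois_avg \<nu> h (explore \<phi> (kscale E) n [(v, 1)]) \<le> ennreal (2 * T)"
proof -
  obtain b where b: "0 \<le> b" "bsup n = ennreal b"
    using bsup_finite[OF M \<open>M < \<infinity>\<close>, of n] by (cases "bsup n") auto
  have "pois_avg \<nu> h (explore \<phi> (kscale E) n [(v, 1)]) \<le> (1 + \<epsilon> * bsup n) * ennreal T" if "h \<in> env" "v \<in> S" for h v
  proof -
    have "pois_avg \<nu> h (explore \<phi> (kscale E) n [(v, 1)]) \<le> (1 + \<epsilon> * bsup n) * pois_avg \<nu> h (explore \<phi> kone n [(v, 1)])"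
      using pois_avg_explore_compare[OF eps that(1), of "[v]" n] that by simp
    also have "\<dots> \<le> (1 + \<epsilon> * bsup n) * ennreal T"
      by (intro mult_left_mono T that) auto
    finally show ?thesis .
  qed
  \<comment> \<open>The definition is unfolded on the left of the inequality only; on the right
    \<open>bsup n\<close> stays a number.\<close>
  then have "bsup n \<le> (1 + \<epsilon> * bsup n) * ennreal T"
    unfolding bsup_def[of n, THEN arg_cong[where f = "\<lambda>x. x \<le> _"]] by (intro SUP_least)
  also have "\<dots> = ennreal T + (\<epsilon> * ennreal T) * ennreal b"
    by (simp add: b distrib_right) (simp add: ac_simps)
  also have "\<dots> \<le> ennreal T + ennreal (1 / 2) * ennreal b"
    by (intro add_left_mono mult_right_mono small) auto
  also have "\<dots> = ennreal (T + 1 / 2 * b)"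
    using b \<open>0 \<le> T\<close> ennreal_mult[of "1 / 2" b] ennreal_plus[of T "1 / 2 * b"] by simp
  finally have "ennreal b \<le> ennreal (T + 1 / 2 * b)" unfolding b .
  then have "b \<le> 2 * T" using b \<open>0 \<le> T\<close> by (subst (asm) ennreal_le_iff) auto
  then show ?thesis
    using bsup_upper[OF h, of n] b by (simp add: order.trans[OF _ ennreal_leI])
qed

end

section \<open>Random graphs on finitely many points\<close>

abbreviation unif :: "(nat \<times> nat \<Rightarrow> real) measure" where
  "unif \<equiv> PiM UNIV (\<lambda>_. uniform_measure lborel {0..1})"

lemma prob_space_uniform01: "prob_space (uniform_measure lborel {0..1::real})"
  by (rule prob_space_uniform_measure) auto

lemma sets_unif [measurable_cong]: "sets unif = sets (PiM UNIV (\<lambda>_. borel))"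
  by (rule sets_PiM_cong) auto

lemma prob_space_unif: "prob_space unif"
  by (rule prob_space_PiM) (rule prob_space_uniform01)

lemma nn_integral_uniform01_le:
  fixes a b :: ennreal
  assumes "0 \<le> p" "p \<le> 1"
  shows "(\<integral>\<^sup>+x. (if x \<le> p then a else b) \<partial>uniform_measure lborel {0..1}) = ennreal p * a + (1 - ennreal p) * b"
proof -
  have "(\<integral>\<^sup>+x. (if x \<le> p then a else b) \<partial>uniform_measure lborel {0..1}) =
      (\<integral>\<^sup>+x. (if x \<le> p then a else b) * indicator {0..1} x \<partial>lborel) / emeasure lborel {0..1::real}"
    by (rule nn_integral_uniform_measure) auto
  also have "\<dots> = (\<integral>\<^sup>+x. a * indicator {0..p} x + b * indicator {p<..1} x \<partial>lborel)"
    using assms by (simp add: divide_ennreal_def) (auto intro!: nn_integral_cong simp: indicator_def)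
  also have "\<dots> = a * ennreal p + b * ennreal (1 - p)"
    using assms by (subst nn_integral_add) (auto simp: nn_integral_cmult_indicator)
  finally show ?thesis
    using assms by (simp add: mult.commute ennreal_minus[symmetric] flip: ennreal_1)
qed

text \<open>Replacing the mark at \<open>e\<close> by a fresh uniform mark preserves the law of all
  marks. Since \<open>K\<close> and \<open>K'\<close> do not see this mark, only the comparison with
  \<open>p\<close> does, and the fresh mark can be integrated out.\<close>

lemma nn_integral_unif_split:
  assumes [measurable]: "K \<in> borel_measurable (PiM UNIV (\<lambda>_. borel))" "K' \<in> borel_measurable (PiM UNIV (\<lambda>_. borel))"
    and inv: "\<And>u a. K (u(e := a)) = K u" "\<And>u a. K' (u(e := a)) = (K' u :: ennreal)"
    and p: "0 \<le> p" "p \<le> 1"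
  shows "(\<integral>\<^sup>+u. (if u e \<le> p then K u else K' u) \<partial>unif) =
    ennreal p * (\<integral>\<^sup>+u. K u \<partial>unif) + (1 - ennreal p) * (\<integral>\<^sup>+u. K' u \<partial>unif)"
proof -
  interpret prob_space unif by (rule prob_space_unif)
  interpret u1: prob_space "uniform_measure lborel {0..1::real}" by (rule prob_space_uniform01)
  interpret pair_sigma_finite "uniform_measure lborel {0..1::real}" unif ..
  have eq: "distr (uniform_measure lborel {0..1} \<Otimes>\<^sub>M unif) unif (\<lambda>(x, X). X(e := x)) = unif"
    using distr_pair_PiM_eq_PiM[where i' = e and I = UNIV and M = "\<lambda>_. uniform_measure lborel {0..1::real}"] prob_space_uniform01
    by (simp add: insert_UNIV)
  have ue [measurable]: "(\<lambda>u. u e) \<in> PiM UNIV (\<lambda>_. borel) \<rightarrow>\<^sub>M (borel :: real measure)"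
    by (rule measurable_PiM_UNIV_component)
  have F [measurable]: "(\<lambda>u. if u e \<le> p then K u else K' u) \<in> borel_measurable unif"
    by measurable
  have upd [measurable]: "(\<lambda>(x, X). X(e := x)) \<in> uniform_measure lborel {0..1} \<Otimes>\<^sub>M unif \<rightarrow>\<^sub>M unif"
    using measurable_add_dim[where i = e and I = UNIV and M = "\<lambda>_. uniform_measure lborel {0..1::real}"]
    by (subst measurable_pair_swap_iff) (simp add: split_beta' insert_UNIV)
  have "(\<integral>\<^sup>+u. (if u e \<le> p then K u else K' u) \<partial>unif) =
    (\<integral>\<^sup>+u. (if u e \<le> p then K u else K' u) \<partial>distr (uniform_measure lborel {0..1} \<Otimes>\<^sub>M unif) unif (\<lambda>(x, X). X(e := x)))"
    by (simp only: eq)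
  also have "\<dots> = (\<integral>\<^sup>+z. (if fst z \<le> p then K (snd z) else K' (snd z)) \<partial>(uniform_measure lborel {0..1} \<Otimes>\<^sub>M unif))"
    by (subst nn_integral_distr[OF upd]) (use F in \<open>auto simp: inv split_beta' intro!: nn_integral_cong\<close>)
  also have "\<dots> = (\<integral>\<^sup>+u. \<integral>\<^sup>+x. (if x \<le> p then K u else K' u) \<partial>uniform_measure lborel {0..1} \<partial>unif)"
    by (subst nn_integral_snd[symmetric]) (auto cong: if_cong)
  also have "\<dots> = ennreal p * (\<integral>\<^sup>+u. K u \<partial>unif) + (1 - ennreal p) * (\<integral>\<^sup>+u. K' u \<partial>unif)"
    using p by (simp add: nn_integral_uniform01_le nn_integral_add nn_integral_cmult)
  finally show ?thesis .
qed

section \<open>Depth first search in the graph on indices\<close>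

definition iadj :: "('a \<Rightarrow> 'a \<Rightarrow> real) \<Rightarrow> (nat \<Rightarrow> 'a) \<Rightarrow> (nat \<times> nat \<Rightarrow> real) \<Rightarrow> nat \<Rightarrow> nat \<Rightarrow> bool" where
  "iadj \<phi> x u a b \<longleftrightarrow> u (min a b, max a b) \<le> \<phi> (x a) (x b)"

lemma measurable_filter_iadj:
  assumes "\<And>Y Z. K Y Z \<in> borel_measurable (PiM UNIV (\<lambda>_. borel))"
  shows "(\<lambda>u. K (filter (iadj \<phi> x u w) X) (filter (\<lambda>i. \<not> iadj \<phi> x u w i) X) u :: ennreal)
    \<in> borel_measurable (PiM UNIV (\<lambda>_. borel))"
  using assms
proof (induction X arbitrary: K)
  case (Cons j X)
  let ?e = "(min w j, max w j)"
  have ue [measurable]: "(\<lambda>u. u ?e) \<in> PiM UNIV (\<lambda>_. borel) \<rightarrow>\<^sub>M (borel :: real measure)"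
    by (rule measurable_PiM_UNIV_component)
  have [measurable]: "(\<lambda>u. K (j # filter (iadj \<phi> x u w) X) (filter (\<lambda>i. \<not> iadj \<phi> x u w i) X) u)
    \<in> borel_measurable (PiM UNIV (\<lambda>_. borel))"
    "(\<lambda>u. K (filter (iadj \<phi> x u w) X) (j # filter (\<lambda>i. \<not> iadj \<phi> x u w i) X) u)
    \<in> borel_measurable (PiM UNIV (\<lambda>_. borel))"
    by (rule Cons.IH; rule Cons.prems)+
  have "(\<lambda>u. K (filter (iadj \<phi> x u w) (j # X)) (filter (\<lambda>i. \<not> iadj \<phi> x u w i) (j # X)) u) =
    (\<lambda>u. if u ?e \<le> \<phi> (x w) (x j) then K (j # filter (iadj \<phi> x u w) X) (filter (\<lambda>i. \<not> iadj \<phi> x u w i) X) u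
      else K (filter (iadj \<phi> x u w) X) (j # filter (\<lambda>i. \<not> iadj \<phi> x u w i) X) u)"
    by (auto simp: iadj_def)
  also have "\<dots> \<in> borel_measurable (PiM UNIV (\<lambda>_. borel))" by measurable
  finally show ?case .
qed simp

text \<open>The marks between \<open>w\<close> and \<open>X\<close> are revealed one after the
  other, and the continuation \<open>K\<close> depends on none of them. In the induction an index
  that has been decided moves from \<open>X\<close> to \<open>A\<close>.\<close>

lemma nn_integral_unif_thin:
  assumes \<phi>: "\<And>a b. 0 \<le> \<phi> a b \<and> \<phi> a b \<le> (1::real)"
    and "\<And>Y Z. K Y Z \<in> borel_measurable (PiM UNIV (\<lambda>_. borel))"
    and "\<And>Y Z u j a. set Y \<subseteq> A \<union> set X \<Longrightarrow> set Z \<subseteq> A \<union> set X \<Longrightarrow> j \<in> set X \<Longrightarrow>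
      K Y Z (u((min w j, max w j) := a)) = K Y Z u"
    and "distinct X" "w \<notin> set X"
  shows "(\<integral>\<^sup>+u. K (filter (iadj \<phi> x u w) X) (filter (\<lambda>i. \<not> iadj \<phi> x u w i) X) u \<partial>unif) =
    thin (\<lambda>i. ennreal (\<phi> (x w) (x i))) X (\<lambda>Y Z. \<integral>\<^sup>+u. K Y Z u \<partial>unif)"
  using assms(2-)
proof (induction X arbitrary: K A)
  case (Cons j X)
  let ?e = "(min w j, max w j)"
  let ?K1 = "\<lambda>u. K (j # filter (iadj \<phi> x u w) X) (filter (\<lambda>i. \<not> iadj \<phi> x u w i) X) u"
  let ?K2 = "\<lambda>u. K (filter (iadj \<phi> x u w) X) (j # filter (\<lambda>i. \<not> iadj \<phi> x u w i) X) u"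
  have inv: "filter (iadj \<phi> x (u(?e := a)) w) X = filter (iadj \<phi> x u w) X"
     "filter (\<lambda>i. \<not> iadj \<phi> x (u(?e := a)) w i) X = filter (\<lambda>i. \<not> iadj \<phi> x u w i) X" for u a
  proof -
    have "iadj \<phi> x (u(?e := a)) w i = iadj \<phi> x u w i" if "i \<in> set X" for i
    proof -
      have "i \<noteq> j" using that Cons.prems(3) by auto
      then have "(min w i, max w i) \<noteq> ?e" by (auto simp: min_def max_def split: if_splits)
      then show ?thesis unfolding iadj_def by (subst fun_upd_other) auto
    qed
    then show "filter (iadj \<phi> x (u(?e := a)) w) X = filter (iadj \<phi> x u w) X"
     "filter (\<lambda>i. \<not> iadj \<phi> x (u(?e := a)) w i) X = filter (\<lambda>i. \<not> iadj \<phi> x u w i) X"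
      by (auto intro!: filter_cong)
  qed
  have Kinv: "K Y Z (u(?e := a)) = K Y Z u" if "set Y \<subseteq> insert j (set X)" "set Z \<subseteq> insert j (set X)" for Y Z u a
    by (rule Cons.prems(2)) (use that in auto)
  have "(\<integral>\<^sup>+u. K (filter (iadj \<phi> x u w) (j # X)) (filter (\<lambda>i. \<not> iadj \<phi> x u w i) (j # X)) u \<partial>unif) =
    (\<integral>\<^sup>+u. (if u ?e \<le> \<phi> (x w) (x j) then ?K1 u else ?K2 u) \<partial>unif)"
    by (auto simp: iadj_def intro!: nn_integral_cong)
  also have "\<dots> = ennreal (\<phi> (x w) (x j)) * (\<integral>\<^sup>+u. ?K1 u \<partial>unif) + (1 - ennreal (\<phi> (x w) (x j))) * (\<integral>\<^sup>+u. ?K2 u \<partial>unif)"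
  proof (rule nn_integral_unif_split)
    show "?K1 \<in> borel_measurable (PiM UNIV (\<lambda>_. borel))"
      by (rule measurable_filter_iadj[where K = "\<lambda>Y. K (j # Y)"]) (rule Cons.prems)
    show "?K2 \<in> borel_measurable (PiM UNIV (\<lambda>_. borel))"
      by (rule measurable_filter_iadj[where K = "\<lambda>Y Z. K Y (j # Z)"]) (rule Cons.prems)
    fix u a
    show "?K1 (u(?e := a)) = ?K1 u" "?K2 (u(?e := a)) = ?K2 u"
      unfolding inv by (rule Kinv; auto)+
  qed (use \<phi> in auto)
  also have "(\<integral>\<^sup>+u. ?K1 u \<partial>unif) = thin (\<lambda>i. ennreal (\<phi> (x w) (x i))) X (\<lambda>Y Z. \<integral>\<^sup>+u. K (j # Y) Z u \<partial>unif)"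
    by (rule Cons.IH[where K = "\<lambda>Y. K (j # Y)" and A = "insert j A"])
      (use Cons.prems in \<open>auto intro!: Cons.prems(2)\<close>)
  also have "(\<integral>\<^sup>+u. ?K2 u \<partial>unif) = thin (\<lambda>i. ennreal (\<phi> (x w) (x i))) X (\<lambda>Y Z. \<integral>\<^sup>+u. K Y (j # Z) u \<partial>unif)"
    by (rule Cons.IH[where K = "\<lambda>Y Z. K Y (j # Z)" and A = "insert j A"])
      (use Cons.prems in \<open>auto intro!: Cons.prems(2)\<close>)
  finally show ?case by simp
qed simp

text \<open>The recursion of \<open>explore\<close> with the marks held fixed: thinning is replaced
  by inspecting the marks. It runs on indices, since marks belong to pairs of indices.\<close>

fun dfs :: "('a \<Rightarrow> 'a \<Rightarrow> real) \<Rightarrow> ('a \<Rightarrow> ennreal) \<Rightarrow> (nat \<Rightarrow> 'a) \<Rightarrow> nat \<Rightarrow> nat list \<Rightarrow> nat list \<Rightarrow>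
    (nat \<times> nat \<Rightarrow> real) \<Rightarrow> ennreal" where
  "dfs \<phi> f x 0 L X u = 0"
| "dfs \<phi> f x (Suc n) [] X u = 0"
| "dfs \<phi> f x (Suc n) (w # L) X u = f (x w) +
     dfs \<phi> f x n (filter (iadj \<phi> x u w) X @ L) (filter (\<lambda>i. \<not> iadj \<phi> x u w i) X) u"

lemma dfs_fun [simp]:
  "dfs \<phi> f x 0 L X = (\<lambda>_. 0)" "dfs \<phi> f x (Suc n) [] X = (\<lambda>_. 0)"
  "dfs \<phi> f x (Suc n) (w # L) X = (\<lambda>u. f (x w) +
     dfs \<phi> f x n (filter (iadj \<phi> x u w) X @ L) (filter (\<lambda>i. \<not> iadj \<phi> x u w i) X) u)"
  by auto

lemma measurable_dfs: "dfs \<phi> f x n L X \<in> borel_measurable (PiM UNIV (\<lambda>_. borel))"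
proof (induction n arbitrary: L X)
  case (Suc n)
  show ?case
  proof (cases L)
    case (Cons w L')
    have [measurable]: "(\<lambda>u. dfs \<phi> f x n (filter (iadj \<phi> x u w) X @ L') (filter (\<lambda>i. \<not> iadj \<phi> x u w i) X) u)
      \<in> borel_measurable (PiM UNIV (\<lambda>_. borel))"
      by (rule measurable_filter_iadj[where K = "\<lambda>Y. dfs \<phi> f x n (Y @ L')"]) (rule Suc)
    show ?thesis unfolding Cons by simp
  qed simp
qed simp

text \<open>Consequently the marks at an index that has left both lists no longer influence the
  search.\<close>

lemma dfs_cong:
  assumes "\<And>a b. a \<in> set L \<union> set X \<Longrightarrow> b \<in> set X \<Longrightarrow> u (min a b, max a b) = u' (min a b, max a b)"
  shows "dfs \<phi> f x n L X u = dfs \<phi> f x n L X u'"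
  using assms
proof (induction n arbitrary: L X)
  case (Suc n)
  show ?case
  proof (cases L)
    case (Cons w L')
    have eq: "filter (iadj \<phi> x u w) X = filter (iadj \<phi> x u' w) X"
      "filter (\<lambda>i. \<not> iadj \<phi> x u w i) X = filter (\<lambda>i. \<not> iadj \<phi> x u' w i) X"
      using Suc.prems Cons by (auto simp: iadj_def intro!: filter_cong)
    have "dfs \<phi> f x n (filter (iadj \<phi> x u' w) X @ L') (filter (\<lambda>i. \<not> iadj \<phi> x u' w i) X) u =
      dfs \<phi> f x n (filter (iadj \<phi> x u' w) X @ L') (filter (\<lambda>i. \<not> iadj \<phi> x u' w i) X) u'"
      by (rule Suc.IH) (use Suc.prems Cons in auto)
    then show ?thesis by (simp add: Cons eq)
  qed simp
qed simp

text \<open>\<open>R\<close> stands for the pending indices; it makes the distinctness demanded by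
  the induction hypothesis of \<open>nn_integral_dfs\<close> available under
  \<open>thin\<close>.\<close>

lemma thin_cong_distinct:
  assumes "\<And>Y Z. distinct (Y @ Z @ R) \<Longrightarrow> H Y Z = H' Y Z" "distinct (X @ R)"
  shows "thin g X H = thin g X H'"
  using assms
proof (induction X arbitrary: H H' R)
  case (Cons x X)
  have "thin g X (\<lambda>Y Z. H (x # Y) Z) = thin g X (\<lambda>Y Z. H' (x # Y) Z)"
    "thin g X (\<lambda>Y Z. H Y (x # Z)) = thin g X (\<lambda>Y Z. H' Y (x # Z))"
    by (rule Cons.IH[where R = "x # R"], rule Cons.prems(1), use Cons.prems(2) in auto)+
  then show ?case by simp
qed simp

text \<open>Once \<open>w\<close> is expanded it belongs to neither list, so the rest of the search
  is independent of the marks at \<open>w\<close>. Integrating these marks first gives exactly one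
  thinning step.\<close>

lemma nn_integral_dfs:
  assumes \<phi>: "\<And>a b. 0 \<le> \<phi> a b \<and> \<phi> a b \<le> (1::real)" and "distinct (L @ X)"
  shows "(\<integral>\<^sup>+u. dfs \<phi> f x n L X u \<partial>unif) =
    explore (\<lambda>a b. ennreal (\<phi> a b)) (\<lambda>_ _ y. f y) n (map (\<lambda>i. (x i, f (x i))) L) (map x X)"
  using assms(2)
proof (induction n arbitrary: L X)
  case (Suc n)
  interpret prob_space unif by (rule prob_space_unif)
  show ?case
  proof (cases L)
    case (Cons w L')
    have d: "distinct X" "w \<notin> set X" "w \<notin> set L'" "distinct L'" "set L' \<inter> set X = {}"
      using Suc.prems Cons by auto
    have [measurable]: "(\<lambda>u. dfs \<phi> f x n (filter (iadj \<phi> x u w) X @ L') (filter (\<lambda>i. \<not> iadj \<phi> x u w i) X) u)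
      \<in> borel_measurable unif"
      unfolding measurable_cong_sets[OF sets_unif refl]
      by (rule measurable_filter_iadj[where K = "\<lambda>Y. dfs \<phi> f x n (Y @ L')"]) (rule measurable_dfs)
    have sub: "thin g X (\<lambda>Y Z. \<integral>\<^sup>+u. dfs \<phi> f x n (Y @ L') Z u \<partial>unif) =
       thin g X (\<lambda>Y Z. explore (\<lambda>a b. ennreal (\<phi> a b)) (\<lambda>_ _ y. f y) n (map (\<lambda>i. (x i, f (x i))) (Y @ L')) (map x Z))" for g
      by (rule thin_cong_distinct[where R = L'], rule Suc.IH) (use d in auto)
    have "(\<integral>\<^sup>+u. dfs \<phi> f x (Suc n) L X u \<partial>unif) = f (x w) +
      (\<integral>\<^sup>+u. dfs \<phi> f x n (filter (iadj \<phi> x u w) X @ L') (filter (\<lambda>i. \<not> iadj \<phi> x u w i) X) u \<partial>unif)"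
      by (simp add: Cons nn_integral_add emeasure_space_1)
    also have "(\<integral>\<^sup>+u. dfs \<phi> f x n (filter (iadj \<phi> x u w) X @ L') (filter (\<lambda>i. \<not> iadj \<phi> x u w i) X) u \<partial>unif) =
      thin (\<lambda>i. ennreal (\<phi> (x w) (x i))) X (\<lambda>Y Z. \<integral>\<^sup>+u. dfs \<phi> f x n (Y @ L') Z u \<partial>unif)"
    proof (rule nn_integral_unif_thin[where K = "\<lambda>Y. dfs \<phi> f x n (Y @ L')" and A = "{}"])
      fix Y Z u j a assume YZ: "set Y \<subseteq> {} \<union> set X" "set Z \<subseteq> {} \<union> set X" "j \<in> set X"
      show "dfs \<phi> f x n (Y @ L') Z (u((min w j, max w j) := a)) = dfs \<phi> f x n (Y @ L') Z u"
      proof (rule dfs_cong)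
        fix b c assume "b \<in> set (Y @ L') \<union> set Z" "c \<in> set Z"
        then have "b \<noteq> w" "c \<noteq> w" using YZ d by auto
        then have "(min b c, max b c) \<noteq> (min w j, max w j)" by (auto simp: min_def max_def split: if_splits)
        then show "(u((min w j, max w j) := a)) (min b c, max b c) = u (min b c, max b c)" by (rule fun_upd_other)
      qed
    qed (use \<phi> d measurable_dfs in auto)
    finally show ?thesis
      unfolding sub by (simp add: Cons thin_map comp_def)
  qed simp
qed simp

section \<open>The set of indices found by a complete search\<close>

definition reach :: "('a \<Rightarrow> 'a \<Rightarrow> real) \<Rightarrow> (nat \<Rightarrow> 'a) \<Rightarrow> (nat \<times> nat \<Rightarrow> real) \<Rightarrow> nat set \<Rightarrow> nat set \<Rightarrow> nat set" where
  "reach \<phi> x u L X = {b. \<exists>a\<in>L. (\<lambda>a b. b \<in> X \<and> iadj \<phi> x u a b)\<^sup>*\<^sup>* a b}"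

lemma reach_subset: "reach \<phi> x u L X \<subseteq> L \<union> X"
proof -
  have "(\<lambda>a b. b \<in> X \<and> iadj \<phi> x u a b)\<^sup>*\<^sup>* a b \<Longrightarrow> b = a \<or> b \<in> X" for a b
    by (induction rule: rtranclp_induct) auto
  then show ?thesis by (auto simp: reach_def)
qed

lemma reach_mono: "X \<subseteq> X' \<Longrightarrow> reach \<phi> x u L X \<subseteq> reach \<phi> x u L X'"
  unfolding reach_def using rtranclp_mono[of "\<lambda>a b. b \<in> X \<and> iadj \<phi> x u a b" "\<lambda>a b. b \<in> X' \<and> iadj \<phi> x u a b"]
  by blast

lemma reach_refl: "a \<in> L \<Longrightarrow> a \<in> reach \<phi> x u L X"
  by (auto simp: reach_def)

lemma reach_step: "a \<in> reach \<phi> x u L X \<Longrightarrow> b \<in> X \<Longrightarrow> iadj \<phi> x u a b \<Longrightarrow> b \<in> reach \<phi> x u L X"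
  unfolding reach_def using rtranclp.rtrancl_into_rtrancl by fastforce

lemma reach_induct [consumes 1, case_names base step]:
  assumes "b \<in> reach \<phi> x u L X" "\<And>a. a \<in> L \<Longrightarrow> Q a"
    "\<And>a b. a \<in> reach \<phi> x u L X \<Longrightarrow> Q a \<Longrightarrow> b \<in> X \<Longrightarrow> iadj \<phi> x u a b \<Longrightarrow> Q b"
  shows "Q b"
proof -
  obtain a where a: "a \<in> L" "(\<lambda>a b. b \<in> X \<and> iadj \<phi> x u a b)\<^sup>*\<^sup>* a b" using assms(1) by (auto simp: reach_def)
  from a(2) have "Q b \<and> b \<in> reach \<phi> x u L X"
  proof (induction rule: rtranclp_induct)
    case base
    then show ?case using a assms(2) reach_refl by fast
  next
    case (step y z)
    then show ?case using assms(3) reach_step by fast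
  qed
  then show ?thesis ..
qed

text \<open>The invariant of the search. The neighbours of \<open>w\<close> become starting points,
  so a path through one of them can be restarted there, and deleting them from the admissible
  vertices loses nothing.\<close>

lemma reach_insert:
  assumes "w \<notin> X"
  shows "reach \<phi> x u (insert w L) X =
    insert w (reach \<phi> x u ({i\<in>X. iadj \<phi> x u w i} \<union> L) {i\<in>X. \<not> iadj \<phi> x u w i})" (is "?A = insert w ?B")
proof (intro equalityI subsetI)
  fix b assume "b \<in> ?A"
  then show "b \<in> insert w ?B"
  proof (induction rule: reach_induct)
    case (base a)
    then show ?case by (auto intro: reach_refl)
  next
    case (step a b)
    show ?case
    proof (cases "iadj \<phi> x u w b")
      case True
      then show ?thesis using step by (auto intro: reach_refl)
    next
      case False
      then show ?thesis using step by (auto intro: reach_step)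
    qed
  qed
next
  fix b assume "b \<in> insert w ?B"
  moreover have "b \<in> ?A" if "b \<in> ?B"
    using that
  proof (induction rule: reach_induct)
    case (base a)
    then show ?case by (auto intro: reach_refl reach_step[OF reach_refl[of w]])
  next
    case (step a b)
    then show ?case by (auto intro: reach_step)
  qed
  ultimately show "b \<in> ?A" by (auto intro: reach_refl)
qed

text \<open>Every step removes one index from the two lists together, so as many steps as there are
  indices complete the search; with fewer steps a part of the cluster is missing.\<close>

lemma dfs_reach:
  assumes "distinct (L @ X)"
  shows "dfs \<phi> f x n L X u \<le> (\<Sum>i\<in>reach \<phi> x u (set L) (set X). f (x i))"
    and "length L + length X \<le> n \<Longrightarrow> dfs \<phi> f x n L X u = (\<Sum>i\<in>reach \<phi> x u (set L) (set X). f (x i))"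
  using assms
proof (induction n arbitrary: L X)
  case 0
  case 1
  show ?case by simp
  case 2
  then show ?case by (auto simp: reach_def)
next
  case (Suc n)
  have *: "(\<Sum>i\<in>reach \<phi> x u (set (w # L)) (set X). f (x i)) = f (x w) +
     (\<Sum>i\<in>reach \<phi> x u (set (filter (iadj \<phi> x u w) X @ L)) (set (filter (\<lambda>i. \<not> iadj \<phi> x u w i) X)). f (x i))"
    (is "_ = _ + sum _ ?R") if "distinct ((w # L) @ X)" for w L X
  proof -
    have eq: "reach \<phi> x u (set (w # L)) (set X) = insert w ?R"
      using reach_insert[of w "set X" \<phi> x u "set L"] that by simp
    have "w \<notin> ?R" "finite ?R"
      using reach_subset[of \<phi> x u "set (filter (iadj \<phi> x u w) X @ L)" "set (filter (\<lambda>i. \<not> iadj \<phi> x u w i) X)"] that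
      by (auto intro: finite_subset)
    then show ?thesis unfolding eq by (simp del: set_append set_filter)
  qed
  {
    case 1
    show ?case
    proof (cases L)
      case (Cons w L')
      show ?thesis
        unfolding Cons dfs.simps *[OF 1[unfolded Cons]]
        by (intro add_left_mono Suc.IH(1)) (use 1 Cons in auto)
    qed simp
  next
    case 2
    show ?case
    proof (cases L)
      case (Cons w L')
      have "length (filter (iadj \<phi> x u w) X @ L') + length (filter (\<lambda>i. \<not> iadj \<phi> x u w i) X) \<le> n"
        using 2(1) sum_length_filter_compl[of "iadj \<phi> x u w" X] by (simp add: Cons)
      then show ?thesis
        unfolding Cons dfs.simps *[OF 2(2)[unfolded Cons]]
        by (intro arg_cong2[where f = "(+)"] refl Suc.IH(2)) (use 2 Cons in auto)
    qed (simp add: reach_def)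
  }
qed

lemma nn_integral_reach:
  assumes \<phi>: "\<And>a b. 0 \<le> \<phi> a b \<and> \<phi> a b \<le> (1::real)" and d: "distinct (L @ X)"
    and n: "length L + length X \<le> n"
  shows "(\<integral>\<^sup>+u. (\<Sum>i\<in>reach \<phi> x u (set L) (set X). f (x i)) \<partial>unif) =
    explore (\<lambda>a b. ennreal (\<phi> a b)) (\<lambda>_ _ y. f y) n (map (\<lambda>i. (x i, f (x i))) L) (map x X)"
  unfolding dfs_reach(2)[OF d n, symmetric] by (rule nn_integral_dfs[OF \<phi> d])

lemma explore_le_reach:
  assumes \<phi>: "\<And>a b. 0 \<le> \<phi> a b \<and> \<phi> a b \<le> (1::real)" and d: "distinct (L @ X)"
  shows "explore (\<lambda>a b. ennreal (\<phi> a b)) (\<lambda>_ _ y. f y) n (map (\<lambda>i. (x i, f (x i))) L) (map x X) \<le>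
    (\<integral>\<^sup>+u. (\<Sum>i\<in>reach \<phi> x u (set L) (set X). f (x i)) \<partial>unif)"
proof -
  have "(\<integral>\<^sup>+u. dfs \<phi> f x n L X u \<partial>unif) \<le> (\<integral>\<^sup>+u. (\<Sum>i\<in>reach \<phi> x u (set L) (set X). f (x i)) \<partial>unif)"
    by (intro nn_integral_mono dfs_reach(1) d)
  then show ?thesis by (simp only: nn_integral_dfs[OF \<phi> d])
qed

text \<open>A coupling: both sides are realised with the same marks, and the cluster can only grow
  when the vertex \<open>z\<close> is added. The right-hand search must be complete for
  this.\<close>

lemma explore_remove_le:
  assumes \<phi>: "\<And>a b. 0 \<le> \<phi> a b \<and> \<phi> a b \<le> (1::real)" and m: "Suc (length (P @ z # Q)) \<le> m"
  shows "explore (\<lambda>a b. ennreal (\<phi> a b)) (\<lambda>_ _ y. f y) n [(v, f v)] (P @ Q) \<le>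
     explore (\<lambda>a b. ennreal (\<phi> a b)) (\<lambda>_ _ y. f y) m [(v, f v)] (P @ z # Q)"
proof -
  let ?x = "\<lambda>i. (v # P @ z # Q) ! i"
  \<comment> \<open>Index \<open>0\<close> is the root \<open>v\<close>; the index
    \<open>Suc (length P)\<close> of \<open>z\<close> is skipped.\<close>
  let ?I = "[1..<Suc (length P)]" and ?J = "[Suc (Suc (length P))..<Suc (length (P @ z # Q))]"
  have P: "map ?x ?I = P" by (rule nth_equalityI) (auto simp: nth_append simp del: upt_Suc)
  have Q: "map ?x ?J = Q" by (rule nth_equalityI) (auto simp: nth_append simp del: upt_Suc)
  have PQ: "map ?x [1..<Suc (length (P @ z # Q))] = P @ z # Q"
    by (rule nth_equalityI) (auto simp del: upt_Suc)
  have "explore (\<lambda>a b. ennreal (\<phi> a b)) (\<lambda>_ _ y. f y) n (map (\<lambda>i. (?x i, f (?x i))) [0]) (map ?x (?I @ ?J)) \<le>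
     (\<integral>\<^sup>+u. (\<Sum>i\<in>reach \<phi> ?x u (set [0]) (set (?I @ ?J)). f (?x i)) \<partial>unif)"
    by (rule explore_le_reach[OF \<phi>]) auto
  also have "\<dots> \<le> (\<integral>\<^sup>+u. (\<Sum>i\<in>reach \<phi> ?x u (set [0]) (set [1..<Suc (length (P @ z # Q))]). f (?x i)) \<partial>unif)"
  proof (intro nn_integral_mono sum_mono2)
    fix u
    show "finite (reach \<phi> ?x u (set [0]) (set [1..<Suc (length (P @ z # Q))]))"
      by (rule finite_subset[OF reach_subset]) auto
  qed (auto intro!: reach_mono)
  also have "\<dots> = explore (\<lambda>a b. ennreal (\<phi> a b)) (\<lambda>_ _ y. f y) m (map (\<lambda>i. (?x i, f (?x i))) [0])
      (map ?x [1..<Suc (length (P @ z # Q))])"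
    by (rule nn_integral_reach[OF \<phi>]) (use m in auto)
  finally show ?thesis by (simp only: map_append P Q PQ list.map nth_Cons_0)
qed

text \<open>Both lists are read off from the same index set, in different orders and with the same
  marks, and a complete search depends on the set only.\<close>

lemma explore_perm:
  assumes \<phi>: "\<And>a b. 0 \<le> \<phi> a b \<and> \<phi> a b \<le> (1::real)" and m: "mset X' = mset X" and n: "Suc (length X) \<le> n"
  shows "explore (\<lambda>a b. ennreal (\<phi> a b)) (\<lambda>_ _ y. f y) n [(v, f v)] X' =
     explore (\<lambda>a b. ennreal (\<phi> a b)) (\<lambda>_ _ y. f y) n [(v, f v)] X"
proof -
  let ?x = "\<lambda>i. (v # X) ! i"
  obtain p where p: "p permutes {..<length X}" "permute_list p X = X'"
    using mset_eq_permutation[OF m] by blast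
  have bij: "p ` {0..<length X} = {0..<length X}"
    using permutes_image[OF p(1)] by (simp add: atLeast0LessThan)
  have X': "map ?x (map (Suc \<circ> p) [0..<length X]) = X'"
    unfolding p(2)[symmetric] permute_list_def by simp
  have X: "map ?x (map Suc [0..<length X]) = X"
    by (simp add: comp_def map_nth)
  have set: "set (map (Suc \<circ> p) [0..<length X]) = set (map Suc [0..<length X])"
    using bij by (metis image_comp list.set_map set_upt)
  have "inj p" using p(1) by (rule permutes_inj)
  then have d: "distinct ([0] @ map (Suc \<circ> p) [0..<length X])"
    by (auto simp: distinct_map inj_on_def inj_def)
  show ?thesis
    using nn_integral_reach[OF \<phi> d, where n = n and x = ?x and f = f]
      nn_integral_reach[OF \<phi>, where L = "[0]" and X = "map Suc [0..<length X]" and n = n and x = ?x and f = f] n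
    unfolding set X X' by (simp add: distinct_map)
qed

section \<open>Permanents and point configurations\<close>

text \<open>When all lower coefficients agree, dividing by \<open>z ^ k\<close> and letting
  \<open>z\<close> decrease to \<open>0\<close> isolates the next one. Equality is asked for on
  \<open>0 < z < 1\<close>, where the generating functions of \<open>expectation_npw\<close> provide
  it.\<close>

lemma powser_unique_at_right:
  fixes a b :: "nat \<Rightarrow> real"
  assumes "\<And>z. 0 < z \<Longrightarrow> z < 1 \<Longrightarrow> (\<lambda>n. a n * z ^ n) sums f z"
    "\<And>z. 0 < z \<Longrightarrow> z < 1 \<Longrightarrow> (\<lambda>n. b n * z ^ n) sums f z"
  shows "a k = b k"
proof -
  define d where "d n = a n - b n" for n
  have d0: "(\<lambda>n. d n * z ^ n) sums 0" if "0 < z" "z < 1" for z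
    using sums_diff[OF assms[OF that]] by (simp add: d_def algebra_simps)
  have "d k = 0"
  proof (induction k rule: less_induct)
    case (less k)
    have s: "(\<lambda>j. d (j + k) * z ^ j) sums 0" if "0 < z" "z < 1" for z
    proof -
      have "(\<lambda>j. d (j + k) * z ^ (j + k)) sums 0"
        using sums_iff_shift[of "\<lambda>n. d n * z ^ n" k 0] d0[OF that] less by simp
      then have "(\<lambda>j. d (j + k) * z ^ (j + k) * inverse (z ^ k)) sums (0 * inverse (z ^ k))"
        by (rule sums_mult2)
      then show ?thesis using that by (simp add: power_add field_simps)
    qed
    have "(\<lambda>j. d (j + k) * z ^ j) sums (\<Sum>j. d (j + k) * z ^ j)" if "norm z < 1 / 2" for z
      by (rule summable_sums[OF powser_inside[of _ "1 / 2"]])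
        (use s[of "1 / 2"] that in \<open>auto simp: sums_iff\<close>)
    then have "((\<lambda>z. \<Sum>j. d (j + k) * z ^ j) \<longlongrightarrow> d (0 + k)) (at 0)"
      by (intro powser_limit_0[of "1 / 2"]) auto
    then have "((\<lambda>z. \<Sum>j. d (j + k) * z ^ j) \<longlongrightarrow> d k) (at_right 0)"
      by (rule filterlim_mono) (auto simp: at_le)
    moreover have "eventually (\<lambda>z. (\<Sum>j. d (j + k) * z ^ j) = 0) (at_right 0)"
      by (rule eventually_at_rightI[of 0 1]) (auto intro: sums_unique[OF s, symmetric])
    ultimately have "((\<lambda>z. 0) \<longlongrightarrow> d k) (at_right (0::real))"
      by (rule Lim_transform_eventually)
    then show ?case by (simp add: tendsto_const_iff)
  qed
  then show ?thesis by (simp add: d_def)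
qed

text \<open>Passing to complements turns this into the expansion of \<open>(-1 + 1)\<close> to the
  power of the number of elements missing from \<open>R\<close>.\<close>

lemma sum_supersets_alternating:
  assumes "R \<subseteq> {..<k}"
  shows "(\<Sum>T | R \<subseteq> T \<and> T \<subseteq> {..<k}. (- 1) ^ (k - card T)) = (if R = {..<k} then 1 else (0::real))"
proof -
  let ?S = "{..<k} - R"
  have fin: "finite ?S" by simp
  have "(\<Sum>T | R \<subseteq> T \<and> T \<subseteq> {..<k}. (- 1) ^ (k - card T)) = (\<Sum>U\<in>Pow ?S. (- 1::real) ^ card U)"
  proof (rule sum.reindex_bij_witness[of _ "\<lambda>U. {..<k} - U" "\<lambda>T. {..<k} - T"])
    fix T assume "T \<in> {T. R \<subseteq> T \<and> T \<subseteq> {..<k}}"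
    then show "(- 1) ^ card ({..<k} - T) = (- 1::real) ^ (k - card T)"
      by (simp add: card_Diff_subset finite_subset[of T "{..<k}"])
  qed (use assms in auto)
  also have "\<dots> = (\<Sum>U\<in>Pow ?S. \<Prod>i\<in>U. (- 1::real))" by simp
  also have "\<dots> = (\<Prod>i\<in>?S. (- 1::real) + 1)"
    by (subst prod_add[OF fin]) (simp add: fin)
  also have "\<dots> = (if R = {..<k} then 1 else 0)"
    using assms fin by (auto simp: prod_constant power_0_left card_eq_0_iff)
  finally show ?thesis .
qed

text \<open>Ryser's formula. Expanding the products, a map \<open>f\<close> occurs for every
  \<open>T\<close> containing its image, and the signs cancel unless \<open>f\<close> is onto. It
  reduces a product of different indicators to products with one and the same sum in every factor,
  whose expectations are accessible through counts.\<close>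

lemma permanent_Ryser:
  fixes a :: "nat \<Rightarrow> nat \<Rightarrow> real"
  shows "(\<Sum>p | p permutes {..<k}. \<Prod>i<k. a i (p i)) =
     (\<Sum>T\<in>Pow {..<k}. (- 1) ^ (k - card T) * (\<Prod>j<k. \<Sum>i\<in>T. a i j))"
proof -
  let ?P = "\<lambda>f. \<Prod>j<k. a (f j) j"
  let ?E = "{..<k} \<rightarrow>\<^sub>E {..<k}"
  have "(\<Sum>T\<in>Pow {..<k}. (- 1) ^ (k - card T) * (\<Prod>j<k. \<Sum>i\<in>T. a i j)) =
     (\<Sum>T\<in>Pow {..<k}. \<Sum>f\<in>?E. if f ` {..<k} \<subseteq> T then (- 1) ^ (k - card T) * ?P f else 0)"
  proof (rule sum.cong[OF refl])
    fix T assume T: "T \<in> Pow {..<k}"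
    have "(\<Prod>j<k. \<Sum>i\<in>T. a i j) = (\<Sum>f\<in>{..<k} \<rightarrow>\<^sub>E T. ?P f)"
      using T by (subst prod_sum_PiE) (auto intro: finite_subset)
    also have "\<dots> = (\<Sum>f\<in>{f\<in>?E. f ` {..<k} \<subseteq> T}. ?P f)"
      by (rule sum.cong) (use T in \<open>auto simp: PiE_def Pi_def image_subset_iff\<close>)
    also have "\<dots> = (\<Sum>f\<in>?E. if f ` {..<k} \<subseteq> T then ?P f else 0)"
      by (subst sum.inter_filter) (auto intro: finite_PiE)
    finally show "(- 1) ^ (k - card T) * (\<Prod>j<k. \<Sum>i\<in>T. a i j) =
      (\<Sum>f\<in>?E. if f ` {..<k} \<subseteq> T then (- 1) ^ (k - card T) * ?P f else 0)"
      by (simp add: sum_distrib_left if_distrib cong: if_cong)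
  qed
  also have "\<dots> = (\<Sum>f\<in>?E. \<Sum>T\<in>Pow {..<k}. if f ` {..<k} \<subseteq> T then (- 1) ^ (k - card T) * ?P f else 0)"
    by (rule sum.swap)
  also have "\<dots> = (\<Sum>f\<in>?E. if f ` {..<k} = {..<k} then ?P f else 0)"
  proof (rule sum.cong[OF refl])
    fix f assume f: "f \<in> ?E"
    have "(\<Sum>T\<in>Pow {..<k}. if f ` {..<k} \<subseteq> T then (- 1) ^ (k - card T) * ?P f else 0) =
       (\<Sum>T | f ` {..<k} \<subseteq> T \<and> T \<subseteq> {..<k}. (- 1) ^ (k - card T)) * ?P f"
      by (subst sum.inter_filter[symmetric]) (auto simp: sum_distrib_right intro!: sum.cong)
    also have "\<dots> = (if f ` {..<k} = {..<k} then ?P f else 0)"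
      using f by (subst sum_supersets_alternating) auto
    finally show "(\<Sum>T\<in>Pow {..<k}. if f ` {..<k} \<subseteq> T then (- 1) ^ (k - card T) * ?P f else 0) =
      (if f ` {..<k} = {..<k} then ?P f else 0)" .
  qed
  also have "\<dots> = (\<Sum>f\<in>{f\<in>?E. f ` {..<k} = {..<k}}. ?P f)"
    by (subst sum.inter_filter) (auto intro: finite_PiE)
  also have "\<dots> = (\<Sum>p | p permutes {..<k}. ?P p)"
  proof (rule sum.reindex_bij_witness[of _ "\<lambda>p. restrict p {..<k}" "\<lambda>f i. if i < k then f i else i"])
    fix f assume f: "f \<in> {f\<in>?E. f ` {..<k} = {..<k}}"
    show "restrict (\<lambda>i. if i < k then f i else i) {..<k} = f"
      using f by (auto simp: fun_eq_iff restrict_def PiE_def extensional_def)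
    have "inj_on f {..<k}" using f by (intro eq_card_imp_inj_on) auto
    then have "bij_betw f {..<k} {..<k}" using f by (auto simp: bij_betw_def)
    then have "bij_betw (\<lambda>i. if i < k then f i else i) {..<k} {..<k}"
      by (subst bij_betw_cong[where g = f]) auto
    then show "(\<lambda>i. if i < k then f i else i) \<in> {p. p permutes {..<k}}"
      by (auto intro!: bij_imp_permutes split: if_splits)
  next
    fix p assume p: "p \<in> {p. p permutes {..<k}}"
    then show "restrict p {..<k} \<in> {f\<in>?E. f ` {..<k} = {..<k}}"
      using permutes_image[of p "{..<k}"] permutes_in_image[of p "{..<k}"] by (auto simp: image_restrict_eq)
    show "(\<lambda>i. if i < k then restrict p {..<k} i else i) = p"
      using p permutes_not_in[of p "{..<k}"] by (auto simp: fun_eq_iff)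
  qed auto
  \<comment> \<open>The expansion has produced factors \<open>a (p j) j\<close>; inverting the
    permutations exchanges rows and columns.\<close>
  also have "\<dots> = (\<Sum>p | p permutes {..<k}. ?P (inv p))"
    by (rule sum_permutations_inverse)
  also have "\<dots> = (\<Sum>p | p permutes {..<k}. \<Prod>i<k. a i (p i))"
  proof (rule sum.cong[OF refl])
    fix p assume "p \<in> {p. p permutes {..<k}}"
    then have p: "p permutes {..<k}" by simp
    show "?P (inv p) = (\<Prod>i<k. a i (p i))"
      by (subst prod.permute[OF p]) (simp add: comp_def permutes_inverses[OF p])
  qed
  finally show ?thesis ..
qed

section \<open>The points of a configuration in a region\<close>

definition idx :: "'a config \<Rightarrow> 'a set \<Rightarrow> nat set" where
  "idx c B = {n. enat n < fst c \<and> snd c n \<in> B}"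

text \<open>Listed in the order of their indices. If there are infinitely many,
  \<open>sorted_list_of_set\<close> makes this the empty list.\<close>

definition pts :: "'a config \<Rightarrow> 'a set \<Rightarrow> 'a list" where
  "pts c B = map (snd c) (sorted_list_of_set (idx c B))"

lemma num_points_idx: "num_points c B = (if finite (idx c B) then of_nat (card (idx c B)) else \<infinity>)"
  by (simp add: num_points_def idx_def)

lemma num_points_eq_of_nat: "num_points c B = of_nat k \<longleftrightarrow> finite (idx c B) \<and> card (idx c B) = k"
  by (auto simp: num_points_idx)

lemma measurable_fst_config [measurable]: "fst \<in> config_algebra \<rightarrow>\<^sub>M count_space UNIV"
  unfolding config_algebra_def by measurable

lemma measurable_snd_config: "(\<lambda>c. snd c n) \<in> config_algebra \<rightarrow>\<^sub>M borel"
  unfolding config_algebra_def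
  by (rule measurable_compose[OF measurable_snd measurable_PiM_UNIV_component])

lemma measurable_idx:
  assumes [measurable]: "B \<in> sets borel"
  shows "Measurable.pred config_algebra (\<lambda>c. n \<in> idx c B)"
proof -
  have [measurable]: "(\<lambda>c. snd c n) \<in> config_algebra \<rightarrow>\<^sub>M borel" for n
    by (rule measurable_snd_config)
  show ?thesis unfolding idx_def by simp
qed

lemma measurable_sorted_idx:
  assumes B: "B \<in> sets borel"
  shows "(\<lambda>c. sorted_list_of_set (idx c B)) \<in> config_algebra \<rightarrow>\<^sub>M count_space UNIV"
proof (subst measurable_count_space_eq2_countable, intro conjI ballI)
  note [measurable] = measurable_idx[OF B]
  fix l :: "nat list"
  \<comment> \<open>The list is determined by the membership of single indices: finiteness is
    boundedness, and the last branch is the value \<open>[]\<close> at infinite sets.\<close>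
  have eq: "sorted_list_of_set S = l \<longleftrightarrow> (if \<exists>m. \<forall>n. n \<in> S \<longrightarrow> n < m
     then sorted l \<and> distinct l \<and> (\<forall>n. n \<in> S \<longleftrightarrow> n \<in> set l) else l = [])" for S
  proof -
    have "(\<exists>m. \<forall>n. n \<in> S \<longrightarrow> n < m) \<longleftrightarrow> finite S" by (auto simp: finite_nat_set_iff_bounded)
    then show ?thesis
      by (auto simp: sorted_list_of_set.distinct_sorted_key_list_of_set intro: sorted_list_of_set.idem_if_sorted_distinct)
        (metis sorted_list_of_set.idem_if_sorted_distinct set_eqI sorted_list_of_set_unique)+
  qed
  have "Measurable.pred config_algebra (\<lambda>c. sorted_list_of_set (idx c B) = l)"
    unfolding eq by measurable
  then show "(\<lambda>c. sorted_list_of_set (idx c B)) -` {l} \<inter> space config_algebra \<in> sets config_algebra"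
    by (simp add: pred_def vimage_def Int_def conj_commute)
qed auto

lemma measurable_finite_idx:
  assumes B: "B \<in> sets borel"
  shows "Measurable.pred config_algebra (\<lambda>c. finite (idx c B))"
proof -
  note [measurable] = measurable_idx[OF B]
  have "finite (idx c B) \<longleftrightarrow> (\<exists>m. \<forall>n. n \<in> idx c B \<longrightarrow> n < m)" for c
    by (auto simp: finite_nat_set_iff_bounded)
  then show ?thesis by simp
qed

lemma measurable_num_points [measurable]:
  assumes B: "B \<in> sets borel"
  shows "(\<lambda>c. num_points c B) \<in> borel_measurable config_algebra"
proof -
  note [measurable] = measurable_finite_idx[OF B] measurable_sorted_idx[OF B]
  have "(\<lambda>c. if finite (idx c B) then of_nat (length (sorted_list_of_set (idx c B))) else (\<infinity> :: ennreal))
    \<in> borel_measurable config_algebra"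
    by measurable
  then show ?thesis by (simp add: num_points_idx cong: if_cong)
qed

lemma measurable_pts:
  assumes B: "B \<in> sets borel" and F: "lmeas F"
  shows "(\<lambda>c. F (pts c B)) \<in> borel_measurable config_algebra"
  unfolding pts_def
proof (rule measurable_compose_countable[OF _ measurable_sorted_idx[OF B]])
  fix l :: "nat list"
  show "(\<lambda>c. F (map (snd c) l)) \<in> borel_measurable config_algebra"
    by (rule lmeasD'[OF F, where fs = "map (\<lambda>i c. snd c i) l"]) (auto intro: measurable_snd_config)
qed

lemma measurable_pts_nth:
  assumes B: "B \<in> sets borel"
  shows "(\<lambda>c. snd c (sorted_list_of_set (idx c B) ! j)) \<in> borel_measurable config_algebra"
  by (rule measurable_compose_countable[OF _ measurable_sorted_idx[OF B]]) (rule measurable_snd_config)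

section \<open>Factorial moments of a Poisson process\<close>

text \<open>\<open>a\<close> to the power \<open>N\<close>, with value \<open>0\<close> at \<open>N = \<infinity>\<close> for every \<open>a\<close>.\<close>

definition pw :: "real \<Rightarrow> ennreal \<Rightarrow> ennreal" where
  "pw a N = (\<Sum>n. ennreal (a ^ n) * indicator {of_nat n} N)"

lemma measurable_pw [measurable]: "pw a \<in> borel_measurable borel"
  unfolding pw_def by measurable

lemma pw_of_nat: "pw a (of_nat n) = ennreal (a ^ n)"
proof -
  have "(\<Sum>i. ennreal (a ^ i) * indicator {of_nat i} (of_nat n :: ennreal)) =
    (\<Sum>i\<in>{n}. ennreal (a ^ i) * indicator {of_nat i} (of_nat n :: ennreal))"
    by (rule suminf_finite) (auto simp: indicator_def)
  then show ?thesis by (simp add: pw_def)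
qed

lemma pw_top: "pw a \<infinity> = 0"
  by (simp add: pw_def indicator_def)

text \<open>The coefficient of \<open>z ^ k\<close> in the product of \<open>z * u x\<close> over
  the points \<open>x\<close> in \<open>B\<close>; compare \<open>prod_pw_npw\<close>.\<close>

definition npw :: "('a \<Rightarrow> nat) \<Rightarrow> nat \<Rightarrow> 'a config \<Rightarrow> 'a set \<Rightarrow> real" where
  "npw u k c B = (if finite (idx c B) \<and> card (idx c B) = k then \<Prod>x\<leftarrow>pts c B. real (u x) else 0)"

lemma prod_list_pts: "(\<Prod>x\<leftarrow>pts c B. f x) = (\<Prod>n\<in>idx c B. f (snd c n))" if "finite (idx c B)"
  for f :: "_ \<Rightarrow> 'b::comm_monoid_mult"
  using prod.distinct_set_conv_list[of "sorted_list_of_set (idx c B)" "\<lambda>n. f (snd c n)"] that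
  by (simp add: pts_def comp_def)

text \<open>Grouping the points by their value under \<open>u\<close> gives a product of functions
  of counts on disjoint sets. If \<open>B\<close> contains infinitely many points, so does one of
  the finitely many level sets, and both sides vanish by the convention for \<open>pw\<close> at
  infinity.\<close>

lemma prod_pw_npw:
  assumes u: "\<And>x. u x < m" and z: "0 \<le> z"
  shows "(\<Prod>i<m. pw (z * real i) (num_points c {x\<in>B. u x = i})) = (\<Sum>k. ennreal (z ^ k * npw u k c B))"
proof -
  let ?J = "idx c B"
  have sub: "idx c {x\<in>B. u x = i} = {n\<in>?J. u (snd c n) = i}" for i
    by (auto simp: idx_def)
  show ?thesis
  proof (cases "finite ?J")
    case True
    have "(\<Prod>i<m. pw (z * real i) (num_points c {x\<in>B. u x = i})) =
      (\<Prod>i<m. ennreal ((z * real i) ^ card {n\<in>?J. u (snd c n) = i}))"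
      using True by (simp add: num_points_idx sub pw_of_nat)
    also have "\<dots> = ennreal (\<Prod>i<m. (z * real i) ^ card {n\<in>?J. u (snd c n) = i})"
      using z by (intro prod_ennreal) auto
    also have "(\<Prod>i<m. (z * real i) ^ card {n\<in>?J. u (snd c n) = i}) =
      (\<Prod>i<m. \<Prod>n\<in>{n\<in>?J. u (snd c n) = i}. z * real (u (snd c n)))"
      by (intro prod.cong refl) simp
    also have "\<dots> = (\<Prod>n\<in>?J. z * real (u (snd c n)))"
      by (rule prod.group) (use True u in auto)
    also have "\<dots> = z ^ card ?J * npw u (card ?J) c B"
      using True by (simp add: npw_def prod.distrib prod_list_pts)
    also have "ennreal \<dots> = (\<Sum>k\<in>{card ?J}. ennreal (z ^ k * npw u k c B))" by simp
    also have "\<dots> = (\<Sum>k. ennreal (z ^ k * npw u k c B))"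
      by (rule suminf_finite[symmetric]) (auto simp: npw_def)
    finally show ?thesis .
  next
    case False
    have "?J = (\<Union>i<m. {n\<in>?J. u (snd c n) = i})" using u by auto
    then obtain i where i: "i < m" "infinite {n\<in>?J. u (snd c n) = i}"
      using False by (metis (no_types, lifting) finite_UN_I finite_lessThan lessThan_iff)
    then have "pw (z * real i) (num_points c {x\<in>B. u x = i}) = 0"
      using pw_top by (simp add: num_points_idx sub)
    then have "(\<Prod>i<m. pw (z * real i) (num_points c {x\<in>B. u x = i})) = 0"
      using i(1) by (intro prod_zero) auto
    then show ?thesis using False by (simp add: npw_def)
  qed
qed

lemma (in prob_space) expectation_indicator_sum_ennreal:
  assumes "\<And>n. A n \<in> events"
  shows "(\<integral>\<^sup>+\<omega>. (\<Sum>n. ennreal (c n) * indicator (A n) \<omega>) \<partial>M) = (\<Sum>n. ennreal (c n) * ennreal (prob (A n)))"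
  using assms by (simp add: nn_integral_suminf nn_integral_cmult_indicator emeasure_eq_measure)

definition count_event :: "'w measure \<Rightarrow> ('w \<Rightarrow> 'a config) \<Rightarrow> 'a set \<Rightarrow> nat \<Rightarrow> 'w set" where
  "count_event M \<eta> B k = {\<omega>\<in>space M. finite (idx (\<eta> \<omega>) B) \<and> card (idx (\<eta> \<omega>) B) = k}"

definition nth_pt :: "('w \<Rightarrow> 'a config) \<Rightarrow> 'a set \<Rightarrow> nat \<Rightarrow> 'w \<Rightarrow> 'a" where
  "nth_pt \<eta> B j \<omega> = snd (\<eta> \<omega>) (sorted_list_of_set (idx (\<eta> \<omega>) B) ! j)"

lemma poisson_processD:
  fixes n :: nat
  assumes "poisson_process M \<Lambda> \<eta>"
  shows "prob_space M" "\<eta> \<in> M \<rightarrow>\<^sub>M config_algebra"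
  and "B \<in> sets \<Lambda> \<Longrightarrow> measure M {\<omega>\<in>space M. num_points (\<eta> \<omega>) B = of_nat k} =
    (if emeasure \<Lambda> B = \<infinity> then 0 else measure \<Lambda> B ^ k / fact k * exp (- measure \<Lambda> B))"
  and "(\<And>i. i < n \<Longrightarrow> C i \<in> sets \<Lambda>) \<Longrightarrow> disjoint_family_on C {..<n} \<Longrightarrow>
    prob_space.indep_vars M (\<lambda>_. borel) (\<lambda>i \<omega>. num_points (\<eta> \<omega>) (C i)) {..<n}"
proof -
  show "prob_space M" by (rule assms[unfolded poisson_process_def, THEN conjunct1])
  show "\<eta> \<in> M \<rightarrow>\<^sub>M config_algebra"
    by (rule assms[unfolded poisson_process_def, THEN conjunct2, THEN conjunct1])
  show "measure M {\<omega>\<in>space M. num_points (\<eta> \<omega>) B = of_nat k} =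
    (if emeasure \<Lambda> B = \<infinity> then 0 else measure \<Lambda> B ^ k / fact k * exp (- measure \<Lambda> B))"
    if "B \<in> sets \<Lambda>"
    by (rule assms[unfolded poisson_process_def, THEN conjunct2, THEN conjunct2, THEN conjunct1, rule_format, OF that])
  show "prob_space.indep_vars M (\<lambda>_. borel) (\<lambda>i \<omega>. num_points (\<eta> \<omega>) (C i)) {..<n}"
    if "\<And>i. i < n \<Longrightarrow> C i \<in> sets \<Lambda>" "disjoint_family_on C {..<n}"
    using that by (rule assms[unfolded poisson_process_def, THEN conjunct2, THEN conjunct2, THEN conjunct2, rule_format])
qed

lemma exp_series_sums: "(\<lambda>n. x ^ n / fact n * c) sums (exp x * c)" for x c :: real
  using exp_converges[of x] by (intro sums_mult2) (simp add: field_simps scaleR_conv_of_real)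

context
  fixes M :: "'w measure" and \<Lambda> :: "'a::second_countable_topology measure" and \<eta> :: "'w \<Rightarrow> 'a config"
    and B :: "'a set"
  assumes pp: "poisson_process M \<Lambda> \<eta>" and sets_L [measurable_cong]: "sets \<Lambda> = sets borel"
    and B [measurable]: "B \<in> sets borel" and Bfin: "emeasure \<Lambda> B < \<infinity>"
begin

abbreviation "En \<equiv> count_event M \<eta> B"
abbreviation "Z \<equiv> nth_pt \<eta> B"

lemma prob_M: "prob_space M"
  by (rule poisson_processD[OF pp])

lemma eta_measurable [measurable]: "\<eta> \<in> M \<rightarrow>\<^sub>M config_algebra"
  by (rule poisson_processD[OF pp])

lemma fin_sub: "C \<in> sets borel \<Longrightarrow> C \<subseteq> B \<Longrightarrow> emeasure \<Lambda> C < \<infinity>"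
  using emeasure_mono[of C B \<Lambda>] Bfin B sets_L by (auto intro: le_less_trans)

text \<open>The probability generating function of the Poisson distribution.\<close>

lemma nn_integral_pw:
  assumes C: "C \<in> sets borel" "C \<subseteq> B" and a: "0 \<le> a"
  shows "(\<integral>\<^sup>+\<omega>. pw a (num_points (\<eta> \<omega>) C) \<partial>M) = ennreal (exp ((a - 1) * measure \<Lambda> C))"
proof -
  interpret prob_space M by (rule prob_M)
  note [measurable] = measurable_num_points[OF C(1)]
  let ?A = "\<lambda>n. {\<omega>\<in>space M. num_points (\<eta> \<omega>) C = of_nat n}"
  have A: "?A n \<in> events" for n by measurable
  have P: "prob (?A n) = measure \<Lambda> C ^ n / fact n * exp (- measure \<Lambda> C)" for n
    using poisson_processD(3)[OF pp, of C n] fin_sub[OF C] C(1) sets_L by simp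
  have "(\<integral>\<^sup>+\<omega>. pw a (num_points (\<eta> \<omega>) C) \<partial>M) = (\<integral>\<^sup>+\<omega>. (\<Sum>n. ennreal (a ^ n) * indicator (?A n) \<omega>) \<partial>M)"
    unfolding pw_def by (intro nn_integral_cong suminf_cong) (auto simp: indicator_def)
  also have "\<dots> = (\<Sum>n. ennreal (a ^ n) * ennreal (prob (?A n)))"
    by (rule expectation_indicator_sum_ennreal[OF A])
  also have "\<dots> = (\<Sum>n. ennreal ((a * measure \<Lambda> C) ^ n / fact n * exp (- measure \<Lambda> C)))"
    unfolding P using a by (intro suminf_cong) (simp add: ennreal_mult[symmetric] power_mult_distrib mult.assoc)
  also have "\<dots> = ennreal (exp (a * measure \<Lambda> C) * exp (- measure \<Lambda> C))"
    using a by (intro suminf_ennreal_eq exp_series_sums) auto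
  finally show ?thesis by (simp add: exp_add[symmetric] algebra_simps)
qed

lemma En_sets [measurable]: "En k \<in> sets M"
proof -
  note [measurable] = measurable_num_points[OF B]
  have "En k = {\<omega>\<in>space M. num_points (\<eta> \<omega>) B = of_nat k}"
    by (auto simp: count_event_def num_points_eq_of_nat)
  then show ?thesis by simp
qed

lemma Z_measurable [measurable]: "Z j \<in> M \<rightarrow>\<^sub>M borel"
  unfolding nth_pt_def by (rule measurable_compose[OF eta_measurable measurable_pts_nth[OF B]])

lemma pts_Z: "\<omega> \<in> En k \<Longrightarrow> pts (\<eta> \<omega>) B = map (\<lambda>j. Z j \<omega>) [0..<k]"
  by (rule nth_equalityI) (auto simp: pts_def nth_pt_def count_event_def)

lemma npw_Z: "\<omega> \<in> space M \<Longrightarrow> npw u k (\<eta> \<omega>) B = indicator (En k) \<omega> * (\<Prod>j<k. real (u (Z j \<omega>)))"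
proof (cases "\<omega> \<in> En k")
  case True
  then show ?thesis
    using prod.distinct_set_conv_list[of "[0..<k]" "\<lambda>j. real (u (Z j \<omega>))"]
    by (auto simp: npw_def pts_Z comp_def count_event_def atLeast0LessThan)
qed (auto simp: npw_def count_event_def)

text \<open>Two expansions of one generating function in \<open>z\<close> are compared: by the
  number of points, with the wanted expectations as coefficients, and as an exponential series. The
  constant \<open>I\<close> is the integral of \<open>u\<close> over \<open>B\<close>.\<close>

lemma expectation_npw:
  assumes [measurable]: "u \<in> borel \<rightarrow>\<^sub>M count_space UNIV" and u: "\<And>x. u x < m"
  shows "(\<integral>\<omega>. indicator (En k) \<omega> * (\<Prod>j<k. real (u (Z j \<omega>))) \<partial>M) =
    exp (- measure \<Lambda> B) * (\<Sum>i<m. real i * measure \<Lambda> {x\<in>B. u x = i}) ^ k / fact k"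
    and "integrable M (\<lambda>\<omega>. indicator (En k) \<omega> * (\<Prod>j<k. real (u (Z j \<omega>))))"
proof -
  interpret prob_space M by (rule prob_M)
  let ?W = "\<lambda>k \<omega>. indicator (En k) \<omega> * (\<Prod>j<k. real (u (Z j \<omega>)))"
  let ?C = "\<lambda>i. {x\<in>B. u x = i}"
  define I where "I = (\<Sum>i<m. real i * measure \<Lambda> (?C i))"
  have I0: "0 \<le> I" unfolding I_def by (intro sum_nonneg) auto
  have C [measurable]: "?C i \<in> sets borel" for i by measurable
  have W0: "0 \<le> ?W k \<omega>" for k \<omega> by (intro mult_nonneg_nonneg prod_nonneg) auto
  have Wm: "?W k \<omega> \<le> real m ^ k" for k \<omega>
  proof -
    have "(\<Prod>j<k. real (u (Z j \<omega>))) \<le> (\<Prod>j<k. real m)"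
      using u by (intro prod_mono) (auto intro: less_imp_le)
    then show ?thesis by (auto simp: indicator_def)
  qed
  have int: "integrable M (?W k)" for k
  proof (rule integrable_const_bound[of _ "real m ^ k"])
    show "AE \<omega> in M. norm (?W k \<omega>) \<le> real m ^ k"
      using W0 Wm by (auto simp: abs_of_nonneg)
    show "?W k \<in> borel_measurable M" by measurable
  qed
  show "integrable M (?W k)" by (rule int)
  define a where "a k = (\<integral>\<omega>. ?W k \<omega> \<partial>M)" for k
  have a0: "0 \<le> a k" for k unfolding a_def using W0 by (intro Bochner_Integration.integral_nonneg) auto
  have cover: "(\<Sum>i<m. measure \<Lambda> (?C i)) = measure \<Lambda> B"
  proof -
    have "B = (\<Union>i<m. ?C i)" using u by auto
    then have "measure \<Lambda> B = measure \<Lambda> (\<Union>i<m. ?C i)" by simp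
    also have "\<dots> = (\<Sum>i<m. measure \<Lambda> (?C i))"
      by (rule measure_finite_Union) (use fin_sub[OF C, THEN less_imp_neq] sets_L C in \<open>auto simp: disjoint_family_on_def\<close>)
    finally show ?thesis by simp
  qed
  \<comment> \<open>The counts on the level sets of \<open>u\<close> are independent Poisson
    variables, and their generating functions multiply to
    \<open>exp (z * I - measure \<Lambda> B)\<close>.\<close>
  have key: "(\<Sum>k. ennreal (z ^ k * a k)) = ennreal (exp (z * I) * exp (- measure \<Lambda> B))" if z: "0 \<le> z" for z
  proof -
    note mn [measurable] = measurable_num_points[OF C]
    have "indep_vars (\<lambda>_. borel) (\<lambda>i \<omega>. num_points (\<eta> \<omega>) (?C i)) {..<m}"
    proof -
      have "?C i \<in> sets \<Lambda>" if "i < m" for i using C sets_L by simp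
      moreover have "disjoint_family_on ?C {..<m}" by (auto simp: disjoint_family_on_def)
      ultimately show ?thesis
        by (rule poisson_processD(4)[OF pp])
    qed
    from indep_vars_compose2[OF this measurable_pw]
    have ind: "indep_vars (\<lambda>_. borel) (\<lambda>i \<omega>. pw (z * real i) (num_points (\<eta> \<omega>) (?C i))) {..<m}" .
    have "(\<Sum>k. ennreal (z ^ k * a k)) = (\<Sum>k. \<integral>\<^sup>+\<omega>. ennreal (z ^ k * ?W k \<omega>) \<partial>M)"
      unfolding a_def using z W0
      by (intro suminf_cong, subst nn_integral_eq_integral) (auto intro!: integrable_mult_right int mult_nonneg_nonneg simp del: mult_eq_0_iff)
    also have "\<dots> = (\<integral>\<^sup>+\<omega>. (\<Sum>k. ennreal (z ^ k * ?W k \<omega>)) \<partial>M)"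
      by (subst nn_integral_suminf) auto
    also have "\<dots> = (\<integral>\<^sup>+\<omega>. (\<Prod>i<m. pw (z * real i) (num_points (\<eta> \<omega>) (?C i))) \<partial>M)"
      by (intro nn_integral_cong) (simp add: prod_pw_npw[OF u z] npw_Z)
    also have "\<dots> = (\<Prod>i<m. \<integral>\<^sup>+\<omega>. pw (z * real i) (num_points (\<eta> \<omega>) (?C i)) \<partial>M)"
      by (rule indep_vars_nn_integral[OF _ ind]) auto
    also have "\<dots> = (\<Prod>i<m. ennreal (exp ((z * real i - 1) * measure \<Lambda> (?C i))))"
      using z by (intro prod.cong refl nn_integral_pw C) auto
    also have "\<dots> = ennreal (exp (\<Sum>i<m. (z * real i - 1) * measure \<Lambda> (?C i)))"
      by (simp add: prod_ennreal exp_sum)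
    also have "(\<Sum>i<m. (z * real i - 1) * measure \<Lambda> (?C i)) = z * I - measure \<Lambda> B"
      unfolding cover[symmetric] I_def by (simp add: sum_distrib_left sum_subtractf algebra_simps)
    finally show ?thesis by (simp add: exp_diff exp_minus field_simps)
  qed
  have "a k = exp (- measure \<Lambda> B) * I ^ k / fact k"
  proof (rule powser_unique_at_right)
    fix z :: real assume z: "0 < z" "z < 1"
    show "(\<lambda>n. a n * z ^ n) sums (exp (z * I) * exp (- measure \<Lambda> B))"
    proof -
      have nt: "(\<Sum>k. ennreal (z ^ k * a k)) \<noteq> top" using key[of z] z by simp
      have s: "summable (\<lambda>k. z ^ k * a k)"
        by (rule summable_suminf_not_top[OF _ nt]) (use z a0 in auto)
      have "(\<Sum>k. ennreal (z ^ k * a k)) = ennreal (\<Sum>k. z ^ k * a k)"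
        by (rule suminf_ennreal2[OF _ s]) (use z a0 in auto)
      then have "ennreal (\<Sum>k. z ^ k * a k) = ennreal (exp (z * I) * exp (- measure \<Lambda> B))"
        using key[OF less_imp_le[OF z(1)]] by (rule trans[OF sym])
      moreover have "0 \<le> (\<Sum>k. z ^ k * a k)" using z a0 s by (intro suminf_nonneg) auto
      ultimately have "(\<Sum>k. z ^ k * a k) = exp (z * I) * exp (- measure \<Lambda> B)" by simp
      then show ?thesis using summable_sums[OF s] by (simp add: mult.commute)
    qed
    show "(\<lambda>n. exp (- measure \<Lambda> B) * I ^ n / fact n * z ^ n) sums (exp (z * I) * exp (- measure \<Lambda> B))"
      using exp_series_sums[of "z * I" "exp (- measure \<Lambda> B)"] by (simp add: power_mult_distrib field_simps)
  qed
  then show "(\<integral>\<omega>. ?W k \<omega> \<partial>M) = exp (- measure \<Lambda> B) * (\<Sum>i<m. real i * measure \<Lambda> (?C i)) ^ k / fact k"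
    by (simp add: a_def I_def)
qed

text \<open>The sum of indicators is the number of sets \<open>A i\<close> containing the point. It
  is a function with finitely many natural values, so the sets may overlap.\<close>

lemma expectation_count:
  assumes T: "finite T" and A: "\<And>i. i \<in> T \<Longrightarrow> A i \<in> sets borel"
  shows "(\<integral>\<omega>. indicator (En k) \<omega> * (\<Prod>j<k. \<Sum>i\<in>T. indicator (A i) (Z j \<omega>) :: real) \<partial>M) =
    exp (- measure \<Lambda> B) * (\<Sum>i\<in>T. measure \<Lambda> (A i \<inter> B)) ^ k / fact k"
    and "integrable M (\<lambda>\<omega>. indicator (En k) \<omega> * (\<Prod>j<k. \<Sum>i\<in>T. indicator (A i) (Z j \<omega>) :: real))"
proof -
  define u where "u x = card {i\<in>T. x \<in> A i}" for x
  have u: "real (u x) = (\<Sum>i\<in>T. indicator (A i) x)" for x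
    using T by (simp add: u_def indicator_def sum.If_cases Int_def)
  have um: "u x < Suc (card T)" for x
    unfolding u_def using T by (simp add: card_mono less_Suc_eq_le)
  have [measurable]: "u \<in> borel \<rightarrow>\<^sub>M count_space UNIV"
  proof -
    have "(\<lambda>x. real (u x)) \<in> borel_measurable borel" unfolding u using A by measurable
    then have "(\<lambda>x. nat \<lfloor>real (u x)\<rfloor>) \<in> borel \<rightarrow>\<^sub>M count_space UNIV" by measurable
    then show ?thesis by simp
  qed
  \<comment> \<open>Both sides are the integral of \<open>u\<close> over \<open>B\<close>, evaluated
    by level sets and by the sets \<open>A i\<close>.\<close>
  have "(\<Sum>i<Suc (card T). real i * measure \<Lambda> {x\<in>B. u x = i}) = (\<Sum>i\<in>T. measure \<Lambda> (A i \<inter> B))"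
  proof -
    let ?\<mu> = "density \<Lambda> (indicator B)"
    have fin: "finite_measure ?\<mu>"
      by (rule finite_measureI) (use Bfin sets_L in \<open>simp add: emeasure_density sets_eq_imp_space_eq[OF sets_L]\<close>)
    interpret finite_measure ?\<mu> by (rule fin)
    have me: "measure ?\<mu> C = measure \<Lambda> (C \<inter> B)" if "C \<in> sets borel" for C
      using that sets_L B by (simp add: measure_def emeasure_density indicator_inter_arith[symmetric] Int_commute)
    have [measurable]: "A i \<in> sets borel" if "i \<in> T" for i using A that by auto
    have [measurable]: "{x. u x = i} \<in> sets borel" for i by measurable
    have "(\<integral>x. real (u x) \<partial>?\<mu>) = (\<integral>x. (\<Sum>i\<in>T. indicator (A i) x) \<partial>?\<mu>)" by (simp add: u)
    also have "\<dots> = (\<Sum>i\<in>T. \<integral>x. indicator (A i) x \<partial>?\<mu>)"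
      by (rule Bochner_Integration.integral_sum) (use A sets_L in \<open>auto intro!: integrable_real_indicator simp: emeasure_eq_measure\<close>)
    also have "\<dots> = (\<Sum>i\<in>T. measure \<Lambda> (A i \<inter> B))"
      using A sets_L by (intro sum.cong refl) (simp add: me sets_eq_imp_space_eq[OF sets_L])
    finally have 1: "(\<integral>x. real (u x) \<partial>?\<mu>) = \<dots>" .
    have "real (u x) = (\<Sum>i<Suc (card T). real i * indicator {x. u x = i} x)" for x
      using um[of x] by (simp add: indicator_def sum.delta if_distrib cong: if_cong del: sum.lessThan_Suc)
    then have "(\<integral>x. real (u x) \<partial>?\<mu>) = (\<integral>x. (\<Sum>i<Suc (card T). real i * indicator {x. u x = i} x) \<partial>?\<mu>)" by simp
    also have "\<dots> = (\<Sum>i<Suc (card T). \<integral>x. real i * indicator {x. u x = i} x \<partial>?\<mu>)"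
      by (rule Bochner_Integration.integral_sum) (use sets_L in \<open>auto intro!: integrable_mult_right integrable_real_indicator simp: emeasure_eq_measure\<close>)
    also have "\<dots> = (\<Sum>i<Suc (card T). real i * measure \<Lambda> {x\<in>B. u x = i})"
      using sets_L by (intro sum.cong refl) (simp add: me sets_eq_imp_space_eq[OF sets_L] Int_def conj_commute)
    finally show ?thesis using 1 by simp
  qed
  then show "(\<integral>\<omega>. indicator (En k) \<omega> * (\<Prod>j<k. \<Sum>i\<in>T. indicator (A i) (Z j \<omega>) :: real) \<partial>M) =
    exp (- measure \<Lambda> B) * (\<Sum>i\<in>T. measure \<Lambda> (A i \<inter> B)) ^ k / fact k"
    "integrable M (\<lambda>\<omega>. indicator (En k) \<omega> * (\<Prod>j<k. \<Sum>i\<in>T. indicator (A i) (Z j \<omega>) :: real))"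
    using expectation_npw[of u "Suc (card T)" k, OF _ um] by (simp_all add: u del: sum.lessThan_Suc)
qed

text \<open>Ryser's formula is applied in both directions: to the random matrix of indicators, whose
  terms are covered by \<open>expectation_count\<close>, and back to the matrix of measures.\<close>

lemma expectation_permanent:
  assumes A: "\<And>i. i < k \<Longrightarrow> A i \<in> sets borel"
  shows "(\<integral>\<omega>. indicator (En k) \<omega> * (\<Sum>p | p permutes {..<k}. \<Prod>i<k. indicator (A i) (Z (p i) \<omega>) :: real) \<partial>M) =
    exp (- measure \<Lambda> B) * (\<Prod>i<k. measure \<Lambda> (A i \<inter> B))"
proof -
  have fT: "finite T" if "T \<in> Pow {..<k}" for T using that by (auto intro: finite_subset)
  have AT: "A i \<in> sets borel" if "T \<in> Pow {..<k}" "i \<in> T" for T i using that A by auto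
  let ?c = "\<lambda>T. (- 1 :: real) ^ (k - card T)"
  have "(\<integral>\<omega>. indicator (En k) \<omega> * (\<Sum>p | p permutes {..<k}. \<Prod>i<k. indicator (A i) (Z (p i) \<omega>) :: real) \<partial>M) =
    (\<integral>\<omega>. (\<Sum>T\<in>Pow {..<k}. ?c T * (indicator (En k) \<omega> * (\<Prod>j<k. \<Sum>i\<in>T. indicator (A i) (Z j \<omega>)))) \<partial>M)"
    by (subst permanent_Ryser) (simp add: sum_distrib_left ac_simps)
  also have "\<dots> = (\<Sum>T\<in>Pow {..<k}. \<integral>\<omega>. ?c T * (indicator (En k) \<omega> * (\<Prod>j<k. \<Sum>i\<in>T. indicator (A i) (Z j \<omega>))) \<partial>M)"
    by (rule Bochner_Integration.integral_sum) (intro integrable_mult_right expectation_count(2) fT AT)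
  also have "\<dots> = (\<Sum>T\<in>Pow {..<k}. ?c T * (exp (- measure \<Lambda> B) * (\<Sum>i\<in>T. measure \<Lambda> (A i \<inter> B)) ^ k / fact k))"
    by (intro sum.cong refl) (simp add: expectation_count(1)[OF fT AT])
  also have "\<dots> = exp (- measure \<Lambda> B) / fact k *
      (\<Sum>T\<in>Pow {..<k}. ?c T * (\<Prod>j<k. \<Sum>i\<in>T. measure \<Lambda> (A i \<inter> B)))"
    by (simp add: sum_distrib_left ac_simps)
  \<comment> \<open>This matrix has constant rows, so its permanent is \<open>fact k\<close> times a
    single product.\<close>
  also have "\<dots> = exp (- measure \<Lambda> B) / fact k * (\<Sum>p | p permutes {..<k}. \<Prod>i<k. measure \<Lambda> (A i \<inter> B))"
    by (subst permanent_Ryser[symmetric]) simp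
  also have "\<dots> = exp (- measure \<Lambda> B) * (\<Prod>i<k. measure \<Lambda> (A i \<inter> B))"
    by (simp add: card_permutations[of _ k])
  finally show ?thesis .
qed

end

section \<open>Janossy densities\<close>

text \<open>The list is reversed because the product space splits off its last coordinate, whereas
  \<open>lint\<close> integrates the head first.\<close>

lemma nn_integral_PiM_lint:
  fixes \<mu> :: "'a::second_countable_topology measure"
  assumes sets: "sets \<mu> = sets borel" and sf: "sigma_finite_measure \<mu>"
    and F: "lmeas F"
  shows "(\<integral>\<^sup>+x. F (map x (rev [0..<k])) \<partial>PiM {..<k} (\<lambda>_. \<mu>)) = lint \<mu> (\<lambda>_. 1) k F"
  using F
proof (induction k arbitrary: F)
  case 0
  then show ?case by (simp add: PiM_empty nn_integral_count_space_finite)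
next
  case (Suc k)
  note [measurable_cong] = sets
  interpret product_sigma_finite "\<lambda>_::nat. \<mu>"
    using sf by (simp add: product_sigma_finite_def)
  have m: "(\<lambda>x. F (map x (rev [0..<Suc k]))) \<in> borel_measurable (PiM (insert k {..<k}) (\<lambda>_. \<mu>))"
  proof (rule lmeasD'[OF Suc.prems, where fs = "map (\<lambda>i x. x i) (rev [0..<Suc k])"])
    fix f :: "(nat \<Rightarrow> 'a) \<Rightarrow> 'a" assume "f \<in> set (map (\<lambda>i x. x i) (rev [0..<Suc k]))"
    then obtain i where "i \<in> set (rev [0..<Suc k])" and i2: "f = (\<lambda>x. x i)" unfolding set_map by blast
    then have i: "i \<in> insert k {..<k}" by auto
    have "(\<lambda>x. x i) \<in> PiM (insert k {..<k}) (\<lambda>_. \<mu>) \<rightarrow>\<^sub>M \<mu>"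
      by (rule measurable_component_singleton[OF i])
    then show "f \<in> PiM (insert k {..<k}) (\<lambda>_. \<mu>) \<rightarrow>\<^sub>M borel"
      unfolding i2 measurable_cong_sets[OF refl sets] .
  qed (simp add: comp_def)
  have "(\<integral>\<^sup>+x. F (map x (rev [0..<Suc k])) \<partial>PiM {..<Suc k} (\<lambda>_. \<mu>)) =
    (\<integral>\<^sup>+y. \<integral>\<^sup>+x. F (map (x(k := y)) (rev [0..<Suc k])) \<partial>PiM {..<k} (\<lambda>_. \<mu>) \<partial>\<mu>)"
    unfolding lessThan_Suc by (rule product_nn_integral_insert_rev[OF _ _ m]) auto
  also have "\<dots> = (\<integral>\<^sup>+y. \<integral>\<^sup>+x. F (y # map x (rev [0..<k])) \<partial>PiM {..<k} (\<lambda>_. \<mu>) \<partial>\<mu>)"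
    by (intro nn_integral_cong arg_cong[where f = F]) auto
  also have "\<dots> = lint \<mu> (\<lambda>_. 1) (Suc k) F"
    by (simp add: Suc.IH[OF lmeas_Cons[OF Suc.prems]])
  finally show ?case .
qed

context
  fixes M :: "'w measure" and \<Lambda> :: "'a::second_countable_topology measure" and \<eta> :: "'w \<Rightarrow> 'a config"
    and B :: "'a set"
  assumes pp: "poisson_process M \<Lambda> \<eta>" and sets_L [measurable_cong]: "sets \<Lambda> = sets borel"
    and B [measurable]: "B \<in> sets borel" and Bfin: "emeasure \<Lambda> B < \<infinity>"
begin

abbreviation "ZZ \<equiv> nth_pt \<eta> B"
abbreviation "EE \<equiv> count_event M \<eta> B"

lemma restr_finite: "finite_measure (density \<Lambda> (indicator B))"
  by (rule finite_measureI) (use Bfin sets_L in \<open>simp add: emeasure_density sets_eq_imp_space_eq[OF sets_L]\<close>)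

text \<open>By \<open>expectation_permanent\<close> the law of the points, summed over all their
  orders, has product form on rectangles; these determine a product measure.\<close>

lemma symmetrized_law:
  assumes F: "F \<in> borel_measurable (PiM {..<k} (\<lambda>_. borel))"
  shows "(\<integral>\<^sup>+\<omega>. indicator (EE k) \<omega> * (\<Sum>p | p permutes {..<k}. F (\<lambda>i\<in>{..<k}. ZZ (p i) \<omega>)) \<partial>M) =
    ennreal (exp (- measure \<Lambda> B)) * (\<integral>\<^sup>+x. F x \<partial>PiM {..<k} (\<lambda>_. density \<Lambda> (indicator B)))"
proof -
  interpret prob_space M by (rule prob_M[OF pp sets_L B Bfin])
  let ?\<mu> = "density \<Lambda> (indicator B)"
  interpret mu: finite_measure ?\<mu> by (rule restr_finite)
  interpret product_sigma_finite "\<lambda>_::nat. ?\<mu>"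
    by (simp add: product_sigma_finite_def mu.sigma_finite_measure)
  let ?P = "{p. p permutes {..<k}}"
  note [measurable] = Z_measurable[OF pp sets_L B Bfin] En_sets[OF pp sets_L B Bfin]
  have finP: "finite ?P" by (rule finite_permutations) simp
  let ?e = "ennreal (exp (measure \<Lambda> B))"
  \<comment> \<open>A pair \<open>(\<omega>, p)\<close> lists the points in the order
    \<open>p\<close>, counting measure sums over the orders, and the factor \<open>?e\<close> scales
    the image to the product measure itself.\<close>
  let ?D = "density (M \<Otimes>\<^sub>M count_space ?P) (\<lambda>(\<omega>, p). ?e * indicator (EE k) \<omega>)"
  let ?T = "\<lambda>(\<omega>, p). \<lambda>i\<in>{..<k}. ZZ (p i) \<omega>"
  have sets_mu: "sets (PiM {..<k} (\<lambda>_. ?\<mu>)) = sets (PiM {..<k} (\<lambda>_. borel))"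
    by (rule sets_PiM_cong) (auto simp: sets_L)
  have T [measurable]: "?T \<in> M \<Otimes>\<^sub>M count_space ?P \<rightarrow>\<^sub>M PiM {..<k} (\<lambda>_. borel)"
  proof (rule measurable_PiM_single')
    fix i assume "i \<in> {..<k}"
    have "(\<lambda>z. ZZ (snd z i) (fst z)) \<in> M \<Otimes>\<^sub>M count_space ?P \<rightarrow>\<^sub>M borel"
      by (rule measurable_compose_countable'[where g = snd and I = ?P and f = "\<lambda>p z. ZZ (p i) (fst z)"])
        (auto intro: countable_finite[OF finP])
    then show "(\<lambda>z. ?T z i) \<in> M \<Otimes>\<^sub>M count_space ?P \<rightarrow>\<^sub>M borel"
      using \<open>i \<in> _\<close> by (simp add: split_beta')
  qed (auto split: if_splits)
  define \<rho> where "\<rho> = distr ?D (PiM {..<k} (\<lambda>_. ?\<mu>)) ?T"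
  have int: "(\<integral>\<^sup>+x. G x \<partial>\<rho>) = ?e * (\<integral>\<^sup>+\<omega>. indicator (EE k) \<omega> * (\<Sum>p\<in>?P. G (\<lambda>i\<in>{..<k}. ZZ (p i) \<omega>)) \<partial>M)"
    if [measurable]: "G \<in> borel_measurable (PiM {..<k} (\<lambda>_. borel))" for G
  proof -
    interpret cP: finite_measure "count_space ?P" by (rule finite_measure_count_space[OF finP])
    interpret pair_sigma_finite M "count_space ?P" ..
    have GT: "(\<lambda>z. G (?T z)) \<in> borel_measurable (M \<Otimes>\<^sub>M count_space ?P)"
      by (rule measurable_compose[OF T that])
    have Gp: "(\<lambda>\<omega>. G (\<lambda>i\<in>{..<k}. ZZ (p i) \<omega>)) \<in> borel_measurable M" if "p \<in> ?P" for p
      using measurable_compose[OF measurable_Pair2'[of p "count_space ?P" M] GT] that by simp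
    have "(\<integral>\<^sup>+x. G x \<partial>\<rho>) = (\<integral>\<^sup>+z. G (?T z) \<partial>?D)"
      unfolding \<rho>_def by (rule nn_integral_distr) (use T that in \<open>simp_all add: measurable_cong_sets[OF refl sets_mu] measurable_cong_sets[OF sets_mu refl]\<close>)
    also have "\<dots> = (\<integral>\<^sup>+z. (?e * indicator (EE k) (fst z)) * G (?T z) \<partial>(M \<Otimes>\<^sub>M count_space ?P))"
      by (subst nn_integral_density) (use GT in \<open>auto simp: split_beta'\<close>)
    also have "\<dots> = (\<integral>\<^sup>+\<omega>. \<integral>\<^sup>+p. (?e * indicator (EE k) \<omega>) * G (\<lambda>i\<in>{..<k}. ZZ (p i) \<omega>) \<partial>count_space ?P \<partial>M)"
      by (subst cP.nn_integral_fst[symmetric]) (use GT in \<open>auto simp: split_beta'\<close>)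
    also have "\<dots> = (\<integral>\<^sup>+\<omega>. ?e * (indicator (EE k) \<omega> * (\<Sum>p\<in>?P. G (\<lambda>i\<in>{..<k}. ZZ (p i) \<omega>))) \<partial>M)"
      by (intro nn_integral_cong) (simp add: nn_integral_count_space_finite[OF finP] sum_distrib_left mult.assoc)
    also have "\<dots> = ?e * (\<integral>\<^sup>+\<omega>. indicator (EE k) \<omega> * (\<Sum>p\<in>?P. G (\<lambda>i\<in>{..<k}. ZZ (p i) \<omega>)) \<partial>M)"
      by (rule nn_integral_cmult) (intro borel_measurable_times_ennreal borel_measurable_sum Gp, auto)
    finally show ?thesis .
  qed
  have "\<rho> = PiM {..<k} (\<lambda>_. ?\<mu>)"
  proof (rule PiM_eqI)
    fix A :: "nat \<Rightarrow> 'a set" assume "\<And>i. i \<in> {..<k} \<Longrightarrow> A i \<in> sets ?\<mu>"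
    then have A: "A i \<in> sets borel" if "i < k" for i using that by (simp add: sets_L)
    then have PA: "Pi\<^sub>E {..<k} A \<in> sets (PiM {..<k} (\<lambda>_. borel))" by (intro sets_PiM_I_finite) auto
    let ?G = "\<lambda>\<omega>. \<Sum>p\<in>?P. \<Prod>i<k. indicator (A i) (ZZ (p i) \<omega>) :: real"
    have G0: "0 \<le> indicator (EE k) \<omega> * ?G \<omega>" for \<omega>
      by (intro mult_nonneg_nonneg sum_nonneg prod_nonneg) auto
    have [measurable]: "(\<lambda>\<omega>. indicator (A i) (ZZ j \<omega>) :: real) \<in> borel_measurable M" if "i < k" for i j
      using A[OF that] by measurable
    have Gm: "(\<lambda>\<omega>. indicator (EE k) \<omega> * ?G \<omega>) \<in> borel_measurable M"
      by (intro borel_measurable_times borel_measurable_sum borel_measurable_prod) auto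
    have "emeasure \<rho> (Pi\<^sub>E {..<k} A) = (\<integral>\<^sup>+x. indicator (Pi\<^sub>E {..<k} A) x \<partial>\<rho>)"
      using PA by (simp add: \<rho>_def sets_mu)
    also have "\<dots> = ?e * (\<integral>\<^sup>+\<omega>. indicator (EE k) \<omega> * (\<Sum>p\<in>?P. indicator (Pi\<^sub>E {..<k} A) (\<lambda>i\<in>{..<k}. ZZ (p i) \<omega>)) \<partial>M)"
      by (rule int) (use PA in measurable)
    also have "\<dots> = ?e * (\<integral>\<^sup>+\<omega>. ennreal (indicator (EE k) \<omega> * ?G \<omega>) \<partial>M)"
    proof (intro arg_cong[where f = "\<lambda>x. ?e * x"] nn_integral_cong)
      fix \<omega>
      have "indicator (Pi\<^sub>E {..<k} A) (\<lambda>i\<in>{..<k}. ZZ (p i) \<omega>) = ennreal (\<Prod>i<k. indicator (A i) (ZZ (p i) \<omega>))" for p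
      proof (cases "\<forall>i<k. ZZ (p i) \<omega> \<in> A i")
        case False
        then obtain i where "i < k" "ZZ (p i) \<omega> \<notin> A i" by auto
        then have "(\<Prod>i<k. indicator (A i) (ZZ (p i) \<omega>) :: real) = 0" "(\<lambda>i\<in>{..<k}. ZZ (p i) \<omega>) \<notin> Pi\<^sub>E {..<k} A"
          by (auto simp: PiE_iff intro!: bexI[of _ i])
        then show ?thesis by (metis ennreal_0 indicator_simps(2))
      qed (auto simp: PiE_iff)
      then show "indicator (EE k) \<omega> * (\<Sum>p\<in>?P. indicator (Pi\<^sub>E {..<k} A) (\<lambda>i\<in>{..<k}. ZZ (p i) \<omega>)) =
        ennreal (indicator (EE k) \<omega> * ?G \<omega>)"
        by (auto simp: indicator_def prod_nonneg intro!: sum_ennreal)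
    qed
    also have "(\<integral>\<^sup>+\<omega>. ennreal (indicator (EE k) \<omega> * ?G \<omega>) \<partial>M) = ennreal (\<integral>\<omega>. indicator (EE k) \<omega> * ?G \<omega> \<partial>M)"
    proof (rule nn_integral_eq_integral)
      have b: "norm (indicator (EE k) \<omega> * ?G \<omega>) \<le> real (card ?P)" for \<omega>
      proof -
        have "?G \<omega> \<le> (\<Sum>p\<in>?P. 1)" by (intro sum_mono prod_le_1) auto
        moreover have "0 \<le> ?G \<omega>" by (intro sum_nonneg prod_nonneg) auto
        ultimately show ?thesis by (auto simp: indicator_def)
      qed
      show "integrable M (\<lambda>\<omega>. indicator (EE k) \<omega> * ?G \<omega>)"
        by (rule integrable_const_bound[OF _ Gm]) (use b in blast)
    qed (use G0 in auto)
    also have "?e * \<dots> = ennreal (\<Prod>i<k. measure \<Lambda> (A i \<inter> B))"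
      by (subst expectation_permanent[OF pp sets_L B Bfin A])
        (auto simp: ennreal_mult[symmetric] prod_nonneg exp_minus)
    also have "\<dots> = (\<Prod>i<k. ennreal (measure \<Lambda> (A i \<inter> B)))"
      by (simp add: prod_ennreal)
    also have "\<dots> = (\<Prod>i<k. emeasure ?\<mu> (A i))"
    proof (rule prod.cong[OF refl])
      fix i assume "i \<in> {..<k}"
      then have Ai: "A i \<in> sets borel" using A by auto
      have "emeasure ?\<mu> (A i) = emeasure \<Lambda> (A i \<inter> B)"
        using Ai sets_L B by (simp add: emeasure_density indicator_inter_arith[symmetric] Int_commute)
      also have "\<dots> = ennreal (measure \<Lambda> (A i \<inter> B))"
        using fin_sub[OF pp sets_L B Bfin, of "A i \<inter> B"] Ai B by (simp add: emeasure_eq_ennreal_measure)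
      finally show "ennreal (measure \<Lambda> (A i \<inter> B)) = emeasure ?\<mu> (A i)" ..
    qed
    finally show "emeasure \<rho> (Pi\<^sub>E {..<k} A) = (\<Prod>i\<in>{..<k}. emeasure ?\<mu> (A i))" .
  qed (auto simp: \<rho>_def)
  from int[OF F, unfolded this]
  have "ennreal (exp (- measure \<Lambda> B)) * (\<integral>\<^sup>+x. F x \<partial>PiM {..<k} (\<lambda>_. ?\<mu>)) =
    (ennreal (exp (- measure \<Lambda> B)) * ?e) * (\<integral>\<^sup>+\<omega>. indicator (EE k) \<omega> * (\<Sum>p\<in>?P. F (\<lambda>i\<in>{..<k}. ZZ (p i) \<omega>)) \<partial>M)"
    by (simp add: mult.assoc)
  also have "ennreal (exp (- measure \<Lambda> B)) * ?e = 1"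
    by (simp add: ennreal_mult[symmetric] exp_minus)
  finally show ?thesis by (simp only: mult_1)
qed

text \<open>The Poisson probabilities of the finite counts already add up to
  \<open>1\<close>.\<close>

lemma AE_finite_idx: "AE \<omega> in M. finite (idx (\<eta> \<omega>) B)"
proof -
  interpret prob_space M by (rule prob_M[OF pp sets_L B Bfin])
  note [measurable] = En_sets[OF pp sets_L B Bfin]
  have P: "prob (EE k) = measure \<Lambda> B ^ k / fact k * exp (- measure \<Lambda> B)" for k
  proof -
    have "EE k = {\<omega>\<in>space M. num_points (\<eta> \<omega>) B = of_nat k}"
      by (auto simp: count_event_def num_points_eq_of_nat)
    then show ?thesis using poisson_processD(3)[OF pp, of B k] B Bfin sets_L by simp
  qed
  have "(\<lambda>k. prob (EE k)) sums prob (\<Union>k. EE k)"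
    by (rule finite_measure_UNION)
      (use En_sets[OF pp sets_L B Bfin] in \<open>auto simp: disjoint_family_on_def count_event_def\<close>)
  moreover have "(\<lambda>k. prob (EE k)) sums 1"
    using exp_series_sums[of "measure \<Lambda> B" "exp (- measure \<Lambda> B)"] by (simp add: P exp_minus)
  ultimately have "prob (\<Union>k. EE k) = 1" by (rule sums_unique2)
  then have "AE \<omega> in M. \<omega> \<in> (\<Union>k. EE k)" by (subst AE_in_set_eq_1) auto
  then show ?thesis by eventually_elim (auto simp: count_event_def)
qed

text \<open>A symmetric \<open>F\<close> takes the same value in all \<open>fact k\<close> orders of
  \<open>k\<close> points, so the symmetrised law determines its expectation, with the factor
  \<open>1 / fact k\<close>.\<close>

theorem Janossy:
  assumes F: "lmeas F" and sym: "\<And>xs ys. mset xs = mset ys \<Longrightarrow> F xs = F ys"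
  shows "(\<integral>\<^sup>+\<omega>. F (pts (\<eta> \<omega>) B) \<partial>M) = pois_avg (density \<Lambda> (indicator B)) (\<lambda>_. 1) F"
proof -
  interpret prob_space M by (rule prob_M[OF pp sets_L B Bfin])
  let ?\<mu> = "density \<Lambda> (indicator B)"
  interpret mu: finite_measure ?\<mu> by (rule restr_finite)
  note [measurable] = En_sets[OF pp sets_L B Bfin]
  have Fm [measurable]: "(\<lambda>\<omega>. F (pts (\<eta> \<omega>) B)) \<in> borel_measurable M"
    by (rule measurable_compose[OF eta_measurable[OF pp sets_L B Bfin] measurable_pts[OF B F]])
  have smu: "sets ?\<mu> = sets borel" by (simp add: sets_L)
  have k: "(\<integral>\<^sup>+\<omega>. indicator (EE k) \<omega> * F (pts (\<eta> \<omega>) B) \<partial>M) =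
    ennreal (exp (- measure \<Lambda> B)) * (lint ?\<mu> (\<lambda>_. 1) k F * ennreal (1 / fact k))" for k
  proof -
    let ?F = "\<lambda>x. F (map x (rev [0..<k]))"
    have m: "?F \<in> borel_measurable (PiM {..<k} (\<lambda>_. borel))"
      by (rule lmeasD'[OF F, where fs = "map (\<lambda>i x. x i) (rev [0..<k])"])
        (auto simp: comp_def intro!: measurable_component_singleton)
    have perm: "?F (\<lambda>i\<in>{..<k}. ZZ (p i) \<omega>) = F (pts (\<eta> \<omega>) B)" if "\<omega> \<in> EE k" "p permutes {..<k}" for \<omega> p
    proof (rule sym)
      have "mset (map (\<lambda>i\<in>{..<k}. ZZ (p i) \<omega>) (rev [0..<k])) = image_mset (\<lambda>i. ZZ (p i) \<omega>) (mset [0..<k])"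
        unfolding mset_map mset_rev by (rule image_mset_cong) auto
      also have "\<dots> = image_mset (\<lambda>j. ZZ j \<omega>) (image_mset p (mset_set {..<k}))"
        by (simp add: image_mset.compositionality comp_def atLeast0LessThan)
      also have "image_mset p (mset_set {..<k}) = mset_set {..<k}"
        using that(2) by (simp add: image_mset_mset_set permutes_inj_on permutes_image)
      also have "image_mset (\<lambda>j. ZZ j \<omega>) \<dots> = mset (pts (\<eta> \<omega>) B)"
        by (simp add: pts_Z[OF pp sets_L B Bfin that(1)] atLeast0LessThan)
      finally show "mset (map (\<lambda>i\<in>{..<k}. ZZ (p i) \<omega>) (rev [0..<k])) = mset (pts (\<eta> \<omega>) B)" .
    qed
    have c: "ennreal (fact k) * ennreal (1 / fact k) = 1"
      by (subst ennreal_mult[symmetric]) auto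
    have s1: "(\<integral>\<^sup>+\<omega>. indicator (EE k) \<omega> * (\<Sum>p | p permutes {..<k}. ?F (\<lambda>i\<in>{..<k}. ZZ (p i) \<omega>)) \<partial>M) =
      (\<integral>\<^sup>+\<omega>. ennreal (fact k) * (indicator (EE k) \<omega> * F (pts (\<eta> \<omega>) B)) \<partial>M)"
    proof (rule nn_integral_cong)
      fix \<omega>
      show "indicator (EE k) \<omega> * (\<Sum>p | p permutes {..<k}. ?F (\<lambda>i\<in>{..<k}. ZZ (p i) \<omega>)) =
        ennreal (fact k) * (indicator (EE k) \<omega> * F (pts (\<eta> \<omega>) B))"
      proof (cases "\<omega> \<in> EE k")
        case True
        have "(\<Sum>p | p permutes {..<k}. ?F (\<lambda>i\<in>{..<k}. ZZ (p i) \<omega>)) = of_nat (fact k) * F (pts (\<eta> \<omega>) B)"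
          using perm[OF True] by (simp add: card_permutations[of _ k])
        then show ?thesis using True by (simp add: ennreal_of_nat_eq_real_of_nat)
      qed simp
    qed
    have s2: "(\<integral>\<^sup>+\<omega>. ennreal (fact k) * (indicator (EE k) \<omega> * F (pts (\<eta> \<omega>) B)) \<partial>M) = ennreal (fact k) * (\<integral>\<^sup>+\<omega>. indicator (EE k) \<omega> * F (pts (\<eta> \<omega>) B) \<partial>M)"
      by (rule nn_integral_cmult) measurable
    have "(\<integral>\<^sup>+\<omega>. indicator (EE k) \<omega> * F (pts (\<eta> \<omega>) B) \<partial>M) =
      (ennreal (fact k) * ennreal (1 / fact k)) * (\<integral>\<^sup>+\<omega>. indicator (EE k) \<omega> * F (pts (\<eta> \<omega>) B) \<partial>M)"
      by (simp only: c mult_1)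
    also have "\<dots> = ennreal (1 / fact k) * (ennreal (fact k) * (\<integral>\<^sup>+\<omega>. indicator (EE k) \<omega> * F (pts (\<eta> \<omega>) B) \<partial>M))"
      by (simp only: ac_simps)
    also have "ennreal (fact k) * (\<integral>\<^sup>+\<omega>. indicator (EE k) \<omega> * F (pts (\<eta> \<omega>) B) \<partial>M) =
      ennreal (exp (- measure \<Lambda> B)) * lint ?\<mu> (\<lambda>_. 1) k F"
      unfolding s2[symmetric] s1[symmetric] symmetrized_law[OF m]
      by (simp only: nn_integral_PiM_lint[OF smu mu.sigma_finite_measure F])
    finally show ?thesis by (simp only: ac_simps)
  qed
  have "(\<integral>\<^sup>+\<omega>. F (pts (\<eta> \<omega>) B) \<partial>M) = (\<integral>\<^sup>+\<omega>. (\<Sum>k. indicator (EE k) \<omega> * F (pts (\<eta> \<omega>) B)) \<partial>M)"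
  proof (rule nn_integral_cong_AE)
    show "AE \<omega> in M. F (pts (\<eta> \<omega>) B) = (\<Sum>k. indicator (EE k) \<omega> * F (pts (\<eta> \<omega>) B))"
      using AE_finite_idx AE_space
    proof eventually_elim
      case (elim \<omega>)
      have "(\<Sum>k. indicator (EE k) \<omega> * F (pts (\<eta> \<omega>) B)) =
        (\<Sum>k\<in>{card (idx (\<eta> \<omega>) B)}. indicator (EE k) \<omega> * F (pts (\<eta> \<omega>) B))"
        by (rule suminf_finite) (auto simp: count_event_def)
      then show ?case using elim by (simp add: count_event_def)
    qed
  qed
  also have "\<dots> = (\<Sum>k. \<integral>\<^sup>+\<omega>. indicator (EE k) \<omega> * F (pts (\<eta> \<omega>) B) \<partial>M)"
    by (rule nn_integral_suminf) measurable
  also have "\<dots> = ennreal (exp (- measure \<Lambda> B)) * (\<Sum>k. lint ?\<mu> (\<lambda>_. 1) k F * ennreal (1 / fact k))"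
    by (simp only: k ennreal_suminf_cmult)
  also have "measure \<Lambda> B = enn2real (\<integral>\<^sup>+x. 1 \<partial>?\<mu>)"
    using sets_L B by (simp add: measure_def emeasure_density sets_eq_imp_space_eq[OF sets_L])
  finally show ?thesis by (simp add: pois_avg_def)
qed

end

section \<open>The cluster in a bounded region\<close>

lemma density_scale_measure:
  assumes [measurable]: "f \<in> borel_measurable M"
  shows "density (scale_measure r M) f = density M (\<lambda>x. r * f x)"
proof (rule measure_eqI)
  fix A assume "A \<in> sets (density (scale_measure r M) f)"
  then have [measurable]: "A \<in> sets M" by simp
  show "emeasure (density (scale_measure r M) f) A = emeasure (density M (\<lambda>x. r * f x)) A"
    by (simp add: emeasure_density nn_integral_scale_measure nn_integral_cmult mult.assoc)
qed simp

context
  fixes \<nu> :: "'a::second_countable_topology measure"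
  assumes sets_nu [measurable_cong]: "sets \<nu> = sets borel" and sf: "sigma_finite_measure \<nu>"
begin

lemma lint_density:
  assumes [measurable]: "h \<in> borel_measurable borel" and "lmeas F"
  shows "lint (density \<nu> h) (\<lambda>_. 1) k F = lint \<nu> h k F"
  using assms(2)
proof (induction k arbitrary: F)
  case (Suc k)
  note [measurable] = measurable_lint_Cons[OF sets_nu sf assms(1) Suc.prems]
  show ?case using Suc by (simp add: lmeas_Cons nn_integral_density)
qed simp

lemma pois_avg_density:
  assumes [measurable]: "h \<in> borel_measurable borel" and "lmeas F"
  shows "pois_avg (density \<nu> h) (\<lambda>_. 1) F = pois_avg \<nu> h F"
proof -
  have "(\<integral>\<^sup>+x. 1 \<partial>density \<nu> h) = (\<integral>\<^sup>+x. h x \<partial>\<nu>)"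
    by (subst nn_integral_density) auto
  then show ?thesis by (simp only: pois_avg_def lint_density[OF assms])
qed

lemma Janossy_scale:
  assumes pp: "poisson_process M (scale_measure r \<nu>) \<eta>" and B [measurable]: "B \<in> sets borel"
    and "emeasure \<nu> B < \<infinity>" "r < \<infinity>"
    and F: "lmeas F" and sym: "\<And>xs ys. mset xs = mset ys \<Longrightarrow> F xs = F ys"
  shows "(\<integral>\<^sup>+\<omega>. F (pts (\<eta> \<omega>) B) \<partial>M) = pois_avg \<nu> (\<lambda>x. r * indicator B x) F"
proof -
  have "(\<integral>\<^sup>+\<omega>. F (pts (\<eta> \<omega>) B) \<partial>M) = pois_avg (density (scale_measure r \<nu>) (indicator B)) (\<lambda>_. 1) F"
    by (rule Janossy[OF pp _ B _ F sym]) (use assms(3,4) in \<open>auto simp: sets_nu ennreal_mult_less_top\<close>)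
  also have "density (scale_measure r \<nu>) (indicator B) = density \<nu> (\<lambda>x. r * indicator B x)"
    by (rule density_scale_measure) measurable
  finally show ?thesis by (simp add: pois_avg_density[OF _ F])
qed

end

section \<open>Measurable relations and almost sure distinctness of the points\<close>

lemma borel_pred_eq:
  fixes f g :: "'b \<Rightarrow> 'a::{metric_space, second_countable_topology}"
  assumes [measurable]: "f \<in> borel_measurable M" "g \<in> borel_measurable M"
  shows "Measurable.pred M (\<lambda>x. f x = g x)"
proof -
  have "(\<lambda>x. f x = g x) = (\<lambda>x. dist (f x) (g x) = 0)" by simp
  then show ?thesis by simp
qed

text \<open>With countably many vertices, connectedness is a countable union over lengths of paths
  and intermediate vertices. This is a reason to work with indices instead of points.\<close>

lemma pred_rtranclp:
  fixes E :: "'b \<Rightarrow> 'c::countable \<Rightarrow> 'c \<Rightarrow> bool"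
  assumes [measurable]: "\<And>a b. Measurable.pred M (\<lambda>\<omega>. E \<omega> a b)"
  shows "Measurable.pred M (\<lambda>\<omega>. (E \<omega>)\<^sup>*\<^sup>* a b)"
proof -
  have [measurable]: "Measurable.pred M (\<lambda>\<omega>. ((E \<omega>) ^^ n) a b)" for n b
  proof (induction n arbitrary: b)
    case (Suc n)
    note [measurable] = Suc
    show ?case by (simp add: relcompp_apply)
  qed simp
  show ?thesis by (simp add: rtranclp_is_Sup_relpowp)
qed

lemma lmeas_not_distinct:
  "lmeas (\<lambda>xs :: 'a::{metric_space, second_countable_topology} list. indicator {xs. \<not> distinct xs} xs)"
  unfolding lmeas_def
proof
  fix k
  have *: "Measurable.pred (PiM UNIV (\<lambda>_. borel)) (\<lambda>x :: nat \<Rightarrow> 'a. \<forall>i<k. \<forall>j<k. x i = x j \<longrightarrow> i = j)"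
  proof -
    have "Measurable.pred (PiM UNIV (\<lambda>_. borel)) (\<lambda>x :: nat \<Rightarrow> 'a. x i = x j)" for i j
      by (rule borel_pred_eq) (rule measurable_PiM_UNIV_component)+
    then show ?thesis
      unfolding pred_def
      by (intro sets.sets_Collect_countable_All sets.sets_Collect_imp sets.sets_Collect_const)
  qed
  have eq: "distinct (map x [0..<k]) \<longleftrightarrow> (\<forall>i<k. \<forall>j<k. x i = x j \<longrightarrow> i = j)" for x :: "nat \<Rightarrow> 'a"
    by (auto simp: distinct_map inj_on_def)
  have [measurable]: "Measurable.pred (PiM UNIV (\<lambda>_. borel)) (\<lambda>x :: nat \<Rightarrow> 'a. distinct (map x [0..<k]))"
    unfolding eq by (rule *)
  have "(\<lambda>x :: nat \<Rightarrow> 'a. indicator {xs. \<not> distinct xs} (map x [0..<k]) :: ennreal) =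
     indicator {x. \<not> distinct (map x [0..<k])}"
    by (auto simp: indicator_def)
  then show "(\<lambda>x :: nat \<Rightarrow> 'a. indicator {xs. \<not> distinct xs} (map x [0..<k]) :: ennreal) \<in>
     borel_measurable (PiM UNIV (\<lambda>_. borel))"
    by simp
qed

lemma pois_avg_eq_0D:
  assumes "pois_avg \<nu> h F = 0"
  shows "lint \<nu> h k F = 0"
proof -
  have "(\<Sum>k. lint \<nu> h k F * ennreal (1 / fact k)) = 0"
    using assms by (simp add: pois_avg_def)
  then have "lint \<nu> h k F * ennreal (1 / fact k) = 0"
    by (simp add: suminf_eq_zero_iff)
  then show ?thesis by simp
qed

text \<open>A list repeats an entry if its head \<open>x\<close> occurs in the tail or the tail
  repeats an entry. Occurrences of \<open>x\<close> are counted by sums of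
  \<open>indicator {x}\<close>, and their Poisson average is \<open>0\<close> by Campbell's formula
  and diffuseness.\<close>

lemma lint_not_distinct:
  fixes \<nu> :: "'a::{metric_space, second_countable_topology} measure"
  assumes sets_nu: "sets \<nu> = sets borel" and sf: "sigma_finite_measure \<nu>"
    and diffuse: "\<And>x. emeasure \<nu> {x} = 0"
    and h [measurable]: "h \<in> borel_measurable borel" and fin: "(\<integral>\<^sup>+x. h x \<partial>\<nu>) < \<infinity>"
  shows "lint \<nu> h k (indicator {xs. \<not> distinct xs}) = 0"
proof (induction k)
  case (Suc k)
  note [measurable_cong] = sets_nu
  have "lint \<nu> h k (\<lambda>xs. indicator {xs. \<not> distinct xs} (x # xs)) = 0" for x
  proof -
    have e: "indicator {x} \<in> borel_measurable (borel :: 'a measure)" by simp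
    have "pois_avg \<nu> h (\<lambda>Y. \<Sum>y\<leftarrow>Y. indicator {x} y) = (\<integral>\<^sup>+y. h y * indicator {x} y \<partial>\<nu>)"
      by (rule pois_avg_sum_list[OF sets_nu sf h fin e])
    also have "\<dots> = 0"
      using AE_not_in[of "{x}" \<nu>] diffuse[of x] sets_nu
      by (subst nn_integral_0_iff_AE) (auto simp: null_sets_def elim!: eventually_mono)
    finally have 0: "lint \<nu> h k (\<lambda>Y. \<Sum>y\<leftarrow>Y. indicator {x} y) = 0" by (rule pois_avg_eq_0D)
    have "indicator {xs. \<not> distinct xs} (x # xs) \<le> (\<Sum>y\<leftarrow>xs. indicator {x} y) + (indicator {xs. \<not> distinct xs} xs :: ennreal)" for xs
    proof (cases "x \<in> set xs")
      case True
      then have "1 \<le> (\<Sum>y\<leftarrow>xs. indicator {x} y :: ennreal)"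
        by (induction xs) (auto simp: add_increasing2 add_increasing)
      moreover have "indicator {xs. \<not> distinct xs} (x # xs) \<le> (1::ennreal)" by (simp add: indicator_def)
      ultimately show ?thesis by (meson add_increasing2 order.trans zero_le)
    qed (auto simp: indicator_def)
    then have "lint \<nu> h k (\<lambda>xs. indicator {xs. \<not> distinct xs} (x # xs)) \<le>
      lint \<nu> h k (\<lambda>xs. (\<Sum>y\<leftarrow>xs. indicator {x} y) + indicator {xs. \<not> distinct xs} xs)"
      by (intro lint_mono[of UNIV]) auto
    also have "\<dots> = 0"
      by (subst lint_add[OF sets_nu sf h lmeas_sum_list[OF sets_nu sf h fin e] lmeas_not_distinct]) (simp add: 0 Suc)
    finally show ?thesis by simp
  qed
  then show ?case by simp
qed simp

context
  fixes M :: "'w measure" and \<Lambda> :: "'a::{metric_space, second_countable_topology} measure" and \<eta> :: "'w \<Rightarrow> 'a config"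
  assumes pp: "poisson_process M \<Lambda> \<eta>" and sets_L: "sets \<Lambda> = sets borel"
begin

lemma AE_no_points:
  assumes N: "N \<in> sets borel" "emeasure \<Lambda> N = 0"
  shows "AE \<omega> in M. idx (\<eta> \<omega>) N = {}"
proof -
  interpret prob_space M by (rule poisson_processD[OF pp])
  have [measurable]: "\<eta> \<in> M \<rightarrow>\<^sub>M config_algebra" by (rule poisson_processD[OF pp])
  note [measurable] = measurable_num_points[OF N(1)]
  have "prob {\<omega>\<in>space M. num_points (\<eta> \<omega>) N = of_nat 0} = 1"
  proof -
    have "N \<in> sets \<Lambda>" using N sets_L by simp
    then have "prob {\<omega>\<in>space M. num_points (\<eta> \<omega>) N = of_nat 0} =
       (if emeasure \<Lambda> N = \<infinity> then 0 else measure \<Lambda> N ^ 0 / fact 0 * exp (- measure \<Lambda> N))"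
      by (rule poisson_processD(3)[OF pp])
    then show ?thesis using N by (simp add: measure_def)
  qed
  then have "AE \<omega> in M. \<omega> \<in> {\<omega>\<in>space M. num_points (\<eta> \<omega>) N = of_nat 0}"
    by (subst AE_in_set_eq_1) measurable
  then show ?thesis by eventually_elim (auto simp: num_points_idx split: if_splits)
qed

text \<open>Distinctness does not depend on the order of a list, so \<open>Janossy\<close> applies
  to its indicator.\<close>

lemma AE_distinct_pts:
  assumes B [measurable]: "B \<in> sets borel" "emeasure \<Lambda> B < \<infinity>" and diffuse: "\<And>x. emeasure \<Lambda> {x} = 0"
  shows "AE \<omega> in M. distinct (pts (\<eta> \<omega>) B)"
proof -
  let ?\<mu> = "density \<Lambda> (indicator B)"
  interpret mu: finite_measure ?\<mu> by (rule restr_finite[OF pp sets_L B])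
  have smu: "sets ?\<mu> = sets borel" by (simp add: sets_L)
  have eta: "\<eta> \<in> M \<rightarrow>\<^sub>M config_algebra" by (rule poisson_processD[OF pp])
  let ?F = "indicator {xs :: 'a list. \<not> distinct xs} :: _ \<Rightarrow> ennreal"
  have d: "emeasure ?\<mu> {x} = 0" for x
    using diffuse[of x] sets_L B emeasure_mono[of "{x} \<inter> B" "{x}" \<Lambda>]
    by (simp add: emeasure_density indicator_inter_arith[symmetric] Int_commute)
  have fin: "(\<integral>\<^sup>+x. 1 \<partial>?\<mu>) < \<infinity>"
    using mu.emeasure_finite by (simp add: less_top[symmetric])
  have "lint ?\<mu> (\<lambda>_. 1) k ?F = 0" for k
    by (rule lint_not_distinct[OF smu mu.sigma_finite_measure d _ fin]) simp
  then have "(\<integral>\<^sup>+\<omega>. ?F (pts (\<eta> \<omega>) B) \<partial>M) = 0"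
    by (subst Janossy[OF pp sets_L B lmeas_not_distinct])
      (auto simp: pois_avg_def indicator_def dest: mset_eq_imp_distinct_iff)
  moreover have "(\<lambda>\<omega>. ?F (pts (\<eta> \<omega>) B)) \<in> borel_measurable M"
    by (rule measurable_compose[OF eta measurable_pts[OF B(1) lmeas_not_distinct]])
  ultimately have "AE \<omega> in M. ?F (pts (\<eta> \<omega>) B) = 0"
    by (subst (asm) nn_integral_0_iff_AE)
  then show ?thesis by eventually_elim (auto simp: indicator_def split: if_splits)
qed

end

section \<open>The component of the added point inside a region\<close>

lemma snd_add_point [simp]:
  "snd (add_point v c) 0 = v" "snd (add_point v c) (Suc n) = snd c n"
  by (simp_all add: add_point_def)

lemma less_fst_add_point [simp]:
  "enat 0 < fst (add_point v c)" "enat (Suc n) < fst (add_point v c) \<longleftrightarrow> enat n < fst c"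
  by (simp_all add: add_point_def enat_0 flip: eSuc_enat)

lemma idx_add_point: "idx (add_point v c) B - {0} = Suc ` idx c B"
proof (rule set_eqI)
  fix n show "n \<in> idx (add_point v c) B - {0} \<longleftrightarrow> n \<in> Suc ` idx c B"
    by (cases n) (auto simp: idx_def)
qed

text \<open>The indices of the points connected to the point with index \<open>0\<close> by paths in \<open>B\<close>.\<close>

definition bcomp :: "('a \<Rightarrow> 'a \<Rightarrow> real) \<Rightarrow> 'a set \<Rightarrow> 'a config \<Rightarrow> (nat \<times> nat \<Rightarrow> real) \<Rightarrow> nat set" where
  "bcomp \<phi> B c u = reach \<phi> (snd c) u {0} (idx c B - {0})"

text \<open>A series over all indices, so that it is measurable and increasing in \<open>B\<close>
  without any finiteness of the configuration.\<close>

definition bsum :: "('a \<Rightarrow> ennreal) \<Rightarrow> ('a \<Rightarrow> 'a \<Rightarrow> real) \<Rightarrow> 'a set \<Rightarrow> 'a config \<Rightarrow> (nat \<times> nat \<Rightarrow> real) \<Rightarrow> ennreal" where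
  "bsum f \<phi> B c u = (\<Sum>i. f (snd c i) * indicator (bcomp \<phi> B c u) i)"

lemma measurable_phi_comp:
  assumes "case_prod \<phi> \<in> borel_measurable (borel \<Otimes>\<^sub>M borel)" "f \<in> M \<rightarrow>\<^sub>M borel" "g \<in> M \<rightarrow>\<^sub>M borel"
  shows "(\<lambda>\<omega>. \<phi> (f \<omega>) (g \<omega>)) \<in> borel_measurable M"
  using measurable_compose[OF measurable_Pair[OF assms(2,3)] assms(1)] by simp

lemma measurable_bsum:
  assumes \<phi>: "case_prod \<phi> \<in> borel_measurable (borel \<Otimes>\<^sub>M borel)" and B: "B \<in> sets borel"
    and f: "f \<in> borel_measurable borel"
  shows "(\<lambda>(c, u). bsum f \<phi> B c u) \<in> borel_measurable (config_algebra \<Otimes>\<^sub>M PiM UNIV (\<lambda>_. borel))"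
proof -
  let ?M = "config_algebra \<Otimes>\<^sub>M PiM UNIV (\<lambda>_. borel) :: ('a config \<times> (nat \<times> nat \<Rightarrow> real)) measure"
  have x [measurable]: "(\<lambda>z. snd (fst z) i) \<in> ?M \<rightarrow>\<^sub>M borel" for i
    by (rule measurable_compose[OF measurable_fst measurable_snd_config])
  have u [measurable]: "(\<lambda>z. snd z e) \<in> ?M \<rightarrow>\<^sub>M borel" for e
    by (rule measurable_compose[OF measurable_snd measurable_PiM_UNIV_component])
  have [measurable]: "(\<lambda>z. \<phi> (snd (fst z) a) (snd (fst z) b)) \<in> borel_measurable ?M" for a b
    by (rule measurable_phi_comp[OF \<phi> x x])
  have [measurable]: "(\<lambda>z. f (snd (fst z) i)) \<in> borel_measurable ?M" for i
    by (rule measurable_compose[OF x f])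
  have [measurable]: "Measurable.pred ?M (\<lambda>z. n \<in> idx (fst z) B)" for n
    by (rule measurable_compose[OF measurable_fst measurable_idx[OF B]])
  have "Measurable.pred ?M (\<lambda>z. (\<lambda>a b. b \<in> idx (fst z) B - {0} \<and> iadj \<phi> (snd (fst z)) (snd z) a b)\<^sup>*\<^sup>* 0 i)" for i
    by (rule pred_rtranclp) (simp add: iadj_def)
  then have [measurable]: "Measurable.pred ?M (\<lambda>z. i \<in> bcomp \<phi> B (fst z) (snd z))" for i
    by (simp add: bcomp_def reach_def)
  have "(\<lambda>z. \<Sum>i. f (snd (fst z) i) * (if i \<in> bcomp \<phi> B (fst z) (snd z) then 1 else 0)) \<in> borel_measurable ?M"
    by measurable
  then show ?thesis by (simp add: bsum_def split_beta' indicator_def of_bool_def)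
qed

lemma finite_bcomp: "finite (idx c B) \<Longrightarrow> finite (bcomp \<phi> B c u)"
  unfolding bcomp_def by (rule finite_subset[OF reach_subset]) auto

lemma bsum_finite:
  assumes "finite (idx c B)"
  shows "bsum f \<phi> B c u = (\<Sum>i\<in>bcomp \<phi> B c u. f (snd c i))"
proof -
  have "bsum f \<phi> B c u = (\<Sum>i\<in>bcomp \<phi> B c u. f (snd c i) * indicator (bcomp \<phi> B c u) i)"
    unfolding bsum_def by (rule suminf_finite[OF finite_bcomp[OF assms]]) auto
  then show ?thesis by simp
qed

lemma nn_integral_bsum_unif:
  assumes \<phi>: "\<And>a b. 0 \<le> \<phi> a b \<and> \<phi> a b \<le> (1::real)" and fin: "finite (idx c B)"
  shows "(\<integral>\<^sup>+u. bsum f \<phi> B (add_point v c) u \<partial>unif) =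
    explore (\<lambda>a b. ennreal (\<phi> a b)) (\<lambda>_ _ y. f y) (Suc (length (pts c B))) [(v, f v)] (pts c B)"
proof -
  let ?X = "map Suc (sorted_list_of_set (idx c B))"
  have fin': "finite (idx (add_point v c) B)"
    using fin idx_add_point[of v c B] by (metis finite_Diff_insert finite.emptyI finite_Diff2 finite_imageI finite_insert)
  have "(\<integral>\<^sup>+u. bsum f \<phi> B (add_point v c) u \<partial>unif) =
    (\<integral>\<^sup>+u. (\<Sum>i\<in>reach \<phi> (snd (add_point v c)) u (set [0]) (set ?X). f (snd (add_point v c) i)) \<partial>unif)"
    using fin by (simp add: bsum_finite[OF fin'] bcomp_def idx_add_point)
  also have "\<dots> = explore (\<lambda>a b. ennreal (\<phi> a b)) (\<lambda>_ _ y. f y) (Suc (length (pts c B)))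
      (map (\<lambda>i. (snd (add_point v c) i, f (snd (add_point v c) i))) [0]) (map (snd (add_point v c)) ?X)"
    by (rule nn_integral_reach[OF \<phi>]) (auto simp: pts_def distinct_map)
  finally show ?thesis by (simp add: pts_def comp_def)
qed

lemma lmeas_length:
  assumes "\<And>n. lmeas (F n)"
  shows "lmeas (\<lambda>X. F (Suc (length X)) X)"
  using assms by (simp add: lmeas_def)

text \<open>The marks are independent of the points and are integrated first, which gives the
  complete exploration: \<open>Suc (length X)\<close> steps suffice for the points of
  \<open>X\<close> and the root. Being symmetric, it can then be averaged by
  \<open>Janossy_scale\<close>.\<close>

lemma nn_integral_bsum:
  fixes \<nu> :: "'a::{metric_space, second_countable_topology} measure"
  assumes sets_nu: "sets \<nu> = sets borel" and sf: "sigma_finite_measure \<nu>"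
    and \<phi>: "\<And>a b. 0 \<le> \<phi> a b \<and> \<phi> a b \<le> (1::real)"
    and \<phi>m: "case_prod \<phi> \<in> borel_measurable (borel \<Otimes>\<^sub>M borel)"
    and f: "f \<in> borel_measurable borel"
    and pp: "poisson_process M (scale_measure r \<nu>) \<eta>" and "r < \<infinity>"
    and marks: "rcm_marks M (\<lambda>\<omega>. add_point v (\<eta> \<omega>)) U"
    and B: "B \<in> sets borel" "emeasure \<nu> B < \<infinity>"
  shows "(\<integral>\<^sup>+\<omega>. bsum f \<phi> B (add_point v (\<eta> \<omega>)) (U \<omega>) \<partial>M) =
    pois_avg \<nu> (\<lambda>x. r * indicator B x)
      (\<lambda>X. explore (\<lambda>a b. ennreal (\<phi> a b)) (\<lambda>_ _ y. f y) (Suc (length X)) [(v, f v)] X)"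
proof -
  let ?\<xi> = "\<lambda>\<omega>. add_point v (\<eta> \<omega>)"
  let ?G = "\<lambda>(c, u). bsum f \<phi> B c u"
  let ?F = "\<lambda>X. explore (\<lambda>a b. ennreal (\<phi> a b)) (\<lambda>_ _ y. f y) (Suc (length X)) [(v, f v)] X"
  have xi [measurable]: "?\<xi> \<in> M \<rightarrow>\<^sub>M config_algebra" and U [measurable]: "U \<in> M \<rightarrow>\<^sub>M PiM UNIV (\<lambda>_. borel)"
    and eq: "distr M (config_algebra \<Otimes>\<^sub>M PiM UNIV (\<lambda>_. borel)) (\<lambda>\<omega>. (?\<xi> \<omega>, U \<omega>)) =
       distr M config_algebra ?\<xi> \<Otimes>\<^sub>M unif"
    using marks by (auto simp: rcm_marks_def)
  note G = measurable_bsum[OF \<phi>m B(1) f]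
  interpret u: prob_space unif by (rule prob_space_unif)
  have G': "?G \<in> borel_measurable (distr M config_algebra ?\<xi> \<Otimes>\<^sub>M unif)"
    using G by (simp cong: measurable_cong_sets add: sets_pair_measure_cong[OF sets_distr sets_unif])
  have "(\<integral>\<^sup>+\<omega>. bsum f \<phi> B (?\<xi> \<omega>) (U \<omega>) \<partial>M) =
    (\<integral>\<^sup>+z. ?G z \<partial>distr M (config_algebra \<Otimes>\<^sub>M PiM UNIV (\<lambda>_. borel)) (\<lambda>\<omega>. (?\<xi> \<omega>, U \<omega>)))"
    by (subst nn_integral_distr) (use G in auto)
  also have "\<dots> = (\<integral>\<^sup>+c. \<integral>\<^sup>+w. ?G (c, w) \<partial>unif \<partial>distr M config_algebra ?\<xi>)"
    unfolding eq by (rule u.nn_integral_fst[OF G', symmetric])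
  also have "\<dots> = (\<integral>\<^sup>+\<omega>. \<integral>\<^sup>+w. ?G (?\<xi> \<omega>, w) \<partial>unif \<partial>M)"
  proof (rule nn_integral_distr[OF xi])
    have "(\<lambda>c. \<integral>\<^sup>+w. ?G (c, w) \<partial>unif) \<in> borel_measurable (distr M config_algebra ?\<xi>)"
      by (rule u.borel_measurable_nn_integral_fst[OF G'])
    then show "(\<lambda>c. \<integral>\<^sup>+w. ?G (c, w) \<partial>unif) \<in> borel_measurable (distr M config_algebra ?\<xi>)" .
  qed
  also have "\<dots> = (\<integral>\<^sup>+\<omega>. ?F (pts (\<eta> \<omega>) B) \<partial>M)"
  proof (rule nn_integral_cong_AE)
    have "AE \<omega> in M. finite (idx (\<eta> \<omega>) B)"
      by (rule AE_finite_idx[OF pp _ B(1)]) (use B \<open>r < \<infinity>\<close> sets_nu in \<open>auto simp: ennreal_mult_less_top\<close>)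
    then show "AE \<omega> in M. (\<integral>\<^sup>+w. ?G (?\<xi> \<omega>, w) \<partial>unif) = ?F (pts (\<eta> \<omega>) B)"
      by eventually_elim (simp only: split nn_integral_bsum_unif[OF \<phi>])
  qed
  also have "\<dots> = pois_avg \<nu> (\<lambda>x. r * indicator B x) ?F"
  proof (rule Janossy_scale[OF sets_nu sf pp B \<open>r < \<infinity>\<close>])
    have "case_prod (\<lambda>a b. ennreal (\<phi> a b)) \<in> borel_measurable (borel \<Otimes>\<^sub>M borel)"
      using measurable_compose[OF \<phi>m measurable_ennreal] by (simp add: split_beta')
    moreover have "(\<lambda>(w::'a, c::ennreal, y). f y) \<in> borel_measurable (borel \<Otimes>\<^sub>M borel \<Otimes>\<^sub>M borel)"
      using measurable_compose[OF measurable_compose[OF measurable_snd measurable_snd] f] by (simp add: split_beta')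
    ultimately show "lmeas ?F"
      by (intro lmeas_length[where F = "\<lambda>n. explore (\<lambda>a b. ennreal (\<phi> a b)) (\<lambda>_ _ y. f y) n [(v, f v)]"] lmeas_explore)
  next
    fix xs ys :: "'a list" assume m: "mset xs = mset ys"
    then have "length xs = length ys" by (rule mset_eq_length)
    then show "?F xs = ?F ys" using explore_perm[OF \<phi> m, where n = "Suc (length ys)" and f = f and v = v] by simp
  qed
  finally show ?thesis .
qed

section \<open>Exponential moments in bounded regions\<close>

lemma thin_const: "(\<And>x. g x \<le> 1) \<Longrightarrow> thin g X (\<lambda>_ _. c) = c"
proof (induction X)
  case (Cons x X)
  then show ?case by (simp flip: distrib_right) (metis ennreal_add_1_minus mult_1)
qed simp

lemma thin_mono_length:
  assumes "\<And>Y Z. length Y \<le> length X \<Longrightarrow> H Y Z \<le> K Y Z"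
  shows "thin g X H \<le> thin g X K"
  using assms
proof (induction X arbitrary: H K)
  case (Cons x X)
  have "thin g X (\<lambda>Y Z. H (x # Y) Z) \<le> thin g X (\<lambda>Y Z. K (x # Y) Z)"
    "thin g X (\<lambda>Y Z. H Y (x # Z)) \<le> thin g X (\<lambda>Y Z. K Y (x # Z))"
    by (rule Cons.IH, rule Cons.prems, simp)+
  then show ?case by (auto intro!: add_mono mult_left_mono)
qed simp

text \<open>A step on a nonempty list counts one point and shortens the list by at most one entry;
  new neighbours only prolong it.\<close>

lemma explore_kone_ge:
  assumes "\<And>x y. \<phi> x y \<le> 1"
  shows "of_nat (min n (length L)) \<le> explore \<phi> kone n (map (\<lambda>w. (w, 1)) L) X"
proof (induction n arbitrary: L X)
  case (Suc n)
  show ?case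
  proof (cases L)
    case (Cons w L')
    have "of_nat (min n (length L')) = thin (\<phi> w) X (\<lambda>_ _. of_nat (min n (length L')))"
      using assms by (simp add: thin_const)
    also have "\<dots> \<le> thin (\<phi> w) X (\<lambda>Y Z. explore \<phi> kone n (map (\<lambda>y. (y, 1)) Y @ map (\<lambda>w. (w, 1)) L') Z)"
    proof (rule thin_mono)
      fix Y Z
      have "of_nat (min n (length L')) \<le> (of_nat (min n (length (Y @ L'))) :: ennreal)"
        by (intro of_nat_mono) auto
      then show "of_nat (min n (length L')) \<le> explore \<phi> kone n (map (\<lambda>y. (y, 1)) Y @ map (\<lambda>w. (w, 1)) L') Z"
        using Suc[of "Y @ L'" Z, unfolded map_append] by (rule order.trans)
    qed
    finally show ?thesis by (simp add: Cons add_left_mono)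
  qed simp
qed simp

text \<open>Along a tree path the product of the factors \<open>E\<close> dominates
  \<open>f\<close>. For \<open>f = wexp \<delta> v\<close> and \<open>E = wexp \<delta>\<close> the
  hypothesis is the triangle inequality. On the left each listed weight is exactly \<open>f\<close>
  of its point; on the right it is at least that.\<close>

lemma explore_le_scale:
  fixes f :: "'a \<Rightarrow> ennreal"
  assumes f: "\<And>w y. f y \<le> f w * E w y"
    and "list_all2 (\<lambda>p q. fst p = fst q \<and> snd p = f (fst p) \<and> snd p \<le> snd q) L L'"
  shows "explore \<phi> (\<lambda>_ _ y. f y) n L X \<le> explore \<phi> (kscale E) n L' X"
  using assms(2)
proof (induction n arbitrary: L L' X)
  case (Suc n)
  show ?case
  proof (cases L)
    case Nil
    then show ?thesis by simp
  next
    case (Cons p L1)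
    then obtain q L2 where L': "L' = q # L2" and pq: "fst p = fst q" "snd p = f (fst p)" "snd p \<le> snd q"
      and L12: "list_all2 (\<lambda>p q. fst p = fst q \<and> snd p = f (fst p) \<and> snd p \<le> snd q) L1 L2"
      using Suc.prems by (auto simp: list_all2_Cons1)
    have "f y \<le> snd q * E (fst p) y" for y
      using f[of y "fst p"] mult_right_mono[OF pq(3), of "E (fst p) y"] pq(2) by (simp add: order.trans)
    then have "explore \<phi> (\<lambda>_ _ y. f y) n (map (\<lambda>y. (y, f y)) Y @ L1) Z \<le>
       explore \<phi> (kscale E) n (map (\<lambda>y. (y, snd q * E (fst q) y)) Y @ L2) Z" for Y Z
      using L12 pq by (intro Suc.IH list_all2_appendI) (auto simp: list_all2_map1 list_all2_map2 list_all2_same)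
    then show ?thesis
      unfolding Cons L' using pq by (auto intro!: add_mono thin_mono)
  qed
qed simp

text \<open>Removes the cut-off. In the terms \<open>k < K\<close> of the series,
  \<open>Suc k\<close> steps are at most \<open>K\<close> steps, so each partial sum is bounded by
  the average of the single function \<open>F K\<close>.\<close>

lemma pois_avg_length_le:
  assumes "\<And>n. pois_avg \<nu> h (F n) \<le> C" "\<And>n X. F n X \<le> F (Suc n) X"
  shows "pois_avg \<nu> h (\<lambda>X. F (Suc (length X)) X) \<le> C"
proof -
  let ?e = "ennreal (exp (- enn2real (\<integral>\<^sup>+x. h x \<partial>\<nu>)))"
  have mono: "F n X \<le> F m X" if "n \<le> m" for n m X
    using that assms(2) by (rule lift_Suc_mono_le[of "\<lambda>n. F n X", rotated])
  have "?e * (\<Sum>k<K. lint \<nu> h k (\<lambda>X. F (Suc (length X)) X) * ennreal (1 / fact k)) \<le> C" for K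
  proof -
    have "(\<Sum>k<K. lint \<nu> h k (\<lambda>X. F (Suc (length X)) X) * ennreal (1 / fact k)) \<le>
      (\<Sum>k<K. lint \<nu> h k (F K) * ennreal (1 / fact k))"
      by (intro sum_mono mult_right_mono lint_mono[of UNIV] mono) auto
    also have "\<dots> \<le> (\<Sum>k. lint \<nu> h k (F K) * ennreal (1 / fact k))"
      by (rule sum_le_suminf) auto
    finally have "?e * (\<Sum>k<K. lint \<nu> h k (\<lambda>X. F (Suc (length X)) X) * ennreal (1 / fact k)) \<le> pois_avg \<nu> h (F K)"
      unfolding pois_avg_def by (intro mult_left_mono) auto
    then show ?thesis using assms(1) by (rule order.trans)
  qed
  then have "(SUP K. ?e * (\<Sum>k<K. lint \<nu> h k (\<lambda>X. F (Suc (length X)) X) * ennreal (1 / fact k))) \<le> C"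
    by (rule SUP_least)
  then show ?thesis
    unfolding pois_avg_def suminf_eq_SUP by (simp add: SUP_mult_left_ennreal)
qed

text \<open>The expected sum of \<open>f\<close> over the component of \<open>v\<close>, given the points \<open>X\<close>.\<close>

abbreviation (input) "full \<phi> f v X \<equiv>
  explore (\<lambda>a b. ennreal (\<phi> a b)) (\<lambda>_ _ y. f y) (Suc (length X)) [(v, f v)] X"

lemma explore_le_full:
  assumes \<phi>: "\<And>a b. 0 \<le> \<phi> a b \<and> \<phi> a b \<le> (1::real)"
  shows "explore (\<lambda>a b. ennreal (\<phi> a b)) (\<lambda>_ _ y. f y) n [(v, f v)] X \<le> full \<phi> f v X"
proof -
  let ?x = "\<lambda>i. (v # X) ! i" and ?I = "[1..<Suc (length X)]"
  have X: "map ?x ?I = X" by (rule nth_equalityI) (auto simp del: upt_Suc)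
  have "explore (\<lambda>a b. ennreal (\<phi> a b)) (\<lambda>_ _ y. f y) n (map (\<lambda>i. (?x i, f (?x i))) [0]) (map ?x ?I) \<le>
     (\<integral>\<^sup>+u. (\<Sum>i\<in>reach \<phi> ?x u (set [0]) (set ?I). f (?x i)) \<partial>unif)"
    by (rule explore_le_reach[OF \<phi>]) auto
  also have "\<dots> = explore (\<lambda>a b. ennreal (\<phi> a b)) (\<lambda>_ _ y. f y) (Suc (length X)) (map (\<lambda>i. (?x i, f (?x i))) [0]) (map ?x ?I)"
    by (rule nn_integral_reach[OF \<phi>]) auto
  finally show ?thesis by (simp only: X list.map nth_Cons_0)
qed

section \<open>Exponential edge weights and the choice of the rate\<close>

definition wexp :: "real \<Rightarrow> 'a::metric_space \<Rightarrow> 'a \<Rightarrow> ennreal" where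
  "wexp \<delta> x y = ennreal (exp (\<delta> * dist x y))"

lemma wexp_measurable:
  "case_prod (wexp \<delta> :: 'a::{metric_space, second_countable_topology} \<Rightarrow> _) \<in> borel_measurable (borel \<Otimes>\<^sub>M borel)"
  unfolding wexp_def split_beta' by measurable

lemma wexp_v [measurable]:
  "wexp \<delta> (v :: 'a::{metric_space, second_countable_topology}) \<in> borel_measurable borel"
  unfolding wexp_def by measurable

context
  fixes \<nu> :: "'a::{metric_space, second_countable_topology} measure" and \<phi> :: "'a \<Rightarrow> 'a \<Rightarrow> real"
  assumes sets_nu [measurable_cong]: "sets \<nu> = sets borel" and sf: "sigma_finite_measure \<nu>"
    and \<phi>m: "case_prod \<phi> \<in> borel_measurable (borel \<Otimes>\<^sub>M borel)"
    and \<phi>: "\<And>a b. 0 \<le> \<phi> a b \<and> \<phi> a b \<le> (1::real)"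
begin

lemma phi_ennreal: "case_prod (\<lambda>a b. ennreal (\<phi> a b)) \<in> borel_measurable (borel \<Otimes>\<^sub>M borel)"
  using measurable_compose[OF \<phi>m measurable_ennreal] by (simp add: split_beta')

lemma phi_le_1: "ennreal (\<phi> a b) \<le> 1"
  using \<phi>[of a b] by simp

lemma phi_v [measurable]: "(\<lambda>y. ennreal (\<phi> v y)) \<in> borel_measurable borel"
  using measurable_compose[OF measurable_Pair1' phi_ennreal, of v] by simp

lemma kone_meas: "(\<lambda>(w::'a, c::ennreal, y::'a). kone w c y) \<in> borel_measurable (borel \<Otimes>\<^sub>M borel \<Otimes>\<^sub>M borel)"
  by simp

text \<open>The process of density \<open>g * k\<close> is realised inside that of density
  \<open>k\<close>, and discarding points cannot enlarge the cluster. The truncated count is first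
  raised to the complete one, for which this monotonicity is known
  (\<open>explore_remove_le\<close>).\<close>

lemma pois_avg_thinning:
  assumes k [measurable]: "k \<in> borel_measurable borel" and kfin: "(\<integral>\<^sup>+x. k x \<partial>\<nu>) < \<infinity>"
    and g [measurable]: "g \<in> borel_measurable borel" and g1: "\<And>x. g x \<le> 1"
  shows "pois_avg \<nu> (\<lambda>x. g x * k x) (explore (\<lambda>a b. ennreal (\<phi> a b)) kone n [(v, 1)]) \<le> pois_avg \<nu> k (\<lambda>X. full \<phi> (\<lambda>_. 1) v X)"
proof -
  let ?F = "explore (\<lambda>a b. ennreal (\<phi> a b)) kone n [(v, 1)]"
  have lF: "lmeas ?F" by (rule lmeas_explore[OF phi_ennreal kone_meas])
  have F2: "lmeas2 (\<lambda>Y Z. ?F Y)"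
    using lF by (simp add: lmeas_def lmeas2_def)
  have q: "(\<lambda>x. (1 - g x) * k x) \<in> borel_measurable borel" by measurable
  have qfin: "(\<integral>\<^sup>+x. (1 - g x) * k x \<partial>\<nu>) < \<infinity>"
  proof -
    have "(1 - g x) * k x \<le> k x" for x
      using mult_right_mono[of "1 - g x" 1 "k x"] by (simp add: diff_le_self_ennreal)
    then have "(\<integral>\<^sup>+x. (1 - g x) * k x \<partial>\<nu>) \<le> (\<integral>\<^sup>+x. k x \<partial>\<nu>)" by (intro nn_integral_mono)
    then show ?thesis using kfin by order
  qed
  have "pois_avg \<nu> (\<lambda>x. g x * k x) ?F = pois_avg \<nu> k (\<lambda>X. thin g X (\<lambda>Y Z. ?F Y))"
    by (simp only: pois_avg_thin[OF sets_nu sf k kfin g g1 F2] pois_avg_const[OF sets_nu sf q qfin])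
  also have "\<dots> \<le> pois_avg \<nu> k (\<lambda>X. full \<phi> (\<lambda>_. 1) v X)"
  proof (rule pois_avg_mono[of UNIV])
    fix X
    have "thin g X (\<lambda>Y Z. ?F Y) \<le> thin g X (\<lambda>Y Z. full \<phi> (\<lambda>_. 1) v ([] @ Y))"
      using explore_le_full[OF \<phi>, where f = "\<lambda>_. 1"] by (intro thin_mono) simp
    also have "\<dots> \<le> full \<phi> (\<lambda>_. 1) v ([] @ X)"
    proof (rule thin_le[OF g1])
      fix P x Q
      show "full \<phi> (\<lambda>_. 1) v (P @ Q) \<le> full \<phi> (\<lambda>_. 1) v (P @ x # Q)"
        by (rule explore_remove_le[OF \<phi>, where f = "\<lambda>_. 1"]) simp
    qed
    finally show "thin g X (\<lambda>Y Z. ?F Y) \<le> full \<phi> (\<lambda>_. 1) v X" by simp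
  qed auto
  finally show ?thesis .
qed

text \<open>The neighbours of \<open>v\<close> belong to its cluster, so the mean degree, computed
  by thinning with \<open>\<phi> v\<close>, is at most the mean cluster size.\<close>

lemma degree_le:
  assumes k [measurable]: "k \<in> borel_measurable borel" and kfin: "(\<integral>\<^sup>+x. k x \<partial>\<nu>) < \<infinity>"
  shows "(\<integral>\<^sup>+y. ennreal (\<phi> v y) * k y \<partial>\<nu>) \<le> pois_avg \<nu> k (\<lambda>X. full \<phi> (\<lambda>_. 1) v X)"
proof -
  let ?g = "\<lambda>y. ennreal (\<phi> v y)"
  let ?l = "\<lambda>Y. \<Sum>y\<leftarrow>Y. (1::ennreal)"
  have le: "x * k y \<le> k y" if "x \<le> 1" for x y
    using mult_right_mono[OF that, of "k y"] by simp
  have fin: "(\<integral>\<^sup>+x. ?g x * k x \<partial>\<nu>) < \<infinity>" "(\<integral>\<^sup>+x. (1 - ?g x) * k x \<partial>\<nu>) < \<infinity>"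
  proof -
    have "(\<integral>\<^sup>+x. ?g x * k x \<partial>\<nu>) \<le> (\<integral>\<^sup>+x. k x \<partial>\<nu>)"
      by (intro nn_integral_mono le phi_le_1)
    then show "(\<integral>\<^sup>+x. ?g x * k x \<partial>\<nu>) < \<infinity>" using kfin by order
    have "(\<integral>\<^sup>+x. (1 - ?g x) * k x \<partial>\<nu>) \<le> (\<integral>\<^sup>+x. k x \<partial>\<nu>)"
      by (intro nn_integral_mono le diff_le_self_ennreal)
    then show "(\<integral>\<^sup>+x. (1 - ?g x) * k x \<partial>\<nu>) < \<infinity>" using kfin by order
  qed
  have p: "(\<lambda>x. ?g x * k x) \<in> borel_measurable borel" and q: "(\<lambda>x. (1 - ?g x) * k x) \<in> borel_measurable borel"
    by measurable
  have "lmeas2 (\<lambda>Y (Z :: 'a list). ?l Y)" by (simp add: lmeas2_def sum_list_triv)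
  from pois_avg_thin[OF sets_nu sf k kfin phi_v phi_le_1 this, of v]
  have "pois_avg \<nu> k (\<lambda>X. thin ?g X (\<lambda>Y Z. ?l Y)) = pois_avg \<nu> (\<lambda>x. ?g x * k x) ?l"
    by (simp only: pois_avg_const[OF sets_nu sf q fin(2)])
  also have "\<dots> = (\<integral>\<^sup>+y. ?g y * k y * 1 \<partial>\<nu>)"
    by (rule pois_avg_sum_list[OF sets_nu sf p fin(1)]) simp
  finally have "(\<integral>\<^sup>+y. ?g y * k y \<partial>\<nu>) = pois_avg \<nu> k (\<lambda>X. thin ?g X (\<lambda>Y Z. ?l Y))" by simp
  also have "\<dots> \<le> pois_avg \<nu> k (\<lambda>X. full \<phi> (\<lambda>_. 1) v X)"
  proof (rule pois_avg_mono[of UNIV])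
    fix X
    \<comment> \<open>After the root has been expanded, \<open>length X\<close> steps remain, and
      there are at most that many neighbours to visit.\<close>
    have "thin ?g X (\<lambda>Y Z. ?l Y) \<le> thin ?g X (\<lambda>Y Z. explore (\<lambda>a b. ennreal (\<phi> a b)) kone (length X) (map (\<lambda>y. (y, 1)) Y @ []) Z)"
    proof (rule thin_mono_length)
      fix Y Z :: "'a list" assume "length Y \<le> length X"
      then show "?l Y \<le> explore (\<lambda>a b. ennreal (\<phi> a b)) kone (length X) (map (\<lambda>y. (y, 1)) Y @ []) Z"
        using explore_kone_ge[of "\<lambda>a b. ennreal (\<phi> a b)" "length X" Y Z, OF phi_le_1]
        by (simp add: sum_list_triv min_absorb2)
    qed
    also have "\<dots> \<le> full \<phi> (\<lambda>_. 1) v X"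
      by (simp add: add_increasing)
    finally show "thin ?g X (\<lambda>Y Z. ?l Y) \<le> full \<phi> (\<lambda>_. 1) v X" .
  qed auto
  finally show ?thesis .
qed

text \<open>Within distance \<open>n0\<close> the weight is bounded and the degree bound applies.
  Beyond, space is cut into shells of width \<open>1\<close>: a weight of rate \<open>b / 2\<close>
  against a tail of rate \<open>b\<close> leaves a geometric series of ratio
  \<open>exp (- (b / 2))\<close>.\<close>

lemma moment_bound:
  fixes t T a b :: real and n0 :: nat
  assumes tail: "\<And>n. n0 \<le> n \<Longrightarrow> ennreal t * (\<integral>\<^sup>+x\<in>{x. dist v x > real n}. ennreal (\<phi> v x) \<partial>\<nu>) \<le> ennreal (2 * (a * exp (- b * real n)))"
    and deg: "(\<integral>\<^sup>+y. ennreal (\<phi> v y) * h y \<partial>\<nu>) \<le> ennreal T"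
    and h [measurable]: "h \<in> borel_measurable borel" and ht: "\<And>x. h x \<le> ennreal t" and "0 < a" "0 < b" "0 \<le> T"
  shows "(\<integral>\<^sup>+y. ennreal (\<phi> v y) * h y * wexp (b / 2) v y \<partial>\<nu>) \<le>
    ennreal (exp (b / 2 * n0) * T + 2 * a * exp (b / 2) * (\<Sum>n. exp (- (b / 2)) ^ n))"
proof -
  let ?A = "\<lambda>n. {x. dist v x > real (n + n0)}"
  let ?c = "\<lambda>n. exp (b / 2 * real (n + n0 + 1))"
  have [measurable]: "?A n \<in> sets borel" for n by measurable
  have pt: "wexp (b / 2) v y \<le> ennreal (exp (b / 2 * n0)) + (\<Sum>n. ennreal (?c n) * indicator (?A n) y)" for y
  proof (cases "dist v y \<le> n0")
    case True
    then have "wexp (b / 2) v y \<le> ennreal (exp (b / 2 * n0))"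
      unfolding wexp_def using \<open>0 < b\<close> by (intro ennreal_leI) simp
    then show ?thesis by (simp add: add_increasing2)
  next
    case False
    \<comment> \<open>The number of the shell \<open>n + n0 < dist v y <= n + n0 + 1\<close> that
      contains \<open>y\<close>.\<close>
    define n where "n = nat (\<lceil>dist v y\<rceil> - 1 - int n0)"
    have n: "real (n + n0) < dist v y" "dist v y \<le> real (n + n0 + 1)"
      using False unfolding n_def by linarith+
    have "wexp (b / 2) v y \<le> ennreal (?c n) * indicator (?A n) y"
      using n \<open>0 < b\<close> by (auto simp: wexp_def intro!: ennreal_leI)
    also have "\<dots> \<le> (\<Sum>n. ennreal (?c n) * indicator (?A n) y)"
    proof -
      have "F n \<le> suminf F" for F :: "nat \<Rightarrow> ennreal" using sum_le_suminf[of F "{n}"] by simp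
      then show ?thesis .
    qed
    finally show ?thesis by (simp add: add_increasing)
  qed
  have r: "\<bar>exp (- (b / 2))\<bar> < 1" using \<open>0 < b\<close> by simp
  have "(\<integral>\<^sup>+y. ennreal (\<phi> v y) * h y * wexp (b / 2) v y \<partial>\<nu>) \<le>
    (\<integral>\<^sup>+y. ennreal (exp (b / 2 * n0)) * (ennreal (\<phi> v y) * h y) +
       (\<Sum>n. ennreal (?c n) * (ennreal t * (ennreal (\<phi> v y) * indicator (?A n) y))) \<partial>\<nu>)"
  proof (rule nn_integral_mono)
    fix y
    have "ennreal (\<phi> v y) * h y * wexp (b / 2) v y \<le>
       ennreal (\<phi> v y) * h y * (ennreal (exp (b / 2 * n0)) + (\<Sum>n. ennreal (?c n) * indicator (?A n) y))"
      by (intro mult_left_mono pt) simp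
    also have "\<dots> = ennreal (exp (b / 2 * n0)) * (ennreal (\<phi> v y) * h y) + ennreal (\<phi> v y) * h y * (\<Sum>n. ennreal (?c n) * indicator (?A n) y)"
      by (simp add: distrib_left ac_simps)
    also have "ennreal (\<phi> v y) * h y * (\<Sum>n. ennreal (?c n) * indicator (?A n) y) \<le>
       ennreal (\<phi> v y) * ennreal t * (\<Sum>n. ennreal (?c n) * indicator (?A n) y)"
      by (intro mult_right_mono mult_left_mono ht) auto
    also have "\<dots> = (\<Sum>n. ennreal (?c n) * (ennreal t * (ennreal (\<phi> v y) * indicator (?A n) y)))"
      by (simp only: ennreal_suminf_cmult[symmetric] ac_simps)
    finally show "ennreal (\<phi> v y) * h y * wexp (b / 2) v y \<le> ennreal (exp (b / 2 * n0)) * (ennreal (\<phi> v y) * h y) +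
       (\<Sum>n. ennreal (?c n) * (ennreal t * (ennreal (\<phi> v y) * indicator (?A n) y)))"
      by (simp add: add_left_mono)
  qed
  also have "\<dots> = ennreal (exp (b / 2 * n0)) * (\<integral>\<^sup>+y. ennreal (\<phi> v y) * h y \<partial>\<nu>) +
     (\<Sum>n. ennreal (?c n) * (ennreal t * (\<integral>\<^sup>+x\<in>?A n. ennreal (\<phi> v x) \<partial>\<nu>)))"
    by (simp add: nn_integral_add nn_integral_cmult nn_integral_suminf)
  also have "\<dots> \<le> ennreal (exp (b / 2 * n0)) * ennreal T +
     (\<Sum>n. ennreal (?c n) * ennreal (2 * (a * exp (- b * real (n + n0)))))"
    by (intro add_mono mult_left_mono deg suminf_le tail) auto
  also have "(\<Sum>n. ennreal (?c n) * ennreal (2 * (a * exp (- b * real (n + n0))))) \<le>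
     (\<Sum>n. ennreal (2 * a * exp (b / 2) * exp (- (b / 2)) ^ n))"
  proof (intro suminf_le)
    fix n
    have "?c n * (2 * (a * exp (- b * real (n + n0)))) = 2 * a * (exp (b / 2) * exp (- (b / 2) * real (n + n0)))"
      by (simp add: mult_exp_exp algebra_simps) (simp add: field_simps)
    also have "\<dots> \<le> 2 * a * (exp (b / 2) * exp (- (b / 2) * real n))"
      using \<open>0 < a\<close> \<open>0 < b\<close> by simp
    also have "\<dots> = 2 * a * exp (b / 2) * exp (- (b / 2)) ^ n"
      by (simp add: exp_of_nat_mult[symmetric] mult.commute)
    finally show "ennreal (?c n) * ennreal (2 * (a * exp (- b * real (n + n0)))) \<le> ennreal (2 * a * exp (b / 2) * exp (- (b / 2)) ^ n)"
      using \<open>0 < a\<close> by (subst ennreal_mult[symmetric]) (auto intro: ennreal_leI)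
  qed auto
  also have "(\<Sum>n. ennreal (2 * a * exp (b / 2) * exp (- (b / 2)) ^ n)) = ennreal (2 * a * exp (b / 2) * (\<Sum>n. exp (- (b / 2)) ^ n))"
    using \<open>0 < a\<close> r by (intro suminf_ennreal_eq sums_mult summable_sums summable_geometric) auto
  also have "ennreal (exp (b / 2 * n0)) * ennreal T + \<dots> =
      ennreal (exp (b / 2 * n0) * T + 2 * a * exp (b / 2) * (\<Sum>n. exp (- (b / 2)) ^ n))"
    using \<open>0 < a\<close> \<open>0 \<le> T\<close> r
    by (simp add: ennreal_mult ennreal_plus suminf_nonneg summable_geometric)
  finally show ?thesis by (simp add: add_left_mono)
qed

text \<open>Convexity of \<open>exp\<close> between \<open>0\<close> and
  \<open>c * dist x y\<close>. It makes the excess weight proportional to \<open>\<theta>\<close>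
  while the moment stays at the fixed rate \<open>c\<close>.\<close>

lemma wexp_convex:
  assumes "0 \<le> \<theta>" "\<theta> \<le> 1"
  shows "wexp (\<theta> * c) x y - 1 \<le> ennreal \<theta> * wexp c x y"
proof -
  let ?z = "c * dist x y"
  have "exp ((1 - \<theta>) *\<^sub>R 0 + \<theta> *\<^sub>R ?z) \<le> (1 - \<theta>) * exp 0 + \<theta> * exp ?z"
    using assms by (intro convex_onD[OF exp_convex]) auto
  then have "exp (\<theta> * ?z) - 1 \<le> \<theta> * exp ?z" using assms by (simp add: algebra_simps)
  then have "ennreal (exp (\<theta> * ?z) - 1) \<le> ennreal (\<theta> * exp ?z)" by (rule ennreal_leI)
  then show ?thesis
    using assms unfolding wexp_def by (simp add: ennreal_minus[symmetric] ennreal_mult mult.assoc flip: ennreal_1)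
qed

text \<open>The constants \<open>M\<close> and \<open>T\<close> control moments and cluster sizes in
  all regions at once, so one \<open>\<delta>\<close> serves every region and every root in
  \<open>S\<close>.\<close>

lemma uniform_weighted_bound:
  fixes s t T a b :: real and n0 :: nat and B :: "nat \<Rightarrow> 'a set"
  assumes B: "\<And>R. B R \<in> sets borel" "\<And>R. emeasure \<nu> (B R) < \<infinity>" "\<And>R. B R \<subseteq> S"
    and st: "0 \<le> t" "t \<le> s" "0 < s"
    and count: "\<And>R v. v \<in> S \<Longrightarrow> pois_avg \<nu> (\<lambda>x. ennreal s * indicator (B R) x) (\<lambda>X. full \<phi> (\<lambda>_. 1) v X) \<le> ennreal T"
    and tail: "\<And>v n. v \<in> S \<Longrightarrow> n0 \<le> n \<Longrightarrow>
       ennreal t * (\<integral>\<^sup>+x\<in>{x. dist v x > real n}. ennreal (\<phi> v x) \<partial>\<nu>) \<le> ennreal (2 * (a * exp (- b * real n)))"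
    and ab: "0 < a" "0 < b" and T: "0 \<le> T"
  shows "\<exists>\<delta>>0. \<forall>R. \<forall>v\<in>S. pois_avg \<nu> (\<lambda>x. ennreal t * indicator (B R) x) (\<lambda>X. full \<phi> (wexp \<delta> v) v X) \<le> ennreal (2 * T)"
proof -
  define M where "M = exp (b / 2 * n0) * T + 2 * a * exp (b / 2) * (\<Sum>n. exp (- (b / 2)) ^ n)"
  have M0: "0 \<le> M"
    unfolding M_def using ab T by (intro add_nonneg_nonneg mult_nonneg_nonneg suminf_nonneg summable_geometric) auto
  \<comment> \<open>Chosen to make \<open>\<theta> * M * T\<close> at most \<open>1 / 2\<close>; the
    added \<open>1\<close> keeps the denominator positive and \<open>\<theta>\<close> at most
    \<open>1\<close>.\<close>
  define \<theta> where "\<theta> = 1 / (2 * (M * T + 1))"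
  have \<theta>: "0 < \<theta>" "\<theta> \<le> 1" "\<theta> * M * T \<le> 1 / 2"
  proof -
    have "0 \<le> M * T" using M0 T by simp
    then show "0 < \<theta>" "\<theta> \<le> 1" "\<theta> * M * T \<le> 1 / 2" by (auto simp: \<theta>_def field_simps)
  qed
  define \<delta> where "\<delta> = \<theta> * (b / 2)"
  have "0 < \<delta>" using \<theta> ab by (simp add: \<delta>_def)
  moreover have "pois_avg \<nu> (\<lambda>x. ennreal t * indicator (B R) x) (\<lambda>X. full \<phi> (wexp \<delta> v) v X) \<le> ennreal (2 * T)" if v: "v \<in> S" for R v
  proof -
    let ?hm = "\<lambda>x. ennreal t * indicator (B R) x" and ?k = "\<lambda>x. ennreal s * indicator (B R) x"
    note [measurable] = B(1)[of R]
    have hm: "?hm \<in> borel_measurable borel" and km: "?k \<in> borel_measurable borel" by measurable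
    have kfin: "(\<integral>\<^sup>+x. ?k x \<partial>\<nu>) < \<infinity>"
      using B(2)[of R] by (simp add: nn_integral_cmult_indicator ennreal_mult_less_top)
    have hk: "?hm x \<le> ?k x" for x
      using st by (intro mult_right_mono ennreal_leI) auto
    have hfin: "(\<integral>\<^sup>+x. ?hm x \<partial>\<nu>) < \<infinity>"
      using le_less_trans[OF nn_integral_mono[OF hk] kfin] .
    have hS: "?hm x = 0" if "x \<notin> S" for x using that B(3)[of R] by (auto simp: indicator_def)
    have E1: "1 \<le> wexp \<delta> x y" for x y
      using \<open>0 < \<delta>\<close> unfolding wexp_def by (simp add: ennreal_ge_1)
    have T1: "pois_avg \<nu> h (explore (\<lambda>a b. ennreal (\<phi> a b)) kone n [(w, 1)]) \<le> ennreal T" if h: "h \<in> envs ?hm" and w: "w \<in> S" for h w n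
    proof -
      have [measurable]: "h \<in> borel_measurable borel" and hle: "\<And>x. h x \<le> ?hm x" using h by (auto simp: envs_def)
      \<comment> \<open>The probability of keeping a point when intensity \<open>s\<close> is
        thinned to \<open>h\<close>; on the region \<open>h\<close> is at most \<open>t\<close>,
        hence at most \<open>s\<close>.\<close>
      let ?g = "\<lambda>x. h x / ennreal s"
      have "h x \<le> ennreal s" for x
        using order.trans[OF hle[of x] hk[of x]] by (cases "x \<in> B R") auto
      then have g1: "?g x \<le> 1" for x
        using st by (simp add: divide_le_posI_ennreal)
      have "h x = ?g x * ?k x" for x
      proof (cases "x \<in> B R")
        case True
        moreover have "h x / ennreal s * ennreal s = h x"
          unfolding ennreal_divide_times using st by (simp add: ennreal_divide_self)
        ultimately show ?thesis by simp
      next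
        case False
        then show ?thesis using hle[of x] by simp
      qed
      then have "pois_avg \<nu> h (explore (\<lambda>a b. ennreal (\<phi> a b)) kone n [(w, 1)]) =
        pois_avg \<nu> (\<lambda>x. ?g x * ?k x) (explore (\<lambda>a b. ennreal (\<phi> a b)) kone n [(w, 1)])" by simp
      also have "\<dots> \<le> pois_avg \<nu> ?k (\<lambda>X. full \<phi> (\<lambda>_. 1) w X)"
        by (rule pois_avg_thinning[OF km kfin _ g1]) measurable
      also have "\<dots> \<le> ennreal T" by (rule count[OF w])
      finally show ?thesis .
    qed
    have mom: "(\<integral>\<^sup>+y. ennreal (\<phi> w y) * ?hm y * wexp (b / 2) w y \<partial>\<nu>) \<le> ennreal M" if w: "w \<in> S" for w
      unfolding M_def
    proof (rule moment_bound[OF tail[OF w] _ hm _ ab T])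
      have "(\<integral>\<^sup>+y. ennreal (\<phi> w y) * ?hm y \<partial>\<nu>) \<le> (\<integral>\<^sup>+y. ennreal (\<phi> w y) * ?k y \<partial>\<nu>)"
        by (intro nn_integral_mono mult_left_mono hk) auto
      also have "\<dots> \<le> pois_avg \<nu> ?k (\<lambda>X. full \<phi> (\<lambda>_. 1) w X)" by (rule degree_le[OF km kfin])
      also have "\<dots> \<le> ennreal T" by (rule count[OF w])
      finally show "(\<integral>\<^sup>+y. ennreal (\<phi> w y) * ?hm y \<partial>\<nu>) \<le> ennreal T" .
      show "?hm x \<le> ennreal t" for x by (auto simp: indicator_def)
    qed auto
    have eps: "(\<integral>\<^sup>+y. ennreal (\<phi> w y) * ?hm y * (wexp \<delta> w y - 1) \<partial>\<nu>) \<le> ennreal (\<theta> * M)" if w: "w \<in> S" for w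
    proof -
      have [measurable]: "(\<lambda>y. wexp c w y) \<in> borel_measurable \<nu>" for c
        using wexp_v[of c w] by (simp cong: measurable_cong_sets)
      have "(\<integral>\<^sup>+y. ennreal (\<phi> w y) * ?hm y * (wexp \<delta> w y - 1) \<partial>\<nu>) \<le>
        (\<integral>\<^sup>+y. ennreal \<theta> * (ennreal (\<phi> w y) * ?hm y * wexp (b / 2) w y) \<partial>\<nu>)"
      proof (rule nn_integral_mono)
        fix y
        have "ennreal (\<phi> w y) * ?hm y * (wexp \<delta> w y - 1) \<le> ennreal (\<phi> w y) * ?hm y * (ennreal \<theta> * wexp (b / 2) w y)"
          unfolding \<delta>_def using \<theta> by (intro mult_left_mono wexp_convex) auto
        then show "ennreal (\<phi> w y) * ?hm y * (wexp \<delta> w y - 1) \<le> ennreal \<theta> * (ennreal (\<phi> w y) * ?hm y * wexp (b / 2) w y)"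
          by (simp only: ac_simps)
      qed
      also have "\<dots> = ennreal \<theta> * (\<integral>\<^sup>+y. ennreal (\<phi> w y) * ?hm y * wexp (b / 2) w y \<partial>\<nu>)"
        by (rule nn_integral_cmult) measurable
      also have "\<dots> \<le> ennreal \<theta> * ennreal M" by (intro mult_left_mono mom w) auto
      finally show ?thesis using \<theta> M0 by (simp add: ennreal_mult)
    qed
    have M2: "(\<integral>\<^sup>+y. ennreal (\<phi> w y) * ?hm y * wexp \<delta> w y \<partial>\<nu>) \<le> ennreal M" if w: "w \<in> S" for w
    proof -
      have "\<delta> * dist w y \<le> b / 2 * dist w y" for y
        unfolding \<delta>_def using \<theta> ab by (intro mult_right_mono) (auto simp: mult_le_cancel_right1)
      then have "wexp \<delta> w y \<le> wexp (b / 2) w y" for y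
        unfolding wexp_def by (intro ennreal_leI) simp
      then have "(\<integral>\<^sup>+y. ennreal (\<phi> w y) * ?hm y * wexp \<delta> w y \<partial>\<nu>) \<le> (\<integral>\<^sup>+y. ennreal (\<phi> w y) * ?hm y * wexp (b / 2) w y \<partial>\<nu>)"
        by (intro nn_integral_mono mult_left_mono) auto
      also have "\<dots> \<le> ennreal M" by (rule mom[OF w])
      finally show ?thesis .
    qed
    have small: "ennreal (\<theta> * M) * ennreal T \<le> ennreal (1 / 2)"
    proof -
      have "ennreal (\<theta> * M) * ennreal T = ennreal (\<theta> * M * T)"
        using \<theta> M0 T by (simp add: ennreal_mult)
      then show ?thesis using ennreal_leI[OF \<theta>(3)] by simp
    qed
    have hmenv: "?hm \<in> envs ?hm" using hm by (simp add: envs_def)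
    have bound: "pois_avg \<nu> ?hm (explore (\<lambda>a b. ennreal (\<phi> a b)) (kscale (wexp \<delta>)) n [(v, 1)]) \<le> ennreal (2 * T)" for n
      by (rule exploration_bound[OF sets_nu sf phi_ennreal wexp_measurable phi_le_1 E1 hm hfin hS eps M2 _ T1 small T hmenv v]) auto
    have tri: "wexp \<delta> v y \<le> wexp \<delta> v w * wexp \<delta> w y" for w y
    proof -
      have "\<delta> * dist v y \<le> \<delta> * dist v w + \<delta> * dist w y"
        using \<open>0 < \<delta>\<close> dist_triangle[of v y w] by (simp flip: distrib_left)
      then show ?thesis
        unfolding wexp_def by (subst ennreal_mult[symmetric]) (auto simp: exp_add[symmetric] intro!: ennreal_leI)
    qed
    have "pois_avg \<nu> ?hm (\<lambda>X. full \<phi> (wexp \<delta> v) v X) \<le>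
      pois_avg \<nu> ?hm (\<lambda>X. explore (\<lambda>a b. ennreal (\<phi> a b)) (kscale (wexp \<delta>)) (Suc (length X)) [(v, 1)] X)"
    proof (rule pois_avg_mono[of UNIV])
      fix X
      show "full \<phi> (wexp \<delta> v) v X \<le> explore (\<lambda>a b. ennreal (\<phi> a b)) (kscale (wexp \<delta>)) (Suc (length X)) [(v, 1)] X"
        by (rule explore_le_scale[where f = "wexp \<delta> v", OF tri]) (auto simp: wexp_def)
    qed auto
    also have "\<dots> \<le> ennreal (2 * T)"
      by (rule pois_avg_length_le[where F = "\<lambda>n. explore (\<lambda>a b. ennreal (\<phi> a b)) (kscale (wexp \<delta>)) n [(v, 1)]", OF bound explore_Suc_mono])
    finally show ?thesis .
  qed
  ultimately show ?thesis by blast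
qed

end

section \<open>From bounded regions to the whole space\<close>

lemma bcomp_subset_component:
  assumes "i \<in> bcomp \<phi> B (add_point v c) u"
  shows "snd (add_point v c) i \<in> rcm_component \<phi> (add_point v c) u v" "enat i < fst (add_point v c)"
proof -
  let ?c = "add_point v c"
  have "(rcm_adj \<phi> ?c u)\<^sup>*\<^sup>* v (snd ?c i) \<and> enat i < fst ?c"
    using assms unfolding bcomp_def
  proof (induction rule: reach_induct)
    case (base a)
    then show ?case by simp
  next
    case (step a b)
    have b: "enat b < fst ?c" using step by (auto simp: idx_def)
    show ?case
    proof (cases "snd ?c a = snd ?c b")
      \<comment> \<open>\<open>rcm_adj\<close> has no loops, but two indices of the same point stand
        for the same vertex.\<close>
      case True
      then show ?thesis using step b by simp
    next
      case False
      then have ab: "a \<noteq> b" by auto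
      have "rcm_adj \<phi> ?c u (snd ?c a) (snd ?c b)"
        unfolding rcm_adj_def
      proof (intro conjI exI)
        show "min a b < max a b" using ab by auto
        show "enat (max a b) < fst ?c" using step b by (auto simp: max_def)
        show "{snd ?c (min a b), snd ?c (max a b)} = {snd ?c a, snd ?c b}" by (auto simp: min_def max_def)
        show "u (min a b, max a b) \<le> \<phi> (snd ?c a) (snd ?c b)" using step by (simp add: iadj_def)
      qed (rule False)
      then show ?thesis using step b by (meson rtranclp.rtrancl_into_rtrancl)
    qed
  qed
  then show "snd ?c i \<in> rcm_component \<phi> ?c u v" "enat i < fst ?c"
    by (simp_all add: rcm_component_def)
qed

lemma bcomp_mono: "B \<subseteq> B' \<Longrightarrow> bcomp \<phi> B c u \<subseteq> bcomp \<phi> B' c u"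
  unfolding bcomp_def by (intro reach_mono) (auto simp: idx_def)

text \<open>A path has finitely many vertices and therefore lies in one of the increasing regions.
  Injectivity lifts a path of points to a path of indices.\<close>

lemma component_in_bcomp:
  assumes inj: "inj_on (snd (add_point v c)) {n. enat n < fst (add_point v c)}"
    and B: "\<And>n. enat n < fst c \<Longrightarrow> \<exists>R. snd c n \<in> B R" "incseq B"
    and x: "x \<in> rcm_component \<phi> (add_point v c) u v"
  shows "\<exists>R i. i \<in> bcomp \<phi> (B R) (add_point v c) u \<and> snd (add_point v c) i = x"
proof -
  let ?c = "add_point v c"
  have "(rcm_adj \<phi> ?c u)\<^sup>*\<^sup>* v x" using x by (simp add: rcm_component_def)
  then show ?thesis
  proof (induction rule: rtranclp_induct)
    case base
    have "0 \<in> bcomp \<phi> (B 0) ?c u" by (simp add: bcomp_def reach_refl)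
    then show ?case by (intro exI[of _ 0]) auto
  next
    case (step y z)
    then obtain R i where i: "i \<in> bcomp \<phi> (B R) ?c u" "snd ?c i = y" by blast
    from step(2) obtain m n where mn: "y \<noteq> z" "m < n" "enat n < fst ?c"
      "{snd ?c m, snd ?c n} = {y, z}" "u (m, n) \<le> \<phi> y z"
      unfolding rcm_adj_def by blast
    have m: "enat m < fst ?c" using mn(2,3) by (meson enat_ord_simps(2) order.strict_trans)
    have ifst: "enat i < fst ?c" by (rule bcomp_subset_component[OF i(1)])
    obtain j where j: "snd ?c j = z" "enat j < fst ?c" "(m, n) = (min i j, max i j)"
    proof (cases "snd ?c m = y")
      case True
      then have "m = i" using inj i(2) m ifst by (auto simp: inj_on_def)
      moreover have "snd ?c n = z" using True mn(4,1) by (auto simp: doubleton_eq_iff)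
      ultimately show ?thesis using that[of n] mn by auto
    next
      case False
      then have "snd ?c n = y" "snd ?c m = z" using mn(4) by (auto simp: doubleton_eq_iff)
      then have "n = i" using inj i(2) mn(3) ifst by (auto simp: inj_on_def)
      then show ?thesis using that[of m] mn m \<open>snd ?c m = z\<close> by auto
    qed
    have adj: "iadj \<phi> (snd ?c) u i j"
      using mn(5) j(1,3) i(2) by (simp add: iadj_def)
    show ?case
    proof (cases j)
      \<comment> \<open>A return to the root, which belongs to \<open>bcomp\<close> for every
        region, whether or not the region contains \<open>v\<close>.\<close>
      case 0
      have "0 \<in> bcomp \<phi> (B 0) ?c u" by (simp add: bcomp_def reach_refl)
      then show ?thesis using j 0 by blast
    next
      case (Suc l)
      then obtain R' where R': "snd c l \<in> B R'" using B(1)[of l] j(2) by auto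
      let ?R = "max R R'"
      have i': "i \<in> bcomp \<phi> (B ?R) ?c u"
        by (rule subsetD[OF bcomp_mono i(1)]) (rule incseqD[OF B(2)], simp)
      have j': "j \<in> idx ?c (B ?R) - {0}"
        using R' incseqD[OF B(2), of R' ?R] j(2) Suc by (auto simp: idx_def)
      have "j \<in> bcomp \<phi> (B ?R) ?c u"
        unfolding bcomp_def by (rule reach_step[OF i'[unfolded bcomp_def] j' adj])
      then show ?thesis using j(1) by blast
    qed
  qed
qed

section \<open>Diameter of the cluster: bounds and measurability\<close>

lemma ennexp_mono: "x \<le> y \<Longrightarrow> ennexp x \<le> ennexp y"
  by (auto simp: ennexp_def top_unique less_top enn2real_mono intro!: ennreal_leI)

lemma ennexp_ennreal: "0 \<le> x \<Longrightarrow> ennexp (ennreal x) = ennreal (exp x)"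
  by (simp add: ennexp_def)

text \<open>Two points of \<open>V\<close> are at most twice as far apart as the largest distance
  from \<open>v\<close> allows; this is the origin of the rate \<open>\<delta> / 2\<close>.\<close>

lemma ennexp_ediameter_le:
  fixes V :: "'a::metric_space set"
  assumes \<delta>: "0 < \<delta>" and V: "v \<in> V" "\<And>x. x \<in> V \<Longrightarrow> wexp \<delta> v x \<le> C"
  shows "ennexp (ennreal (\<delta> / 2) * ediameter V) \<le> C"
proof (cases C)
  case (real c)
  have c1: "1 \<le> c" using V(2)[OF V(1)] real by (simp add: wexp_def flip: ennreal_1)
  have d: "dist v x \<le> ln c / \<delta>" if "x \<in> V" for x
  proof -
    have "exp (\<delta> * dist v x) \<le> c" using V(2)[OF that] real by (simp add: wexp_def)
    then have "\<delta> * dist v x \<le> ln c" using c1 by (simp add: ln_ge_iff)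
    then show ?thesis using \<delta> by (simp add: field_simps)
  qed
  have "ediameter V \<le> ennreal (2 * (ln c / \<delta>))"
    unfolding ediameter_def
  proof (intro SUP_least ennreal_leI)
    fix x y assume "x \<in> V" "y \<in> V"
    then show "dist x y \<le> 2 * (ln c / \<delta>)"
      using d[of x] d[of y] dist_triangle3[of x y v] by linarith
  qed
  then have "ennreal (\<delta> / 2) * ediameter V \<le> ennreal (\<delta> / 2) * ennreal (2 * (ln c / \<delta>))"
    by (rule mult_left_mono) simp
  also have "\<dots> = ennreal (ln c)" using \<delta> c1 by (subst ennreal_mult[symmetric]) auto
  finally have "ennexp (ennreal (\<delta> / 2) * ediameter V) \<le> ennexp (ennreal (ln c))" by (rule ennexp_mono)
  also have "\<dots> = C" using c1 real by (simp add: ennexp_ennreal)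
  finally show ?thesis .
qed simp

lemma measurable_ennexp [measurable]: "ennexp \<in> borel_measurable borel"
  unfolding ennexp_def[abs_def] by measurable

text \<open>Connectedness is moved to the countable set of indices, where
  \<open>pred_rtranclp\<close> applies. As adjacency still refers to the points, repeated points do
  no harm.\<close>

lemma component_index:
  "rcm_component \<phi> c u (snd c 0) = snd c ` {n. (\<lambda>a b. enat b < fst c \<and> rcm_adj \<phi> c u (snd c a) (snd c b))\<^sup>*\<^sup>* 0 n}"
  (is "_ = snd c ` {n. ?E\<^sup>*\<^sup>* 0 n}")
proof (intro equalityI subsetI)
  fix x assume "x \<in> rcm_component \<phi> c u (snd c 0)"
  then have "(rcm_adj \<phi> c u)\<^sup>*\<^sup>* (snd c 0) x" by (simp add: rcm_component_def)
  then show "x \<in> snd c ` {n. ?E\<^sup>*\<^sup>* 0 n}"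
  proof (induction rule: rtranclp_induct)
    case (step y z)
    then obtain n where n: "y = snd c n" "?E\<^sup>*\<^sup>* 0 n" by auto
    from step(2) obtain k l where kl: "k < l" "enat l < fst c" "{snd c k, snd c l} = {y, z}"
      unfolding rcm_adj_def by blast
    have "enat k < fst c" using kl by (meson enat_ord_simps(2) order.strict_trans)
    moreover have "z = snd c k \<or> z = snd c l" using kl(3) by auto
    ultimately obtain j where j: "z = snd c j" "enat j < fst c" using kl by auto
    then have "?E n j" using step(2) n by simp
    then show ?case using n j by (auto intro: rtranclp.rtrancl_into_rtrancl)
  qed auto
next
  fix x assume "x \<in> snd c ` {n. ?E\<^sup>*\<^sup>* 0 n}"
  then obtain n where n: "x = snd c n" "?E\<^sup>*\<^sup>* 0 n" by auto
  from n(2) have "(rcm_adj \<phi> c u)\<^sup>*\<^sup>* (snd c 0) (snd c n)"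
    by (induction rule: rtranclp_induct) (auto intro: rtranclp.rtrancl_into_rtrancl)
  then show "x \<in> rcm_component \<phi> c u (snd c 0)" by (simp add: rcm_component_def n)
qed

lemma measurable_ediameter_component:
  fixes x :: "nat \<Rightarrow> 'b \<Rightarrow> 'a::{metric_space, second_countable_topology}"
  assumes \<phi>: "case_prod \<phi> \<in> borel_measurable (borel \<Otimes>\<^sub>M borel)"
    and x [measurable]: "\<And>n. (\<lambda>z. snd (C z) n) \<in> M \<rightarrow>\<^sub>M (borel :: 'a measure)"
    and k [measurable]: "(\<lambda>z. fst (C z)) \<in> M \<rightarrow>\<^sub>M count_space UNIV"
    and u [measurable]: "\<And>e. (\<lambda>z. V z e) \<in> M \<rightarrow>\<^sub>M (borel :: real measure)"
  shows "(\<lambda>z. ediameter (rcm_component \<phi> (C z) (V z) (snd (C z) 0))) \<in> borel_measurable M"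
proof -
  have eq [measurable]: "Measurable.pred M (\<lambda>z. snd (C z) a = snd (C z) b)" for a b
    by (rule borel_pred_eq[OF x x])
  have phi [measurable]: "(\<lambda>z. \<phi> (snd (C z) a) (snd (C z) b)) \<in> borel_measurable M" for a b
    by (rule measurable_phi_comp[OF \<phi> x x])
  have [measurable]: "Measurable.pred M (\<lambda>z. enat b < fst (C z) \<and> rcm_adj \<phi> (C z) (V z) (snd (C z) a) (snd (C z) b))" for a b
    unfolding rcm_adj_def doubleton_eq_iff by measurable
  define Q where "Q z n \<longleftrightarrow> (\<lambda>a b. enat b < fst (C z) \<and> rcm_adj \<phi> (C z) (V z) (snd (C z) a) (snd (C z) b))\<^sup>*\<^sup>* 0 n" for z n
  have [measurable]: "Measurable.pred M (\<lambda>z. Q z n)" for n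
    unfolding Q_def by (rule pred_rtranclp) measurable
  have comp: "rcm_component \<phi> (C z) (V z) (snd (C z) 0) = snd (C z) ` {n. Q z n}" for z
    unfolding component_index Q_def ..
  have "ediameter (rcm_component \<phi> (C z) (V z) (snd (C z) 0)) =
    (SUP m. SUP n. if Q z m \<and> Q z n then ennreal (dist (snd (C z) m) (snd (C z) n)) else 0)" for z
    unfolding comp ediameter_def image_image
  proof (intro antisym SUP_least)
    fix m n assume "m \<in> {n. Q z n}" "n \<in> {n. Q z n}"
    then show "ennreal (dist (snd (C z) m) (snd (C z) n)) \<le>
      (SUP m. SUP n. if Q z m \<and> Q z n then ennreal (dist (snd (C z) m) (snd (C z) n)) else 0)"
      by (intro SUP_upper2[of m] SUP_upper2[of n]) auto
  next
    fix m n
    show "(if Q z m \<and> Q z n then ennreal (dist (snd (C z) m) (snd (C z) n)) else 0) \<le>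
      (SUP m\<in>{n. Q z n}. SUP n\<in>{n. Q z n}. ennreal (dist (snd (C z) m) (snd (C z) n)))"
    proof (cases "Q z m \<and> Q z n")
      case True
      then have "ennreal (dist (snd (C z) m) (snd (C z) n)) \<le> (SUP n\<in>{n. Q z n}. ennreal (dist (snd (C z) m) (snd (C z) n)))"
        by (intro SUP_upper) simp
      also have "\<dots> \<le> (SUP m\<in>{n. Q z n}. SUP n\<in>{n. Q z n}. ennreal (dist (snd (C z) m) (snd (C z) n)))"
        using True by (intro SUP_upper) simp
      finally show ?thesis using True by simp
    qed auto
  qed
  moreover have "(\<lambda>z. SUP m. SUP n. if Q z m \<and> Q z n then ennreal (dist (snd (C z) m) (snd (C z) n)) else 0) \<in> borel_measurable M"
    by measurable
  ultimately show ?thesis by simp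
qed

text \<open>Inverts \<open>1 - exp (- y) <= q\<close>. The factor \<open>2\<close> comes from
  \<open>- ln (1 - q) <= q + 2 * q\<^sup>2 <= 2 * q\<close> for \<open>q <= 1 / 2\<close>; an
  infinite \<open>y\<close> would force \<open>q\<close> to be at least \<open>1\<close>.\<close>

lemma long_edge_prob_le:
  assumes "long_edge_prob \<nu> \<phi> t v r \<le> ennreal q" "0 \<le> q" "q \<le> 1 / 2"
  shows "ennreal t * (\<integral>\<^sup>+x\<in>{x. dist v x > r}. ennreal (\<phi> v x) \<partial>\<nu>) \<le> ennreal (2 * q)"
proof -
  define y where "y = ennreal t * (\<integral>\<^sup>+x\<in>{x. dist v x > r}. ennreal (\<phi> v x) \<partial>\<nu>)"
  have le: "1 - inverse (ennexp y) \<le> ennreal q" using assms(1) by (simp add: long_edge_prob_def y_def)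
  have "y \<le> ennreal (2 * q)"
  proof (cases y)
    case (real c)
    have "inverse (ennexp y) = ennreal (exp (- c))"
      using real by (simp add: ennexp_ennreal inverse_ennreal exp_minus)
    then have "ennreal (1 - exp (- c)) \<le> ennreal q"
      using le by (simp add: ennreal_minus[symmetric] flip: ennreal_1)
    then have "1 - q \<le> exp (- c)" using assms(2) by simp
    then have "ln (1 - q) \<le> ln (exp (- c))" using assms by (subst ln_le_cancel_iff) auto
    then have "ln (1 - q) \<le> - c" by simp
    moreover have "- q - 2 * q\<^sup>2 \<le> ln (1 - q)" by (rule ln_one_minus_pos_lower_bound[OF assms(2,3)])
    moreover have "2 * q\<^sup>2 \<le> q"
      using mult_right_mono[of q "1 / 2" q] assms by (simp add: power2_eq_square)
    ultimately have "c \<le> 2 * q" by linarith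
    then have "ennreal c \<le> ennreal (2 * q)" by (rule ennreal_leI)
    then show ?thesis using real by (simp only:)
  next
    case top
    then have "1 \<le> ennreal q" using le by (simp add: ennexp_def)
    then have "1 \<le> q" using assms by (simp flip: ennreal_1)
    then show ?thesis using assms by simp
  qed
  then show ?thesis by (simp add: y_def)
qed

lemma sigma_finite_locally_finite:
  fixes \<nu> :: "'a::metric_space measure"
  assumes sets: "sets \<nu> = sets borel"
    and fin: "\<And>B. B \<in> sets borel \<Longrightarrow> bounded B \<Longrightarrow> emeasure \<nu> B < \<infinity>"
  shows "sigma_finite_measure \<nu>"
proof
  obtain z :: 'a where True by simp
  have "(\<Union>n. cball z (real n)) = UNIV"
    by (auto simp: real_arch_simple)
  then show "\<exists>A. countable A \<and> A \<subseteq> sets \<nu> \<and> \<Union> A = space \<nu> \<and> (\<forall>a\<in>A. emeasure \<nu> a \<noteq> \<infinity>)"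
    using fin sets_eq_imp_space_eq[OF sets]
    by (intro exI[of _ "range (\<lambda>n. cball z (real n))"]) (auto simp: sets less_top[symmetric])
qed

text \<open>Two indices of the same point would both be listed in a common region, where the points
  are distinct; \<open>v\<close> itself is not among the points of \<open>c\<close>.\<close>

lemma inj_on_add_point:
  assumes d: "\<And>R :: nat. distinct (pts c (B R))" "\<And>R. finite (idx c (B R))"
    and B: "\<And>n. enat n < fst c \<Longrightarrow> \<exists>R. snd c n \<in> B R"
    and v: "idx c {v} = {}"
  shows "inj_on (snd (add_point v c)) {n. enat n < fst (add_point v c)}"
proof (rule inj_onI)
  fix m n assume mn: "m \<in> {n. enat n < fst (add_point v c)}" "n \<in> {n. enat n < fst (add_point v c)}"
    "snd (add_point v c) m = snd (add_point v c) n"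
  have nv: "snd c k \<noteq> v" if "enat k < fst c" for k
    using v that by (auto simp: idx_def)
  have inj: "k = l" if "enat k < fst c" "enat l < fst c" "snd c k = snd c l" for k l
  proof -
    have "\<exists>R. snd c k \<in> B R" by (rule B[OF that(1)])
    then obtain R where R: "snd c k \<in> B R" by blast
    have "inj_on (snd c) (idx c (B R))"
      using d(1)[of R] d(2)[of R] by (simp add: pts_def distinct_map)
    then show ?thesis using R that by (auto simp: inj_on_def idx_def)
  qed
  show "m = n"
    using mn nv inj by (cases m; cases n) (auto)
qed

text \<open>\<open>bsum\<close> counts indices and \<open>cardinality\<close> counts points;
  injectivity excludes overcounting.\<close>

lemma bcomp_card_le:
  assumes "inj_on (snd (add_point v c)) {n. enat n < fst (add_point v c)}" "finite (idx (add_point v c) B)"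
  shows "bsum (\<lambda>_. 1) \<phi> B (add_point v c) u \<le> cardinality (rcm_component \<phi> (add_point v c) u v)"
proof -
  let ?c = "add_point v c" and ?J = "bcomp \<phi> B (add_point v c) u"
  have "?J \<subseteq> {n. enat n < fst ?c}" by (auto intro: bcomp_subset_component(2))
  then have inj: "inj_on (snd ?c) ?J" using assms(1) by (rule inj_on_subset[rotated])
  have fin: "finite ?J" by (rule finite_bcomp[OF assms(2)])
  have "bsum (\<lambda>_. 1) \<phi> B ?c u = of_nat (card (snd ?c ` ?J))"
    by (simp add: bsum_finite[OF assms(2)] card_image[OF inj])
  also have "\<dots> = emeasure (count_space UNIV) (snd ?c ` ?J)" using fin by simp
  also have "\<dots> \<le> emeasure (count_space UNIV) (rcm_component \<phi> ?c u v)"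
    by (intro emeasure_mono) (auto intro: bcomp_subset_component(1))
  finally show ?thesis by (simp add: cardinality_def)
qed

theorem theorem7p11:
  fixes \<nu> :: "'a::polish_space measure"
    and \<phi> :: "'a \<Rightarrow> 'a \<Rightarrow> real"
    and P :: "real \<Rightarrow> 'w measure"
    and \<eta> :: "'w \<Rightarrow> 'a config"
    and U :: "'w \<Rightarrow> nat \<times> nat \<Rightarrow> real"
    and t :: real
  assumes sets_lambda: "sets \<nu> = sets borel"
    and locally_finite: "\<And>B. B \<in> sets borel \<Longrightarrow> bounded B \<Longrightarrow> emeasure \<nu> B < \<infinity>"
    and diffuse: "\<And>x. emeasure \<nu> {x} = 0"
    and phi_measurable: "case_prod \<phi> \<in> borel_measurable (borel \<Otimes>\<^sub>M borel)"
    and phi_range: "\<And>x y. 0 \<le> \<phi> x y \<and> \<phi> x y \<le> 1"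
    and phi_sym: "\<And>x y. \<phi> x y = \<phi> y x"
    and phi_integrable: "AE x in \<nu>. (\<integral>\<^sup>+ y. ennreal (\<phi> x y) \<partial>\<nu>) < \<infinity>"
    and poisson: "\<And>s. 0 \<le> s \<Longrightarrow> poisson_process (P s) (scale_measure (ennreal s) \<nu>) \<eta>"
    and rcm: "\<And>s v. 0 \<le> s \<Longrightarrow> rcm_marks (P s) (\<lambda>\<omega>. add_point v (\<eta> \<omega>)) U"
    and t_nonneg: "0 \<le> t"
    and t_subcritical: "ennreal t < critical_intensity \<nu> \<phi> P \<eta> U"
    and exp_decay: "\<exists>a>0. \<exists>b>0. eventually
          (\<lambda>r. long_edge_esssup \<nu> \<phi> t r \<le> ennreal (a * exp (- b * r))) at_top"
  shows "\<exists>\<delta>>0. esssup \<nu> (\<lambda>v. \<integral>\<^sup>+ \<omega>. ennexp (ennreal \<delta> * ediameter (cluster \<phi> \<eta> U v \<omega>)) \<partial>P t) < \<infinity>"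
proof -
  note [measurable_cong] = sets_lambda
  have sf: "sigma_finite_measure \<nu>" by (rule sigma_finite_locally_finite[OF sets_lambda locally_finite])
  have space_nu: "space \<nu> = UNIV" using sets_eq_imp_space_eq[OF sets_lambda] by simp
  obtain s where s: "0 \<le> s" "t < s"
    "esssup \<nu> (\<lambda>v. \<integral>\<^sup>+ \<omega>. cardinality (cluster \<phi> \<eta> U v \<omega>) \<partial>P s) < \<infinity>"
  proof -
    obtain s where "0 \<le> s" "ennreal t < ennreal s"
      "esssup \<nu> (\<lambda>v. \<integral>\<^sup>+ \<omega>. cardinality (cluster \<phi> \<eta> U v \<omega>) \<partial>P s) < \<infinity>"
      using t_subcritical unfolding critical_intensity_def less_SUP_iff by blast
    then show ?thesis using that t_nonneg by (auto simp: ennreal_less_iff)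
  qed
  obtain T where T: "0 \<le> T" "esssup \<nu> (\<lambda>v. \<integral>\<^sup>+ \<omega>. cardinality (cluster \<phi> \<eta> U v \<omega>) \<partial>P s) = ennreal T"
    using s(3) by (cases "esssup \<nu> (\<lambda>v. \<integral>\<^sup>+ \<omega>. cardinality (cluster \<phi> \<eta> U v \<omega>) \<partial>P s)") auto
  have AE_T: "AE v in \<nu>. (\<integral>\<^sup>+ \<omega>. cardinality (cluster \<phi> \<eta> U v \<omega>) \<partial>P s) \<le> ennreal T"
    using esssup_AE[where M = \<nu> and f = "\<lambda>v. \<integral>\<^sup>+ \<omega>. cardinality (cluster \<phi> \<eta> U v \<omega>) \<partial>P s"] by (simp add: T)
  obtain a b where ab: "0 < a" "0 < b"
    "eventually (\<lambda>r. long_edge_esssup \<nu> \<phi> t r \<le> ennreal (a * exp (- b * r))) at_top"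
    using exp_decay by blast
  have "((\<lambda>r. a * exp (- b * r)) \<longlongrightarrow> 0) at_top"
    using ab(2) by real_asymp
  \<comment> \<open>The threshold \<open>1 / 2\<close> is the one required by
    \<open>long_edge_prob_le\<close>.\<close>
  then have "eventually (\<lambda>r. a * exp (- b * r) < 1 / 2) at_top"
    by (rule order_tendstoD) simp
  with ab(3) have "eventually (\<lambda>r. long_edge_esssup \<nu> \<phi> t r \<le> ennreal (a * exp (- b * r)) \<and> a * exp (- b * r) < 1 / 2) at_top"
    by eventually_elim simp
  then obtain r0 where r0: "\<And>r. r0 \<le> r \<Longrightarrow> long_edge_esssup \<nu> \<phi> t r \<le> ennreal (a * exp (- b * r)) \<and> a * exp (- b * r) < 1 / 2"
    unfolding eventually_at_top_linorder by blast
  obtain n0 :: nat where n0: "r0 \<le> real n0" using real_arch_simple by blast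
  \<comment> \<open>Integer radii suffice for \<open>moment_bound\<close> and leave only countably
    many null sets to unite.\<close>
  have AE_tail: "AE v in \<nu>. \<forall>n. n0 \<le> n \<longrightarrow> ennreal t * (\<integral>\<^sup>+x\<in>{x. dist v x > real n}. ennreal (\<phi> v x) \<partial>\<nu>) \<le>
      ennreal (2 * (a * exp (- b * real n)))"
    unfolding AE_all_countable
  proof
    fix n :: nat
    show "AE v in \<nu>. n0 \<le> n \<longrightarrow> ennreal t * (\<integral>\<^sup>+x\<in>{x. dist v x > real n}. ennreal (\<phi> v x) \<partial>\<nu>) \<le>
      ennreal (2 * (a * exp (- b * real n)))"
    proof (cases "n0 \<le> n")
      case True
      then have n: "long_edge_esssup \<nu> \<phi> t n \<le> ennreal (a * exp (- b * n))" "a * exp (- b * n) < 1 / 2"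
        using r0[of n] n0 by auto
      have "AE v in \<nu>. long_edge_prob \<nu> \<phi> t v n \<le> long_edge_esssup \<nu> \<phi> t n"
        unfolding long_edge_esssup_def by (rule esssup_AE)
      then show ?thesis
      proof eventually_elim
        case (elim v)
        from order.trans[OF elim n(1)] show ?case
          using ab(1) n(2) by (intro impI long_edge_prob_le) auto
      qed
    qed auto
  qed
  have "AE v in \<nu>. (\<integral>\<^sup>+ \<omega>. cardinality (cluster \<phi> \<eta> U v \<omega>) \<partial>P s) \<le> ennreal T \<and>
      (\<forall>n. n0 \<le> n \<longrightarrow> ennreal t * (\<integral>\<^sup>+x\<in>{x. dist v x > real n}. ennreal (\<phi> v x) \<partial>\<nu>) \<le>
      ennreal (2 * (a * exp (- b * real n))))"
    using AE_T AE_tail by eventually_elim simp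
  then obtain N where N: "N \<in> null_sets \<nu>" and Nbad: "{v\<in>space \<nu>. \<not> ((\<integral>\<^sup>+ \<omega>. cardinality (cluster \<phi> \<eta> U v \<omega>) \<partial>P s) \<le> ennreal T \<and>
      (\<forall>n. n0 \<le> n \<longrightarrow> ennreal t * (\<integral>\<^sup>+x\<in>{x. dist v x > real n}. ennreal (\<phi> v x) \<partial>\<nu>) \<le>
      ennreal (2 * (a * exp (- b * real n)))))} \<subseteq> N"
    by (auto simp: eventually_ae_filter)
  \<comment> \<open>The two bounds now hold at every point of \<open>S\<close>, as the exploration
    demands. Confining the regions to \<open>S\<close> costs nothing, since almost surely no point
    of the process lies in \<open>N\<close>.\<close>
  define S where "S = - N"
  have N_borel [measurable]: "N \<in> sets borel" using N sets_lambda by auto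
  have S_borel [measurable]: "S \<in> sets borel" unfolding S_def by (simp add: Compl_eq_Diff_UNIV)
  have S_card: "(\<integral>\<^sup>+ \<omega>. cardinality (cluster \<phi> \<eta> U v \<omega>) \<partial>P s) \<le> ennreal T" if "v \<in> S" for v
    using Nbad that space_nu by (auto simp: S_def)
  have S_tail: "ennreal t * (\<integral>\<^sup>+x\<in>{x. dist v x > real n}. ennreal (\<phi> v x) \<partial>\<nu>) \<le>
      ennreal (2 * (a * exp (- b * real n)))" if "v \<in> S" "n0 \<le> n" for v n
    using Nbad that space_nu by (auto simp: S_def)
  obtain z0 :: 'a where True by simp
  define B where "B R = ball z0 (real R) \<inter> S" for R :: nat
  have B_borel: "B R \<in> sets borel" for R unfolding B_def by measurable
  have B_fin: "emeasure \<nu> (B R) < \<infinity>" for R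
    by (rule locally_finite[OF B_borel]) (auto simp: B_def intro: bounded_subset[OF bounded_ball])
  have B_inc: "incseq B" unfolding B_def incseq_def by auto
  have B_cover: "\<exists>R. x \<in> B R" if "x \<in> S" for x
    using that reals_Archimedean2[of "dist z0 x"] by (auto simp: B_def)
  \<comment> \<open>The exceptional events are coinciding points, a point at \<open>v\<close>, a
    point in \<open>N\<close>, and infinitely many points in some region. Outside them points and
    indices correspond one to one.\<close>
  have good: "AE \<omega> in P q. inj_on (snd (add_point v (\<eta> \<omega>))) {n. enat n < fst (add_point v (\<eta> \<omega>))} \<and>
      (\<forall>n. enat n < fst (\<eta> \<omega>) \<longrightarrow> snd (\<eta> \<omega>) n \<in> S) \<and> (\<forall>R. finite (idx (\<eta> \<omega>) (B R)))"
    if q: "0 \<le> q" for q v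
  proof -
    note pp = poisson[OF q]
    have sl: "sets (scale_measure (ennreal q) \<nu>) = sets borel" by (simp add: sets_lambda)
    have Bf: "emeasure (scale_measure (ennreal q) \<nu>) (B R) < \<infinity>" for R
      using B_fin by (simp add: ennreal_mult_less_top)
    have 1: "AE \<omega> in P q. \<forall>R. distinct (pts (\<eta> \<omega>) (B R))"
      unfolding AE_all_countable
    proof
      fix R show "AE \<omega> in P q. distinct (pts (\<eta> \<omega>) (B R))"
        by (rule AE_distinct_pts[OF pp sl B_borel Bf]) (simp add: diffuse)
    qed
    have 2: "AE \<omega> in P q. \<forall>R. finite (idx (\<eta> \<omega>) (B R))"
      unfolding AE_all_countable using AE_finite_idx[OF pp sl B_borel Bf] by blast
    have 3: "AE \<omega> in P q. idx (\<eta> \<omega>) N = {}"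
      by (rule AE_no_points[OF pp sl N_borel]) (use N in auto)
    have 4: "AE \<omega> in P q. idx (\<eta> \<omega>) {v} = {}"
      by (rule AE_no_points[OF pp sl]) (auto simp: diffuse)
    from 1 2 3 4 show ?thesis
    proof eventually_elim
      case (elim \<omega>)
      have in_S: "snd (\<eta> \<omega>) n \<in> S" if "enat n < fst (\<eta> \<omega>)" for n
        using elim(3) that by (auto simp: idx_def S_def)
      then show ?case
        using inj_on_add_point[of "\<eta> \<omega>" B v] elim B_cover by blast
    qed
  qed
  have fin_add: "finite (idx (add_point v c) A)" if "finite (idx c A)" for v A and c :: "'a config"
    using idx_add_point[of v c A] that by (metis finite_Diff2 finite.emptyI finite_imageI finite_insert)
  have mean: "(\<integral>\<^sup>+\<omega>. bsum f \<phi> (B R) (add_point v (\<eta> \<omega>)) (U \<omega>) \<partial>P q) =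
    pois_avg \<nu> (\<lambda>x. ennreal q * indicator (B R) x) (\<lambda>X. full \<phi> f v X)" if "0 \<le> q" "f \<in> borel_measurable borel" for q v R f
    by (rule nn_integral_bsum[OF sets_lambda sf phi_range phi_measurable that(2) poisson[OF that(1)] _ rcm[OF that(1)] B_borel B_fin]) simp
  have count: "pois_avg \<nu> (\<lambda>x. ennreal s * indicator (B R) x) (\<lambda>X. full \<phi> (\<lambda>_. 1) v X) \<le> ennreal T" if v: "v \<in> S" for R v
  proof -
    have "(\<integral>\<^sup>+\<omega>. bsum (\<lambda>_. 1) \<phi> (B R) (add_point v (\<eta> \<omega>)) (U \<omega>) \<partial>P s) \<le> (\<integral>\<^sup>+ \<omega>. cardinality (cluster \<phi> \<eta> U v \<omega>) \<partial>P s)"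
    proof (rule nn_integral_mono_AE)
      show "AE \<omega> in P s. bsum (\<lambda>_. 1) \<phi> (B R) (add_point v (\<eta> \<omega>)) (U \<omega>) \<le> cardinality (cluster \<phi> \<eta> U v \<omega>)"
        using good[OF s(1), of v]
        by eventually_elim (auto simp: cluster_def intro!: bcomp_card_le fin_add)
    qed
    also have "\<dots> \<le> ennreal T" by (rule S_card[OF v])
    finally show ?thesis by (simp add: mean[OF s(1)])
  qed
  obtain \<delta> where \<delta>: "0 < \<delta>"
    "\<And>R v. v \<in> S \<Longrightarrow> pois_avg \<nu> (\<lambda>x. ennreal t * indicator (B R) x) (\<lambda>X. full \<phi> (wexp \<delta> v) v X) \<le> ennreal (2 * T)"
  proof -
    have "\<exists>\<delta>>0. \<forall>R. \<forall>v\<in>S. pois_avg \<nu> (\<lambda>x. ennreal t * indicator (B R) x) (\<lambda>X. full \<phi> (wexp \<delta> v) v X) \<le> ennreal (2 * T)"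
    proof (rule uniform_weighted_bound[OF sets_lambda sf phi_measurable phi_range B_borel B_fin _ t_nonneg _ _ count S_tail ab(1,2) T(1)])
      show "B R \<subseteq> S" for R by (simp add: B_def)
      show "t \<le> s" "0 < s" using s t_nonneg by auto
    qed
    then show ?thesis using that by blast
  qed
  let ?I = "\<lambda>v. \<integral>\<^sup>+ \<omega>. ennexp (ennreal (\<delta> / 2) * ediameter (cluster \<phi> \<eta> U v \<omega>)) \<partial>P t"
  have eta [measurable]: "\<eta> \<in> P t \<rightarrow>\<^sub>M config_algebra"
    by (rule poisson_processD(2)[OF poisson[OF t_nonneg]])
  have U_meas [measurable]: "U \<in> P t \<rightarrow>\<^sub>M PiM UNIV (\<lambda>_. borel)"
    using rcm[OF t_nonneg] by (auto simp: rcm_marks_def)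
  interpret Pt: prob_space "P t" by (rule poisson_processD(1)[OF poisson[OF t_nonneg]])
  have bound: "?I v \<le> ennreal (2 * T)" if v: "v \<in> S" for v
  proof -
    let ?b = "\<lambda>R \<omega>. bsum (wexp \<delta> v) \<phi> (B R) (add_point v (\<eta> \<omega>)) (U \<omega>)"
    have xi: "(\<lambda>\<omega>. add_point v (\<eta> \<omega>)) \<in> P t \<rightarrow>\<^sub>M config_algebra"
      using rcm[OF t_nonneg, of v] by (simp add: rcm_marks_def)
    have b_meas: "?b R \<in> borel_measurable (P t)" for R
      using measurable_compose[OF measurable_Pair[OF xi U_meas] measurable_bsum[OF phi_measurable B_borel wexp_v]] by simp
    have b_inc: "incseq (\<lambda>R. ?b R \<omega>)" for \<omega>
      unfolding incseq_def bsum_def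
      by (intro allI impI suminf_le mult_left_mono)
        (auto simp: indicator_def dest: subsetD[OF bcomp_mono[OF incseqD[OF B_inc]]])
    have "?I v \<le> (\<integral>\<^sup>+\<omega>. (SUP R. ?b R \<omega>) \<partial>P t)"
    proof (rule nn_integral_mono_AE)
      show "AE \<omega> in P t. ennexp (ennreal (\<delta> / 2) * ediameter (cluster \<phi> \<eta> U v \<omega>)) \<le> (SUP R. ?b R \<omega>)"
        using good[OF t_nonneg, of v]
      proof eventually_elim
        case (elim \<omega>)
        show ?case
        proof (rule ennexp_ediameter_le[OF \<delta>(1), of v])
          show "v \<in> cluster \<phi> \<eta> U v \<omega>" by (simp add: cluster_def rcm_component_def)
        next
          fix x assume "x \<in> cluster \<phi> \<eta> U v \<omega>"
          then obtain R i where i: "i \<in> bcomp \<phi> (B R) (add_point v (\<eta> \<omega>)) (U \<omega>)" "snd (add_point v (\<eta> \<omega>)) i = x"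
            using component_in_bcomp[of v "\<eta> \<omega>" B x \<phi> "U \<omega>"] elim B_cover B_inc unfolding cluster_def by blast
          \<comment> \<open>The weight of a single cluster point is one term of the total weight in
            a region that contains a path to it.\<close>
          have "wexp \<delta> v x = (\<Sum>j\<in>{i}. wexp \<delta> v (snd (add_point v (\<eta> \<omega>)) j) * indicator (bcomp \<phi> (B R) (add_point v (\<eta> \<omega>)) (U \<omega>)) j)"
            using i by simp
          also have "\<dots> \<le> ?b R \<omega>"
            unfolding bsum_def by (rule sum_le_suminf) auto
          also have "\<dots> \<le> (SUP R. ?b R \<omega>)" by (rule SUP_upper) simp
          finally show "wexp \<delta> v x \<le> (SUP R. ?b R \<omega>)" .
        qed
      qed
    qed
    also have "\<dots> = (SUP R. \<integral>\<^sup>+\<omega>. ?b R \<omega> \<partial>P t)"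
      by (rule nn_integral_monotone_convergence_SUP) (use b_inc b_meas in \<open>auto simp: incseq_def le_fun_def\<close>)
    also have "\<dots> \<le> ennreal (2 * T)"
      by (rule SUP_least) (simp only: mean[OF t_nonneg wexp_v] \<delta>(2)[OF v])
    finally show ?thesis .
  qed
  \<comment> \<open>\<open>esssup\<close> is \<open>top\<close> on functions that are not
    measurable, so a bound for almost every \<open>v\<close> is not enough. Joint measurability in
    \<open>v\<close> and \<open>\<omega>\<close> gives measurability of the integral.\<close>
  have I_meas: "?I \<in> borel_measurable \<nu>"
  proof -
    let ?M = "\<nu> \<Otimes>\<^sub>M P t" and ?C = "\<lambda>z. add_point (fst z) (\<eta> (snd z))"
    have eta2: "(\<lambda>z. \<eta> (snd z)) \<in> ?M \<rightarrow>\<^sub>M config_algebra" by measurable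
    have x: "(\<lambda>z. snd (?C z) n) \<in> ?M \<rightarrow>\<^sub>M (borel :: 'a measure)" for n
    proof (cases n)
      case 0
      have "fst \<in> ?M \<rightarrow>\<^sub>M \<nu>" by measurable
      then show ?thesis by (simp add: 0 measurable_cong_sets[OF refl sets_lambda])
    next
      case (Suc m)
      then show ?thesis using measurable_compose[OF eta2 measurable_snd_config[of m]] by simp
    qed
    have k: "(\<lambda>z. fst (?C z)) \<in> ?M \<rightarrow>\<^sub>M count_space UNIV"
      using measurable_compose[OF measurable_compose[OF eta2 measurable_fst_config],
          of eSuc "count_space UNIV"] by (simp add: add_point_def)
    have u: "(\<lambda>z. U (snd z) e) \<in> ?M \<rightarrow>\<^sub>M (borel :: real measure)" for e
      by (rule measurable_compose[OF measurable_compose[OF measurable_snd U_meas] measurable_PiM_UNIV_component])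
    have [measurable]: "(\<lambda>z. ediameter (cluster \<phi> \<eta> U (fst z) (snd z))) \<in> borel_measurable ?M"
      using measurable_ediameter_component[OF phi_measurable x k u] by (simp add: cluster_def)
    have "(\<lambda>z. ennexp (ennreal (\<delta> / 2) * ediameter (cluster \<phi> \<eta> U (fst z) (snd z)))) \<in> borel_measurable ?M"
      by measurable
    then show ?thesis
      by (intro Pt.borel_measurable_nn_integral) (simp add: split_beta')
  qed
  have "AE v in \<nu>. ?I v \<le> ennreal (2 * T)"
    using AE_not_in[OF N] by eventually_elim (auto intro: bound simp: S_def)
  then have "esssup \<nu> ?I \<le> ennreal (2 * T)"
    unfolding esssup_eq_AE[OF I_meas] by (intro Inf_lower) simp
  then have "esssup \<nu> ?I < \<infinity>" by (rule le_less_trans) simp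
  then show ?thesis using \<delta>(1) by (intro exI[of _ "\<delta> / 2"]) simp
qed

end
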